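(* Let $\mathbf{g}$ be a hyperbolic Darboux integrable Lorentzian metric with a timelike Killing field on $M$. Then, up to local coordinate transformations on $M$ and multiplication of the metric by a positive constant, $\mathbf{g}$ is locally equivalent to one of the following: 1. $\mathbf{g}=\sinh^2u\,(dv)^2-\cosh^4u\,(du)^2$, with $K=-\operatorname{sech}^4u$; 2. $\mathbf{g}=\cosh^2u\,(dv)^2-\sinh^4u\,(du)^2$, with $K=-\operatorname{csch}^4u$; 3. $\mathbf{g}=u^2\left((dv)^2-(du)^2\right)$, with $K=-u^{-4}$.
   Context: $M$ is a Lorentzian surface with orthonormal frame bundle $\mathcal{F}_M$, canonical dual forms $\eta^1,\eta^2$ (so $\mathbf{g}=(\eta^1)^2-(\eta^2)^2$) and connection form $\eta^1_2=\eta^2_1$ satisfying $$d\eta^1=-\eta^1_2\wedge\eta^2,\quad d\eta^2=-\eta^2_1\wedge\eta^1,\quad d\eta^1_2=-K\,\eta^1\wedge\eta^2,$$ which fixes the sign convention for the Gauss curvature $K$. The metric is elliptic if $K>0$ and hyperbolic if $K<0$. A vector $X$ is spacelike if $\langle X,X\rangle<0$ and timelike if $\langle X,X\rangle>0$. The Killing field meant is $V=q_1e_2-q_2e_1$, where $q=|K|^{-3/4}$, $dq=q_1\eta^1+q_2\eta^2$ and $(e_1,e_2)$ is the orthonormal framing dual to $(\eta^1,\eta^2)$ ($V$ is a Killing field whenever $\mathbf{g}$ is Darboux integrable). $\mathbb{R}^{1,2}$ is $\mathbb{R}^3$ with inner product of signature $(1,2)$. $\mathcal{F}_{\mathbb{R}^{1,2}}$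 is the bundle of orthonormal frames $(e_1,e_2,e_3)$ with $\langle e_1,e_1\rangle=1$, $\langle e_2,e_2\rangle=\langle e_3,e_3\rangle=-1$, $\langle e_a,e_b\rangle=0$ for $a\ne b$; with basepoint map $\rho$, its canonical and connection forms are defined by $d\rho=e_i\omega^i$, $de_i=e_j\omega^j_i$. The isometric embedding system $\mathcal{I}$ is the Pfaffian exterior differential system on $\mathcal{F}_M\times\mathcal{F}_{\mathbb{R}^{1,2}}$ generated by $\theta_0=\omega^3$, $\theta_1=\omega^1-\eta^1$, $\theta_2=\omega^2-\eta^2$, $\theta_3=\omega^1_2-\eta^1_2$. Put $k=\sqrt{|K|}$. If $K<0$, its singular systems are $V_\pm=\operatorname{span}\{\theta_0,\theta_1,\theta_2,\theta_3,\omega^3_1\mp k\eta^2,\omega^3_2\pm k\eta^1\}$; if $K>0$, they are $W=\operatorname{span}_{\mathbb{C}}\{\theta_0,\theta_1,\theta_2,\theta_3,\omega^3_1-\mathrm{i}k\eta^2,\omega^3_2+\mathrm{i}k\eta^1\}$ in the complexified cotangent bundle and its conjugate $\overline{W}$. The metric $\mathbf{g}$ is Darboux integrable if, locally, each of the two singular systems contains a (real, respectively complex) Frobenius subbundle of rank at least $2$ that intersects the span of $\theta_0,\theta_1,\theta_2,\theta_3$ only in $0$. *)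

theory Defs
  imports "HOL-Analysis.Analysis"
begin

subsection \<open>Smooth maps and differential 1-forms\<close>

text \<open>On an open set, \<open>C_k_on k S f\<close> says that \<open>f\<close> is $k$ times continuously differentiable,
  phrased through iterated directional derivatives.\<close>

primrec C_k_on ::
  "nat \<Rightarrow> 'a::euclidean_space set \<Rightarrow> ('a \<Rightarrow> 'b::real_normed_vector) \<Rightarrow> bool" where
  "C_k_on 0 S f \<longleftrightarrow> continuous_on S f"
| "C_k_on (Suc k) S f \<longleftrightarrow> (\<forall>x\<in>S. f differentiable (at x)) \<and>
     (\<forall>v. C_k_on k S (\<lambda>x. frechet_derivative f (at x) v))"

definition smooth_on :: "'a::euclidean_space set \<Rightarrow> ('a \<Rightarrow> 'b::real_normed_vector) \<Rightarrow> bool" where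
  "smooth_on S f \<longleftrightarrow> (\<forall>k. C_k_on k S f)"

text \<open>A manifold is treated below as a submanifold \<open>N\<close> of a Euclidean space \<open>'e\<close>.  A 1-form on
  \<open>N\<close> is given by a 1-form on an open subset of \<open>'e\<close>, i.e. a map taking a base point and a vector
  to a scalar; only its values on vectors tangent to \<open>N\<close> are ever used.  The scalars \<open>'k\<close> are
  \<open>real\<close>, or \<open>complex\<close> for sections of the complexified cotangent bundle.  The differential of the
  ambient form, restricted to tangent vectors of \<open>N\<close>, is the differential of the restricted form.\<close>

type_synonym ('e, 'k) form = "'e \<Rightarrow> 'e \<Rightarrow> 'k"

definition smooth_form ::
  "'e::euclidean_space set \<Rightarrow> ('e, 'k::real_normed_field) form \<Rightarrow> bool" where
  "smooth_form W \<alpha> \<longleftrightarrow> (\<forall>p\<in>W. linear (\<alpha> p)) \<and> (\<forall>v. smooth_on W (\<lambda>p. \<alpha> p v))"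

definition tangent_vectors :: "'e::euclidean_space set \<Rightarrow> 'e \<Rightarrow> 'e set" where
  "tangent_vectors N p =
     {v. \<exists>\<gamma>::real \<Rightarrow> 'e. (\<forall>t. \<gamma> t \<in> N) \<and> \<gamma> 0 = p \<and> (\<gamma> has_vector_derivative v) (at 0)}"

definition ext_deriv ::
  "('e::euclidean_space, 'k::real_normed_field) form \<Rightarrow> 'e \<Rightarrow> 'e \<Rightarrow> 'e \<Rightarrow> 'k" where
  "ext_deriv \<alpha> p u v =
     frechet_derivative (\<lambda>y. \<alpha> y v) (at p) u - frechet_derivative (\<lambda>y. \<alpha> y u) (at p) v"

definition wedge :: "('e \<Rightarrow> 'k::real_normed_field) \<Rightarrow> ('e \<Rightarrow> 'k) \<Rightarrow> 'e \<Rightarrow> 'e \<Rightarrow> 'k" where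
  "wedge \<xi> \<zeta> u v = \<xi> u * \<zeta> v - \<xi> v * \<zeta> u"


subsection \<open>Pfaffian systems and Frobenius subbundles\<close>

definition in_span_at ::
  "'e::euclidean_space set \<Rightarrow> ('e, 'k::real_normed_field) form list \<Rightarrow> 'e \<Rightarrow> ('e \<Rightarrow> 'k) \<Rightarrow> bool" where
  "in_span_at N gs p \<xi> \<longleftrightarrow>
     (\<exists>c. \<forall>v\<in>tangent_vectors N p. \<xi> v = (\<Sum>i<length gs. c i * (gs ! i) p v))"

definition independent_at ::
  "'e::euclidean_space set \<Rightarrow> nat \<Rightarrow> (nat \<Rightarrow> ('e, 'k::real_normed_field) form) \<Rightarrow> 'e \<Rightarrow> bool" where
  "independent_at N r \<alpha> p \<longleftrightarrow>
     (\<forall>c. (\<forall>v\<in>tangent_vectors N p. (\<Sum>i<r. c i * \<alpha> i p v) = 0) \<longrightarrow> (\<forall>i<r. c i = 0))"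

text \<open>The forms \<open>\<alpha> 0, \<dots>, \<alpha> (r - 1)\<close> are a frame, over the open piece \<open>N \<inter> W\<close> of \<open>N\<close>, of a rank
  \<open>r\<close> subbundle of the (complexified) cotangent bundle; it is Frobenius if each differential of a
  frame element is a combination \<open>\<Sum>j. \<beta> j \<and> \<alpha> j\<close> (exterior products) at every point.\<close>

definition frobenius_frame ::
  "'e::euclidean_space set \<Rightarrow> 'e set \<Rightarrow> nat \<Rightarrow> (nat \<Rightarrow> ('e, 'k::real_normed_field) form) \<Rightarrow> bool" where
  "frobenius_frame N W r \<alpha> \<longleftrightarrow>
     (\<forall>i<r. smooth_form W (\<alpha> i)) \<and>
     (\<forall>p\<in>N \<inter> W. independent_at N r \<alpha> p \<and>
        (\<forall>i<r. \<exists>\<beta>. (\<forall>j<r. linear (\<beta> j)) \<and>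
           (\<forall>u\<in>tangent_vectors N p. \<forall>v\<in>tangent_vectors N p.
              ext_deriv (\<alpha> i) p u v = (\<Sum>j<r. wedge (\<beta> j) (\<alpha> j p) u v))))"

text \<open>Locally on \<open>N\<close>, the span of \<open>gs\<close> contains a Frobenius subbundle of rank at least 2 that
  meets the span of \<open>\<theta>s\<close> only in 0.\<close>

definition has_transverse_frobenius ::
  "'e::euclidean_space set \<Rightarrow> ('e, 'k::real_normed_field) form list \<Rightarrow> ('e, 'k) form list \<Rightarrow> bool" where
  "has_transverse_frobenius N \<theta>s gs \<longleftrightarrow>
     (\<forall>p\<in>N. \<exists>W r \<alpha>. open W \<and> p \<in> W \<and> 2 \<le> r \<and> frobenius_frame N W r \<alpha> \<and>
        (\<forall>y\<in>N \<inter> W.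
           (\<forall>i<r. in_span_at N gs y (\<alpha> i y)) \<and>
           (\<forall>c. in_span_at N \<theta>s y (\<lambda>v. \<Sum>i<r. c i * \<alpha> i y v) \<longrightarrow>
              (\<forall>v\<in>tangent_vectors N y. (\<Sum>i<r. c i * \<alpha> i y v) = 0))))"


subsection \<open>Lorentzian surfaces\<close>

text \<open>A chart \<open>(U, \<phi>)\<close>; the values of \<open>\<phi>\<close> outside \<open>U\<close> are irrelevant.\<close>

type_synonym 'a chart = "'a set \<times> ('a \<Rightarrow> real^2)"

definition chart_domain :: "'a chart \<Rightarrow> (real^2) set" where
  "chart_domain c = snd c ` fst c"

definition chart_inv :: "'a chart \<Rightarrow> real^2 \<Rightarrow> 'a" where
  "chart_inv c = inv_into (fst c) (snd c)"

definition is_chart :: "'a topology \<Rightarrow> 'a chart \<Rightarrow> bool" where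
  "is_chart X c \<longleftrightarrow> openin X (fst c) \<and> open (chart_domain c) \<and>
     homeomorphic_map (subtopology X (fst c)) (top_of_set (chart_domain c)) (snd c)"

definition transition :: "'a chart \<Rightarrow> 'a chart \<Rightarrow> real^2 \<Rightarrow> real^2" where
  "transition c c' = snd c' \<circ> chart_inv c"

definition compatible :: "'a chart \<Rightarrow> 'a chart \<Rightarrow> bool" where
  "compatible c c' \<longleftrightarrow>
     smooth_on (snd c ` (fst c \<inter> fst c')) (transition c c') \<and>
     smooth_on (snd c' ` (fst c \<inter> fst c')) (transition c' c)"

text \<open>A smooth surface carries a maximal atlas, so that every local coordinate system of the
  surface is one of its charts.\<close>

definition smooth_surface :: "'a topology \<Rightarrow> 'a chart set \<Rightarrow> bool" where
  "smooth_surface X A \<longleftrightarrow>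
     Hausdorff_space X \<and> second_countable X \<and>
     (\<forall>c\<in>A. is_chart X c) \<and> (\<Union>c\<in>A. fst c) = topspace X \<and>
     (\<forall>c\<in>A. \<forall>c'\<in>A. compatible c c') \<and>
     (\<forall>c. is_chart X c \<and> (\<forall>c'\<in>A. compatible c c') \<longrightarrow> c \<in> A)"

text \<open>A metric is given by its local expressions: \<open>g c x\<close> is the bilinear form at the point of the
  surface with coordinates \<open>x\<close> in the chart \<open>c\<close>, expressed in these coordinates.\<close>

type_synonym local_metric = "real^2 \<Rightarrow> real^2 \<Rightarrow> real^2 \<Rightarrow> real"

definition orthonormal_pair :: "local_metric \<Rightarrow> real^2 \<Rightarrow> real^2 \<Rightarrow> real^2 \<Rightarrow> bool" where
  "orthonormal_pair g x e1 e2 \<longleftrightarrow> g x e1 e1 = 1 \<and> g x e2 e2 = -1 \<and> g x e1 e2 = 0"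

definition lorentzian_metric :: "'a chart set \<Rightarrow> ('a chart \<Rightarrow> local_metric) \<Rightarrow> bool" where
  "lorentzian_metric A g \<longleftrightarrow>
     (\<forall>c\<in>A. (\<forall>a b. smooth_on (chart_domain c) (\<lambda>x. g c x a b)) \<and>
        (\<forall>x\<in>chart_domain c. bilinear (g c x) \<and> (\<forall>a b. g c x a b = g c x b a) \<and>
           (\<exists>e1 e2. orthonormal_pair (g c) x e1 e2))) \<and>
     (\<forall>c\<in>A. \<forall>c'\<in>A. \<forall>x\<in>snd c ` (fst c \<inter> fst c'). \<forall>a b.
        g c x a b = g c' (transition c c' x)
          (frechet_derivative (transition c c') (at x) a)
          (frechet_derivative (transition c c') (at x) b))"


subsection \<open>The orthonormal frame bundle of a surface\<close>

text \<open>Over the domain \<open>D\<close> of a chart, a frame is \<open>(x, e\<^sub>1, e\<^sub>2)\<close> with base point \<open>x\<close>.\<close>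

type_synonym frame2 = "(real^2) \<times> (real^2) \<times> (real^2)"

definition frame_bundle :: "(real^2) set \<Rightarrow> local_metric \<Rightarrow> frame2 set" where
  "frame_bundle D g = {(x, e1, e2). x \<in> D \<and> orthonormal_pair g x e1 e2}"

text \<open>The canonical forms: \<open>dx = e\<^sub>1 \<eta>\<^sup>1 + e\<^sub>2 \<eta>\<^sup>2\<close>, solved for \<open>\<eta>\<^sup>1, \<eta>\<^sup>2\<close> by pairing with
  \<open>e\<^sub>1\<close> (of square 1) and \<open>e\<^sub>2\<close> (of square -1).\<close>

fun eta1 :: "local_metric \<Rightarrow> (frame2, real) form" where
  "eta1 g (x, e1, e2) (dx, de1, de2) = g x dx e1"

fun eta2 :: "local_metric \<Rightarrow> (frame2, real) form" where
  "eta2 g (x, e1, e2) (dx, de1, de2) = - g x dx e2"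

text \<open>The structure equations, which determine the connection form \<open>\<eta>\<^sup>1\<^sub>2 = \<eta>\<^sup>2\<^sub>1\<close> (here \<open>\<omega>\<close>, as a form
  on the frame bundle) and the Gauss curvature \<open>K\<close>.\<close>

definition structure_equations ::
  "(real^2) set \<Rightarrow> local_metric \<Rightarrow> (frame2, real) form \<Rightarrow> (real^2 \<Rightarrow> real) \<Rightarrow> bool" where
  "structure_equations D g \<omega> K \<longleftrightarrow>
     smooth_form (D \<times> UNIV) \<omega> \<and>
     (\<forall>p\<in>frame_bundle D g. \<forall>u\<in>tangent_vectors (frame_bundle D g) p.
        \<forall>v\<in>tangent_vectors (frame_bundle D g) p.
          ext_deriv (eta1 g) p u v = - wedge (\<omega> p) (eta2 g p) u v \<and>
          ext_deriv (eta2 g) p u v = - wedge (\<omega> p) (eta1 g p) u v \<and>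
          ext_deriv \<omega> p u v = - K (fst p) * wedge (eta1 g p) (eta2 g p) u v)"

definition connection_and_curvature ::
  "'a chart set \<Rightarrow> ('a chart \<Rightarrow> local_metric) \<Rightarrow> ('a chart \<Rightarrow> (frame2, real) form) \<Rightarrow>
     ('a \<Rightarrow> real) \<Rightarrow> bool" where
  "connection_and_curvature A g \<omega> K \<longleftrightarrow>
     (\<forall>c\<in>A. structure_equations (chart_domain c) (g c) (\<omega> c) (K \<circ> chart_inv c))"

definition hyperbolic :: "'a topology \<Rightarrow> ('a \<Rightarrow> real) \<Rightarrow> bool" where
  "hyperbolic X K \<longleftrightarrow> (\<forall>p\<in>topspace X. K p < 0)"

definition elliptic :: "'a topology \<Rightarrow> ('a \<Rightarrow> real) \<Rightarrow> bool" where
  "elliptic X K \<longleftrightarrow> (\<forall>p\<in>topspace X. K p > 0)"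


subsection \<open>The orthonormal frame bundle of Minkowski space\<close>

definition mink :: "real^3 \<Rightarrow> real^3 \<Rightarrow> real" where
  "mink a b = a $ 1 * b $ 1 - a $ 2 * b $ 2 - a $ 3 * b $ 3"

text \<open>A frame is \<open>(\<rho>, e\<^sub>1, e\<^sub>2, e\<^sub>3)\<close> with base point \<open>\<rho>\<close>.\<close>

type_synonym frame3 = "(real^3) \<times> (real^3) \<times> (real^3) \<times> (real^3)"

definition mink_frame_bundle :: "frame3 set" where
  "mink_frame_bundle = {(\<rho>, e1, e2, e3).
     mink e1 e1 = 1 \<and> mink e2 e2 = -1 \<and> mink e3 e3 = -1 \<and>
     mink e1 e2 = 0 \<and> mink e1 e3 = 0 \<and> mink e2 e3 = 0}"

text \<open>\<open>d\<rho> = e\<^sub>i \<omega>\<^sup>i\<close> and \<open>de\<^sub>i = e\<^sub>j \<omega>\<^sup>j\<^sub>i\<close>, solved for the forms by pairing with the frame vectors.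
  Below \<open>omega_12\<close> is \<open>\<omega>\<^sup>1\<^sub>2\<close>, \<open>omega_31\<close> is \<open>\<omega>\<^sup>3\<^sub>1\<close> and \<open>omega_32\<close> is \<open>\<omega>\<^sup>3\<^sub>2\<close>.\<close>

fun omega1 omega2 omega3 omega_12 omega_31 omega_32 :: "(frame3, real) form" where
  "omega1 (\<rho>, e1, e2, e3) (d\<rho>, de1, de2, de3) = mink d\<rho> e1"
| "omega2 (\<rho>, e1, e2, e3) (d\<rho>, de1, de2, de3) = - mink d\<rho> e2"
| "omega3 (\<rho>, e1, e2, e3) (d\<rho>, de1, de2, de3) = - mink d\<rho> e3"
| "omega_12 (\<rho>, e1, e2, e3) (d\<rho>, de1, de2, de3) = mink de2 e1"
| "omega_31 (\<rho>, e1, e2, e3) (d\<rho>, de1, de2, de3) = - mink de1 e3"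
| "omega_32 (\<rho>, e1, e2, e3) (d\<rho>, de1, de2, de3) = - mink de2 e3"


subsection \<open>The isometric embedding system and Darboux integrability\<close>

definition lift1 :: "(frame2, real) form \<Rightarrow> (frame2 \<times> frame3, 'k::real_normed_field) form" where
  "lift1 \<alpha> p v = of_real (\<alpha> (fst p) (fst v))"

definition lift2 :: "(frame3, real) form \<Rightarrow> (frame2 \<times> frame3, 'k::real_normed_field) form" where
  "lift2 \<alpha> p v = of_real (\<alpha> (snd p) (snd v))"

definition embedding_system ::
  "local_metric \<Rightarrow> (frame2, real) form \<Rightarrow> (frame2 \<times> frame3, 'k::real_normed_field) form list" where
  "embedding_system g \<omega> =
     [\<lambda>p v. lift2 omega3 p v,
      \<lambda>p v. lift2 omega1 p v - lift1 (eta1 g) p v,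
      \<lambda>p v. lift2 omega2 p v - lift1 (eta2 g) p v,
      \<lambda>p v. lift2 omega_12 p v - lift1 \<omega> p v]"

text \<open>With \<open>s = \<plusminus>1\<close>, these are the singular systems $V_\pm$ of a hyperbolic metric; with
  \<open>s = \<plusminus>\<i>\<close>, the systems $W$ and its conjugate of an elliptic metric.\<close>

definition singular_system ::
  "local_metric \<Rightarrow> (frame2, real) form \<Rightarrow> (real^2 \<Rightarrow> real) \<Rightarrow> 'k \<Rightarrow>
     (frame2 \<times> frame3, 'k::real_normed_field) form list" where
  "singular_system g \<omega> K s =
     (let k = (\<lambda>p. of_real (sqrt \<bar>K (fst (fst p))\<bar>)) in
      embedding_system g \<omega> @
      [\<lambda>p v. lift2 omega_31 p v - s * k p * lift1 (eta2 g) p v,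
       \<lambda>p v. lift2 omega_32 p v + s * k p * lift1 (eta1 g) p v])"

definition singular_system_integrable ::
  "'a chart \<Rightarrow> local_metric \<Rightarrow> (frame2, real) form \<Rightarrow> ('a \<Rightarrow> real) \<Rightarrow> 'k::real_normed_field \<Rightarrow> bool" where
  "singular_system_integrable c g \<omega> K s \<longleftrightarrow>
     has_transverse_frobenius (frame_bundle (chart_domain c) g \<times> mink_frame_bundle)
       (embedding_system g \<omega>) (singular_system g \<omega> (K \<circ> chart_inv c) s)"

definition darboux_integrable ::
  "'a topology \<Rightarrow> 'a chart set \<Rightarrow> ('a chart \<Rightarrow> local_metric) \<Rightarrow>
     ('a chart \<Rightarrow> (frame2, real) form) \<Rightarrow> ('a \<Rightarrow> real) \<Rightarrow> bool" where
  "darboux_integrable X A g \<omega> K \<longleftrightarrow>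
     hyperbolic X K \<and>
       (\<forall>c\<in>A. \<forall>s\<in>{1, -1::real}. singular_system_integrable c (g c) (\<omega> c) K s) \<or>
     elliptic X K \<and>
       (\<forall>c\<in>A. \<forall>s\<in>{\<i>, -\<i>}. singular_system_integrable c (g c) (\<omega> c) K s)"


subsection \<open>The Killing field\<close>

text \<open>\<open>V = q\<^sub>1 e\<^sub>2 - q\<^sub>2 e\<^sub>1\<close>, where \<open>dq = q\<^sub>1 \<eta>\<^sup>1 + q\<^sub>2 \<eta>\<^sup>2\<close>, i.e. \<open>q\<^sub>i = dq(e\<^sub>i)\<close>.  It depends
  on the frame only up to sign; it is Killing whenever the metric is Darboux integrable.\<close>

fun killing_field :: "(real^2 \<Rightarrow> real) \<Rightarrow> frame2 \<Rightarrow> real^2" where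
  "killing_field K (x, e1, e2) =
     (let dq = frechet_derivative (\<lambda>y. \<bar>K y\<bar> powr (-3/4)) (at x)
      in dq e1 *\<^sub>R e2 - dq e2 *\<^sub>R e1)"

definition timelike_killing_field ::
  "'a chart set \<Rightarrow> ('a chart \<Rightarrow> local_metric) \<Rightarrow> ('a \<Rightarrow> real) \<Rightarrow> bool" where
  "timelike_killing_field A g K \<longleftrightarrow>
     (\<forall>c\<in>A. \<forall>f\<in>frame_bundle (chart_domain c) (g c).
        g c (fst f) (killing_field (K \<circ> chart_inv c) f) (killing_field (K \<circ> chart_inv c) f) > 0)"

end

theory Submission
  imports Defs
begin

text \<open>Over a local orthonormal frame of \<open>M\<close>, the annihilator of the singular system is spanned by two
  vector fields \<open>e\<^sub>i + A\<^sub>i\<close> on \<open>M \<times> \<F>\<close>, where \<open>\<F>\<close> is the frame bundle of Minkowski space and the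
  \<open>A\<^sub>i\<close> are left invariant fields along \<open>\<F>\<close>, i.e. functions with values in the six-dimensional
  Poincare algebra: \<open>A\<close> is a connection.  A Frobenius subbundle of rank 2 transverse to the
  \<open>\<theta>\<^sub>i\<close> forces the holonomy algebra, which contains the curvature and its covariant derivatives, into
  a four-dimensional subspace transverse to \<open>\<theta>\<^sub>i = 0\<close>.  This overdetermined system collapses
  to the single equation \<open>\<nabla>\<nabla>q = -3 q powr (-1/3) g\<close>, with \<open>g\<close> the metric, which for
  \<open>y = 1 / k\<close> reads \<open>\<nabla>\<nabla>y = - dy \<otimes> dy / (2 y) - 2 g / y\<close>.  Hence \<open>c = y (|\<nabla>y|\<^sup>2 + 4)\<close> is constant, and with
  a potential \<open>v\<close> of the multiple \<open>sqrt y / (4 y - c)\<close> of \<open>y\<^sub>2 \<eta>\<^sup>1 + y\<^sub>1 \<eta>\<^sup>2\<close> the metric is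
  \<open>(4 y - c) dv\<^sup>2 - y / (4 y - c) dy\<^sup>2\<close>.  The three models correspond to the sign of \<open>c\<close>.\<close>

subsection \<open>Maps of class C^k\<close>

text \<open>The collapse rests on four elements of the holonomy algebra. The curvature of
  \<open>A\<close> yields an element \<open>Y\<close> whose translation part is
  \<open>e\<^sub>3\<close>; its covariant derivatives yield \<open>Z\<^sub>1\<close>,
  \<open>Z\<^sub>2\<close> with translation parts \<open>e\<^sub>2\<close>,
  \<open>e\<^sub>1\<close>, so any further element can be freed of its translation part.
  Transversality leaves at most a line for what remains. Where dK is nonzero this line is attained,
  because certain differences of second covariant derivatives equal 2 k dl with l = ln k / 2.
  Closing the line under covariant differentiation gives quadratic equations for the Hessian of l,
  and these reduce to a perfect square (s + 2 k^2)^2 = 0: the Hessian is determined without any free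
  parameter. A timelike Killing field guarantees that dK has no zero. An obstacle shapes the
  calculus: the frame bundles are submanifolds of Euclidean spaces and nothing is known about the
  Frobenius forms off them, so brackets are formed with ambient fields tangent to the bundles, and
  identities are differentiated in tangent directions only.\<close>

abbreviation fderiv :: "('a::real_normed_vector \<Rightarrow> 'b::real_normed_vector) \<Rightarrow> 'a \<Rightarrow> 'a \<Rightarrow> 'b" where
  "fderiv f x \<equiv> frechet_derivative f (at x)"

lemma frechet_derivative_eq: "(f has_derivative f') (at x) \<Longrightarrow> fderiv f x = f'"
  using frechet_derivative_at by blast

lemma has_derivative_frechet: "f differentiable (at x) \<Longrightarrow> (f has_derivative fderiv f x) (at x)"
  using frechet_derivative_works by blast

text \<open>\<open>frechet_derivative\<close> is a choice among all derivatives, and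
  \<open>f\<close>, \<open>g\<close> have the same ones at \<open>x\<close>; so the equality holds
  even where neither map is differentiable.\<close>

lemma frechet_derivative_cong_open:
  assumes "open S" "x \<in> S" "\<And>y. y \<in> S \<Longrightarrow> f y = g y"
  shows "fderiv f x = fderiv g x"
proof -
  have "(f has_derivative F) (at x) \<longleftrightarrow> (g has_derivative F) (at x)" for F
    using assms has_derivative_transform_within_open[of f F x UNIV S g]
      has_derivative_transform_within_open[of g F x UNIV S f] by auto
  then show ?thesis unfolding frechet_derivative_def by simp
qed

lemma C_k_on_cong:
  assumes "open S" "\<And>x. x \<in> S \<Longrightarrow> f x = g x" "C_k_on k S f"
  shows "C_k_on k S g"
  using assms(2,3)
proof (induction k arbitrary: f g)
  case 0
  then show ?case by (simp add: continuous_on_eq)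
next
  case (Suc k)
  have "C_k_on k S (\<lambda>x. fderiv g x v)" for v
  proof (rule Suc.IH)
    show "fderiv f x v = fderiv g x v" if "x \<in> S" for x
      using frechet_derivative_cong_open[OF assms(1) that Suc.prems(1)] by auto
  qed (use Suc.prems in auto)
  moreover have "g differentiable (at x)" if "x \<in> S" for x
    by (rule differentiableI[OF has_derivative_transform_within_open[OF has_derivative_frechet[of f] assms(1) that]])
      (use Suc.prems that in auto)
  ultimately show ?case by simp
qed

lemma C_k_onI_has_derivative:
  assumes S: "open S" and D: "\<And>x. x \<in> S \<Longrightarrow> (f has_derivative f' x) (at x)"
    and C: "\<And>v. C_k_on k S (\<lambda>x. f' x v)"
  shows "C_k_on (Suc k) S f"
proof -
  have "C_k_on k S (\<lambda>x. fderiv f x v)" for v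
  proof (rule C_k_on_cong[OF S _ C])
    show "f' x v = fderiv f x v" if "x \<in> S" for x
      by (simp only: frechet_derivative_eq[OF D[OF that]])
  qed
  moreover have "f differentiable (at x)" if "x \<in> S" for x
    using D[OF that] unfolding differentiable_def by blast
  ultimately show ?thesis by simp
qed

lemma C_k_on_SucE:
  assumes "C_k_on (Suc k) S f"
  shows "x \<in> S \<Longrightarrow> (f has_derivative fderiv f x) (at x)"
    and "C_k_on k S (\<lambda>x. fderiv f x v)"
  using assms has_derivative_frechet by auto

lemma C_k_on_subset: "C_k_on k S f \<Longrightarrow> T \<subseteq> S \<Longrightarrow> C_k_on k T f"
proof (induction k arbitrary: f)
  case 0
  then show ?case using continuous_on_subset by auto
next
  case (Suc k)
  then show ?case unfolding C_k_on.simps by blast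
qed

lemma C_k_on_imp_continuous_on: "C_k_on k S f \<Longrightarrow> continuous_on S f"
proof (cases k)
  case (Suc m)
  assume "C_k_on k S f"
  then have "f differentiable_on S" unfolding Suc
    by (auto simp: differentiable_on_def intro: differentiable_at_withinI)
  then show ?thesis by (rule differentiable_imp_continuous_on)
qed simp

lemma C_k_on_SucD: "C_k_on (Suc k) S f \<Longrightarrow> C_k_on k S f"
proof (induction k arbitrary: f)
  case 0
  then have "continuous_on S f" by (rule C_k_on_imp_continuous_on)
  then show ?case by simp
next
  case (Suc k)
  then have "\<forall>x\<in>S. f differentiable (at x)" "\<forall>v. C_k_on (Suc k) S (\<lambda>x. fderiv f x v)"
    unfolding C_k_on.simps(2)[of "Suc k"] by blast+
  then show ?case using Suc.IH unfolding C_k_on.simps(2)[of k S f] by blast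
qed

lemma C_k_on_const: "C_k_on k S (\<lambda>x. c)"
  by (induction k arbitrary: c) simp_all

lemma C_k_on_linear:
  assumes "bounded_linear f"
  shows "C_k_on k S f"
proof (cases k)
  case 0
  then show ?thesis using assms by (simp add: linear_continuous_on)
next
  case (Suc m)
  show ?thesis unfolding Suc C_k_on.simps
    using bounded_linear_imp_differentiable[OF assms]
    by (simp add: C_k_on_const frechet_derivative_eq[OF bounded_linear_imp_has_derivative[OF assms]])
qed

lemma C_k_on_bounded_linear:
  assumes "open S" "bounded_linear L" "C_k_on k S f"
  shows "C_k_on k S (\<lambda>x. L (f x))"
  using assms(3)
proof (induction k arbitrary: f)
  case 0
  then show ?case using bounded_linear.continuous_on[OF assms(2)] by simp
next
  case (Suc k)
  show ?case
    by (rule C_k_onI_has_derivative[OF assms(1) bounded_linear.has_derivative[OF assms(2)]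
          Suc.IH], rule C_k_on_SucE[OF Suc.prems], assumption, rule C_k_on_SucE[OF Suc.prems])
qed

lemma C_k_on_add:
  assumes "open S" "C_k_on k S f" "C_k_on k S g"
  shows "C_k_on k S (\<lambda>x. f x + g x)"
  using assms(2,3)
proof (induction k arbitrary: f g)
  case 0
  then show ?case by (simp add: continuous_on_add)
next
  case (Suc k)
  show ?case
    by (rule C_k_onI_has_derivative[OF assms(1) has_derivative_add Suc.IH];
        (rule C_k_on_SucE[OF Suc.prems(1)] C_k_on_SucE[OF Suc.prems(2)])?; assumption?)
qed

lemma C_k_on_bilinear:
  assumes "open S" "bounded_bilinear b" "C_k_on k S f" "C_k_on k S g"
  shows "C_k_on k S (\<lambda>x. b (f x) (g x))"
  using assms(3,4)
proof (induction k arbitrary: f g)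
  case 0
  then show ?case using bounded_bilinear.continuous_on[OF assms(2)] by simp
next
  case (Suc k)
  show ?case
  proof (rule C_k_onI_has_derivative[OF assms(1)])
    show "((\<lambda>x. b (f x) (g x)) has_derivative
        (\<lambda>v. b (f x) (fderiv g x v) + b (fderiv f x v) (g x))) (at x)"
      if "x \<in> S" for x
      by (rule bounded_bilinear.FDERIV[OF assms(2)
            C_k_on_SucE(1)[OF Suc.prems(1) that] C_k_on_SucE(1)[OF Suc.prems(2) that]])
    show "C_k_on k S (\<lambda>x. b (f x) (fderiv g x v) + b (fderiv f x v) (g x))" for v
      by (intro C_k_on_add[OF assms(1)] Suc.IH Suc.prems[THEN C_k_on_SucD] Suc.prems[THEN C_k_on_SucE(2)])
  qed
qed

lemma C_k_on_sum:
  assumes "open S" "\<And>i. i \<in> I \<Longrightarrow> C_k_on k S (f i)"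
  shows "C_k_on k S (\<lambda>x. \<Sum>i\<in>I. f i x)"
  using assms(2)
  by (induction I rule: infinite_finite_induct) (simp_all add: C_k_on_const C_k_on_add assms(1))

lemma linear_sum_Basis:
  fixes f :: "'a::euclidean_space \<Rightarrow> 'b::real_vector"
  assumes "linear f"
  shows "f v = (\<Sum>b\<in>Basis. (v \<bullet> b) *\<^sub>R f b)"
  by (metis (no_types, lifting) assms euclidean_representation linear_scale linear_sum sum.cong)

text \<open>The chain rule, expanded over a basis, writes a directional derivative of the composite
  as a sum of products of coordinates of the derivative of \<open>g\<close> with directional
  derivatives of \<open>f\<close> composed with \<open>g\<close>. Hence the induction runs over all
  \<open>f\<close> at once while \<open>g\<close> stays fixed.\<close>

lemma C_k_on_compose:
  fixes g :: "'a::euclidean_space \<Rightarrow> 'b::euclidean_space" and f :: "'b \<Rightarrow> 'c::real_normed_vector"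
  assumes "open S" "open T" "g ` S \<subseteq> T" "C_k_on k T f" "C_k_on k S g"
  shows "C_k_on k S (\<lambda>x. f (g x))"
  using assms(4,5)
proof (induction k arbitrary: f)
  case 0
  then show ?case using assms(3) continuous_on_compose2[of T f S g] by auto
next
  case (Suc k)
  show ?case
  proof (rule C_k_onI_has_derivative[OF assms(1)])
    fix x assume x: "x \<in> S"
    then have gx: "g x \<in> T" using assms(3) by blast
    have lin: "linear (fderiv f (g x))"
      using has_derivative_linear[OF C_k_on_SucE(1)[OF Suc.prems(1) gx]] .
    show "((\<lambda>x. f (g x)) has_derivative (\<lambda>v. \<Sum>b\<in>Basis.
        (fderiv g x v \<bullet> b) *\<^sub>R fderiv f (g x) b)) (at x)"
      unfolding linear_sum_Basis[OF lin, symmetric]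
      by (rule has_derivative_compose[OF C_k_on_SucE(1)[OF Suc.prems(2) x]
            C_k_on_SucE(1)[OF Suc.prems(1) gx]])
  next
    show "C_k_on k S (\<lambda>x. \<Sum>b\<in>Basis.
        (fderiv g x v \<bullet> b) *\<^sub>R fderiv f (g x) b)" for v
      by (intro C_k_on_sum[OF assms(1)] C_k_on_bilinear[OF assms(1) bounded_bilinear_scaleR]
          C_k_on_bounded_linear[OF assms(1) bounded_linear_inner_left]
          Suc.IH Suc.prems(1)[THEN C_k_on_SucE(2)] Suc.prems(2)[THEN C_k_on_SucE(2)]
          Suc.prems(2)[THEN C_k_on_SucD])
  qed
qed

subsection \<open>Smooth maps\<close>

lemma smooth_on_cong: "open S \<Longrightarrow> (\<And>x. x \<in> S \<Longrightarrow> f x = g x) \<Longrightarrow> smooth_on S f \<Longrightarrow> smooth_on S g"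
  unfolding smooth_on_def by (intro allI C_k_on_cong[of S f g]) simp_all

lemma smooth_on_subset: "smooth_on S f \<Longrightarrow> T \<subseteq> S \<Longrightarrow> smooth_on T f"
  unfolding smooth_on_def using C_k_on_subset by blast

lemma smooth_on_differentiable: "smooth_on S f \<Longrightarrow> x \<in> S \<Longrightarrow> f differentiable (at x)"
  unfolding smooth_on_def using C_k_on.simps(2)[of 0] by blast

lemma smooth_on_has_derivative: "smooth_on S f \<Longrightarrow> x \<in> S \<Longrightarrow> (f has_derivative fderiv f x) (at x)"
  using smooth_on_differentiable has_derivative_frechet by blast

lemma smooth_on_continuous_on: "smooth_on S f \<Longrightarrow> continuous_on S f"
  unfolding smooth_on_def using C_k_on_imp_continuous_on by blast

lemma smooth_on_frechet_derivative: "smooth_on S f \<Longrightarrow> smooth_on S (\<lambda>x. fderiv f x v)"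
  unfolding smooth_on_def using C_k_on.simps(2) by blast

lemma smooth_onI_derivative:
  assumes "\<And>x. x \<in> S \<Longrightarrow> f differentiable (at x)"
    and "\<And>v. smooth_on S (\<lambda>x. fderiv f x v)"
  shows "smooth_on S f"
  unfolding smooth_on_def
proof
  show "C_k_on k S f" for k
  proof (cases k)
    case 0
    have "\<forall>v. C_k_on 0 S (\<lambda>x. fderiv f x v)"
      using assms(2) unfolding smooth_on_def by blast
    then have "C_k_on (Suc 0) S f" unfolding C_k_on.simps(2) using assms(1) by blast
    then show ?thesis using 0 C_k_on_SucD by blast
  next
    case (Suc m)
    have "\<forall>v. C_k_on m S (\<lambda>x. fderiv f x v)"
      using assms(2) unfolding smooth_on_def by blast
    then show ?thesis unfolding Suc C_k_on.simps using assms(1) by blast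
  qed
qed

lemma smooth_on_const [simp]: "smooth_on S (\<lambda>x. c)"
  unfolding smooth_on_def using C_k_on_const by blast

lemma smooth_on_linear: "bounded_linear f \<Longrightarrow> smooth_on S f"
  unfolding smooth_on_def using C_k_on_linear by blast

lemma smooth_on_ident [simp]: "smooth_on S (\<lambda>x. x)"
  by (rule smooth_on_linear) (rule bounded_linear_ident)

lemma smooth_on_bounded_linear: "open S \<Longrightarrow> bounded_linear L \<Longrightarrow> smooth_on S f \<Longrightarrow> smooth_on S (\<lambda>x. L (f x))"
  unfolding smooth_on_def by (simp add: C_k_on_bounded_linear[of S L _ f])

lemma smooth_on_bilinear:
  "open S \<Longrightarrow> bounded_bilinear b \<Longrightarrow> smooth_on S f \<Longrightarrow> smooth_on S g \<Longrightarrow> smooth_on S (\<lambda>x. b (f x) (g x))"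
  unfolding smooth_on_def by (simp add: C_k_on_bilinear[of S b _ f g])

lemma smooth_on_add: "open S \<Longrightarrow> smooth_on S f \<Longrightarrow> smooth_on S g \<Longrightarrow> smooth_on S (\<lambda>x. f x + g x)"
  unfolding smooth_on_def by (simp add: C_k_on_add)

lemma smooth_on_sum: "open S \<Longrightarrow> (\<And>i. i \<in> I \<Longrightarrow> smooth_on S (f i)) \<Longrightarrow> smooth_on S (\<lambda>x. \<Sum>i\<in>I. f i x)"
  unfolding smooth_on_def by (simp add: C_k_on_sum)

lemma smooth_on_compose:
  fixes g :: "'a::euclidean_space \<Rightarrow> 'b::euclidean_space" and f :: "'b \<Rightarrow> 'c::real_normed_vector"
  shows "open S \<Longrightarrow> open T \<Longrightarrow> smooth_on T f \<Longrightarrow> smooth_on S g \<Longrightarrow> (\<And>x. x \<in> S \<Longrightarrow> g x \<in> T) \<Longrightarrow>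
    smooth_on S (\<lambda>x. f (g x))"
  unfolding smooth_on_def by (rule allI, rule C_k_on_compose[of S T g _ f]) (simp_all add: image_subset_iff)

lemma smooth_on_minus: "open S \<Longrightarrow> smooth_on S f \<Longrightarrow> smooth_on S (\<lambda>x. - f x)"
  by (rule smooth_on_bounded_linear[OF _ bounded_linear_minus[OF bounded_linear_ident]])

lemma smooth_on_diff: "open S \<Longrightarrow> smooth_on S f \<Longrightarrow> smooth_on S g \<Longrightarrow> smooth_on S (\<lambda>x. f x - g x)"
  using smooth_on_add[of S f "\<lambda>x. - g x"] smooth_on_minus[of S g] by simp

lemma smooth_on_mult:
  fixes f g :: "_ \<Rightarrow> real"
  shows "open S \<Longrightarrow> smooth_on S f \<Longrightarrow> smooth_on S g \<Longrightarrow> smooth_on S (\<lambda>x. f x * g x)"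
  by (rule smooth_on_bilinear[OF _ bounded_bilinear_mult])

lemma smooth_on_scaleR:
  "open S \<Longrightarrow> smooth_on S f \<Longrightarrow> smooth_on S g \<Longrightarrow> smooth_on S (\<lambda>x. f x *\<^sub>R g x)"
  by (rule smooth_on_bilinear[OF _ bounded_bilinear_scaleR])

lemma smooth_on_inner:
  "open S \<Longrightarrow> smooth_on S f \<Longrightarrow> smooth_on S g \<Longrightarrow> smooth_on S (\<lambda>x. f x \<bullet> g x)"
  by (rule smooth_on_bilinear[OF _ bounded_bilinear_inner])

lemma smooth_on_power:
  fixes f :: "_ \<Rightarrow> real"
  shows "open S \<Longrightarrow> smooth_on S f \<Longrightarrow> smooth_on S (\<lambda>x. f x ^ n)"
  by (induction n) (simp_all add: smooth_on_mult)

lemma smooth_on_vec_nth: 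
  fixes f :: "_ \<Rightarrow> real^'n"
  shows "open S \<Longrightarrow> smooth_on S f \<Longrightarrow> smooth_on S (\<lambda>x. f x $ i)"
  by (rule smooth_on_bounded_linear[OF _ bounded_linear_vec_nth])

lemma bounded_linear_Pair_left: "bounded_linear (\<lambda>x. (x, 0))"
  by (intro bounded_linear_Pair bounded_linear_ident bounded_linear_zero)

lemma bounded_linear_Pair_right: "bounded_linear (\<lambda>x. (0, x))"
  by (intro bounded_linear_Pair bounded_linear_ident bounded_linear_zero)

lemma smooth_on_Pair:
  assumes "open S" "smooth_on S f" "smooth_on S g"
  shows "smooth_on S (\<lambda>x. (f x, g x))"
  using smooth_on_add[OF assms(1) smooth_on_bounded_linear[OF assms(1) bounded_linear_Pair_left assms(2)]
      smooth_on_bounded_linear[OF assms(1) bounded_linear_Pair_right assms(3)]]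
  by simp

lemma smooth_on_vector2:
  fixes f g :: "_ \<Rightarrow> real"
  assumes "open S" "smooth_on S f" "smooth_on S g"
  shows "smooth_on S (\<lambda>x. vector [f x, g x] :: real^2)"
proof -
  have "(vector [f x, g x] :: real^2) = f x *\<^sub>R axis 1 1 + g x *\<^sub>R axis 2 1" for x
    by (simp add: vec_eq_iff forall_2 axis_def)
  then show ?thesis
    using assms by (simp add: smooth_on_add smooth_on_scaleR)
qed

text \<open>Differentiation turns a power into a multiple of a power with another exponent, so the
  induction is uniform in \<open>a\<close>.\<close>

lemma smooth_on_powr_real: "smooth_on {0<..} (\<lambda>x::real. x powr a)"
  unfolding smooth_on_def
proof
  fix k
  show "C_k_on k {0<..} (\<lambda>x::real. x powr a)"
  proof (induction k arbitrary: a)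
    case 0
    then show ?case by (auto intro!: continuous_intros)
  next
    case (Suc k)
    show ?case
    proof (rule C_k_onI_has_derivative)
      show "((\<lambda>x. x powr a) has_derivative (\<lambda>v. (a * v) * x powr (a - 1))) (at x)"
        if "x \<in> {0<..}" for x :: real
      proof -
        have "((\<lambda>x. x powr a) has_real_derivative a * x powr (a - 1)) (at x)"
          using that by (auto intro!: derivative_eq_intros)
        then show ?thesis
          unfolding has_field_derivative_def by (rule has_derivative_eq_rhs) (simp add: fun_eq_iff)
      qed
      show "C_k_on k {0<..} (\<lambda>x::real. (a * v) * x powr (a - 1))" for v
        by (rule C_k_on_bounded_linear[OF _ bounded_linear_mult_right Suc.IH]) simp
    qed simp
  qed
qed

lemma smooth_on_powr:
  fixes f :: "'a::euclidean_space \<Rightarrow> real"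
  assumes "open S" "smooth_on S f" "\<And>x. x \<in> S \<Longrightarrow> 0 < f x"
  shows "smooth_on S (\<lambda>x. f x powr a)"
  by (rule smooth_on_compose[OF assms(1) _ smooth_on_powr_real assms(2)]) (use assms in auto)

lemma smooth_on_sqrt:
  fixes f :: "'a::euclidean_space \<Rightarrow> real"
  assumes "open S" "smooth_on S f" "\<And>x. x \<in> S \<Longrightarrow> 0 < f x"
  shows "smooth_on S (\<lambda>x. sqrt (f x))"
  by (rule smooth_on_cong[OF assms(1) _ smooth_on_powr[OF assms, of "1/2"]])
    (use assms(3) in \<open>auto simp: powr_half_sqrt less_imp_le\<close>)

lemma smooth_on_inverse:
  fixes f :: "'a::euclidean_space \<Rightarrow> real"
  assumes S: "open S" and f: "smooth_on S f" and nz: "\<And>x. x \<in> S \<Longrightarrow> f x \<noteq> 0"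
  shows "smooth_on S (\<lambda>x. inverse (f x))"
proof (rule smooth_on_cong[OF S])
  have pos: "\<And>x. x \<in> S \<Longrightarrow> 0 < f x * f x" using nz not_real_square_gt_zero by blast
  \<comment> \<open>Real powers are smooth for positive bases only; squaring makes the base positive
    whatever the sign of \<open>f\<close>.\<close>
  show "smooth_on S (\<lambda>x. f x * (f x * f x) powr (-1))"
    using pos by (intro smooth_on_mult smooth_on_powr S f)
  show "f x * (f x * f x) powr (-1) = inverse (f x)" if "x \<in> S" for x
    using pos[OF that] nz[OF that] by (simp add: powr_minus field_simps)
qed

lemma smooth_on_divide:
  fixes f g :: "'a::euclidean_space \<Rightarrow> real"
  assumes "open S" "smooth_on S f" "smooth_on S g" "\<And>x. x \<in> S \<Longrightarrow> g x \<noteq> 0"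
  shows "smooth_on S (\<lambda>x. f x / g x)"
  unfolding divide_inverse using assms by (intro smooth_on_mult smooth_on_inverse)

text \<open>A form is known to be smooth on fixed vectors; linearity and a basis expansion carry
  this over to variable vectors.\<close>

lemma smooth_on_apply_linear:
  fixes \<alpha> :: "'e::euclidean_space \<Rightarrow> 'b::euclidean_space \<Rightarrow> 'c::real_normed_vector"
  assumes "open S" "open T" "\<And>v. smooth_on T (\<lambda>p. \<alpha> p v)" "\<And>p. p \<in> T \<Longrightarrow> linear (\<alpha> p)"
    "smooth_on S \<phi>" "\<And>x. x \<in> S \<Longrightarrow> \<phi> x \<in> T" "smooth_on S Y"
  shows "smooth_on S (\<lambda>x. \<alpha> (\<phi> x) (Y x))"
proof (rule smooth_on_cong[OF assms(1)])
  show "smooth_on S (\<lambda>x. \<Sum>b\<in>Basis. (Y x \<bullet> b) *\<^sub>R \<alpha> (\<phi> x) b)"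
  proof (intro smooth_on_sum smooth_on_scaleR smooth_on_inner assms smooth_on_const)
    fix b :: 'b
    show "smooth_on S (\<lambda>x. \<alpha> (\<phi> x) b)"
      by (rule smooth_on_compose[OF assms(1,2) _ assms(5,6)]) (rule assms(3))
  qed
  show "(\<Sum>b\<in>Basis. (Y x \<bullet> b) *\<^sub>R \<alpha> (\<phi> x) b) = \<alpha> (\<phi> x) (Y x)" if "x \<in> S" for x
    by (rule linear_sum_Basis[OF assms(4)[OF assms(6)[OF that]], symmetric])
qed

section \<open>Derivatives along vector fields and symmetry of second derivatives\<close>

definition along :: "('a::euclidean_space \<Rightarrow> 'a) \<Rightarrow> ('a \<Rightarrow> 'b::real_normed_vector) \<Rightarrow> 'a \<Rightarrow> 'b" where
  "along X f x = fderiv f x (X x)"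

lemma smooth_on_along:
  assumes "open S" "smooth_on S X" "smooth_on S f"
  shows "smooth_on S (along X f)"
proof -
  have "linear (fderiv f p)" if "p \<in> S" for p
    by (rule linear_frechet_derivative[OF smooth_on_differentiable[OF assms(3) that]])
  from smooth_on_apply_linear[OF assms(1) assms(1)
        smooth_on_frechet_derivative[OF assms(3)] this smooth_on_ident _ assms(2)]
  show ?thesis unfolding along_def by blast
qed

text \<open>The second difference of \<open>f\<close> along \<open>t u\<close>, \<open>t v\<close> is estimated
  with the mean value theorem applied to \<open>s \<mapsto> f (x + s u + t v) - f (x + s u)\<close>.\<close>

lemma second_difference_limit:
  fixes f :: "'a::euclidean_space \<Rightarrow> real"
  assumes S: "open S" "x \<in> S" and f: "smooth_on S f"
  shows "((\<lambda>t. (f (x + t *\<^sub>R u + t *\<^sub>R v) - f (x + t *\<^sub>R u) - f (x + t *\<^sub>R v) + f x) / t\<^sup>2) \<longlongrightarrow>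
    fderiv (\<lambda>y. fderiv f y u) x v) (at_right 0)"
proof -
  let ?g = "\<lambda>y. fderiv f y u"
  let ?L = "fderiv ?g x"
  have dg: "(?g has_derivative ?L) (at x)"
    by (rule smooth_on_has_derivative[OF smooth_on_frechet_derivative[OF f] S(2)])
  then have lin: "linear ?L" using has_derivative_linear by blast
  show ?thesis
  proof (rule tendstoI)
    fix e :: real assume e: "0 < e"
    \<comment> \<open>Two first-order estimates enter, at z u + t v and at z u, with errors at most
      e' t (norm u + norm v) and e' t norm u; this gives the coefficients 2 and 1. The summand 1
      keeps \<open>C\<close> positive.\<close>
    define C where "C = 2 * norm u + norm v + 1"
    have C: "0 < C" unfolding C_def by (smt (verit) norm_ge_zero)
    define e' where "e' = e / (2 * C)"
    have e': "0 < e'" using e C by (simp add: e'_def)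
    obtain d where d: "0 < d" and dd: "\<And>y. norm (y - x) < d \<Longrightarrow>
        norm (?g y - ?g x - ?L (y - x)) \<le> e' * norm (y - x)"
      using dg[unfolded has_derivative_at_alt] e' by blast
    obtain r where r: "0 < r" "ball x r \<subseteq> S" using S openE by blast
    define m where "m = min d r / C"
    have m: "0 < m" using d r C by (simp add: m_def)
    have "dist ((f (x + t *\<^sub>R u + t *\<^sub>R v) - f (x + t *\<^sub>R u) - f (x + t *\<^sub>R v) + f x) / t\<^sup>2) (?L v) < e"
      if t: "0 < t" "t < m" for t
    proof -
      have tC: "t * C < min d r" using t C by (simp add: m_def pos_less_divide_eq)
      have near: "norm (s *\<^sub>R u + a *\<^sub>R v) < min d r \<and> norm (s *\<^sub>R u + a *\<^sub>R v) \<le> t * (norm u + norm v)"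
        if "0 \<le> s" "s \<le> t" "0 \<le> a" "a \<le> t" for s a
      proof -
        have "norm (s *\<^sub>R u + a *\<^sub>R v) \<le> s * norm u + a * norm v"
          using norm_triangle_ineq[of "s *\<^sub>R u" "a *\<^sub>R v"] that by simp
        also have "\<dots> \<le> t * norm u + t * norm v"
          using that by (intro add_mono mult_right_mono) auto
        finally have 1: "norm (s *\<^sub>R u + a *\<^sub>R v) \<le> t * (norm u + norm v)" by (simp add: algebra_simps)
        have "t * (norm u + norm v) \<le> t * C" using t(1) by (intro mult_left_mono) (auto simp: C_def)
        with 1 tC show ?thesis by linarith
      qed
      have inS: "x + s *\<^sub>R u + a *\<^sub>R v \<in> S" if "0 \<le> s" "s \<le> t" "0 \<le> a" "a \<le> t" for s a
      proof -
        have "dist x (x + s *\<^sub>R u + a *\<^sub>R v) < r"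
          using near[OF that] norm_minus_cancel[of "s *\<^sub>R u + a *\<^sub>R v"]
          by (simp add: dist_norm add.assoc)
        then show ?thesis using r by auto
      qed
      define h where "h = (\<lambda>s. f (x + s *\<^sub>R u + t *\<^sub>R v) - f (x + s *\<^sub>R u))"
      have dline: "((\<lambda>s. f (x + s *\<^sub>R u + a *\<^sub>R v)) has_real_derivative ?g (x + s *\<^sub>R u + a *\<^sub>R v)) (at s)"
        if "0 \<le> s" "s \<le> t" "0 \<le> a" "a \<le> t" for s a
      proof -
        let ?F = "fderiv f (x + s *\<^sub>R u + a *\<^sub>R v)"
        have F: "(f has_derivative ?F) (at (x + s *\<^sub>R u + a *\<^sub>R v))"
          by (rule smooth_on_has_derivative[OF f inS[OF that]])
        have "((\<lambda>s. x + s *\<^sub>R u + a *\<^sub>R v) has_derivative (\<lambda>h. h *\<^sub>R u)) (at s)"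
          by (auto intro!: derivative_eq_intros)
        from has_derivative_compose[OF this F]
        have "((\<lambda>s. f (x + s *\<^sub>R u + a *\<^sub>R v)) has_derivative (\<lambda>h. ?F (h *\<^sub>R u))) (at s)" .
        then show ?thesis
          using linear_scale[OF has_derivative_linear[OF F]]
          by (simp add: has_field_derivative_def mult.commute[of _ "?F u"])
      qed
      have "\<exists>z. 0 < z \<and> z < t \<and> h t - h 0 = (t - 0) * (?g (x + z *\<^sub>R u + t *\<^sub>R v) - ?g (x + z *\<^sub>R u))"
      proof (rule MVT2[OF t(1)])
        fix s assume s: "0 \<le> s" "s \<le> t"
        show "(h has_real_derivative ?g (x + s *\<^sub>R u + t *\<^sub>R v) - ?g (x + s *\<^sub>R u)) (at s)"
          unfolding h_def using DERIV_diff[OF dline[of s t] dline[of s 0]] s t by simp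
      qed
      then obtain z where z: "0 < z" "z < t"
        and hz: "h t - h 0 = t * (?g (x + z *\<^sub>R u + t *\<^sub>R v) - ?g (x + z *\<^sub>R u))" by auto
      let ?N = "t * (norm u + norm v)"
      have 1: "norm (?g (x + z *\<^sub>R u + t *\<^sub>R v) - ?g x - ?L (z *\<^sub>R u + t *\<^sub>R v)) \<le> e' * norm (z *\<^sub>R u + t *\<^sub>R v)"
        using dd[of "x + z *\<^sub>R u + t *\<^sub>R v"] near[of z t] z by (simp add: add.assoc)
      have 2: "norm (?g (x + z *\<^sub>R u) - ?g x - ?L (z *\<^sub>R u)) \<le> e' * norm (z *\<^sub>R u)"
        using dd[of "x + z *\<^sub>R u"] near[of z 0] z by simp
      have n1: "e' * norm (z *\<^sub>R u + t *\<^sub>R v) \<le> e' * (t * (norm u + norm v))"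
        using near[of z t] z e' by (intro mult_left_mono) auto
      have n2: "e' * norm (z *\<^sub>R u) \<le> e' * (t * norm u)"
        using z e' by (intro mult_left_mono) (auto intro: mult_right_mono)
      have Luv: "?L (z *\<^sub>R u + t *\<^sub>R v) - ?L (z *\<^sub>R u) = t * ?L v"
        using lin by (simp add: linear_add linear_scale)
      have "\<bar>(?g (x + z *\<^sub>R u + t *\<^sub>R v) - ?g (x + z *\<^sub>R u)) - t * ?L v\<bar> \<le> e' * (t * (norm u + norm v)) + e' * (t * norm u)"
        using 1 2 n1 n2 Luv unfolding real_norm_def by linarith
      also have "\<dots> = t * (e' * (2 * norm u + norm v))" by (simp add: algebra_simps)
      also have "\<dots> \<le> t * (e' * C)" using t e' by (intro mult_left_mono) (auto simp: C_def)
      also have "\<dots> = t * (e / 2)" using C by (simp add: e'_def)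
      finally have b: "\<bar>(?g (x + z *\<^sub>R u + t *\<^sub>R v) - ?g (x + z *\<^sub>R u)) - t * ?L v\<bar> \<le> t * (e / 2)" .
      have "(f (x + t *\<^sub>R u + t *\<^sub>R v) - f (x + t *\<^sub>R u) - f (x + t *\<^sub>R v) + f x) = h t - h 0"
        by (simp add: h_def)
      then have "(f (x + t *\<^sub>R u + t *\<^sub>R v) - f (x + t *\<^sub>R u) - f (x + t *\<^sub>R v) + f x) / t\<^sup>2
          = (?g (x + z *\<^sub>R u + t *\<^sub>R v) - ?g (x + z *\<^sub>R u)) / t"
        using hz t by (simp add: power2_eq_square)
      moreover have "\<bar>(?g (x + z *\<^sub>R u + t *\<^sub>R v) - ?g (x + z *\<^sub>R u)) / t - ?L v\<bar> \<le> e / 2"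
      proof -
        have "(?g (x + z *\<^sub>R u + t *\<^sub>R v) - ?g (x + z *\<^sub>R u)) / t - ?L v
            = ((?g (x + z *\<^sub>R u + t *\<^sub>R v) - ?g (x + z *\<^sub>R u)) - t * ?L v) / t"
          using t by (simp add: field_simps)
        then show ?thesis using b t by (simp add: abs_divide pos_divide_le_eq mult.commute)
      qed
      ultimately show ?thesis using e by (simp add: dist_real_def)
    qed
    then show "\<forall>\<^sub>F t in at_right 0. dist ((f (x + t *\<^sub>R u + t *\<^sub>R v) - f (x + t *\<^sub>R u) - f (x + t *\<^sub>R v) + f x) / t\<^sup>2)
       (?L v) < e"
      unfolding eventually_at_right_field using m by auto
  qed
qed

text \<open>The second difference is symmetric in \<open>u\<close> and \<open>v\<close>, while its
  limit can be computed in either order of differentiation.\<close>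

lemma second_derivative_symmetric_real:
  fixes f :: "'a::euclidean_space \<Rightarrow> real"
  assumes "open S" "x \<in> S" "smooth_on S f"
  shows "fderiv (\<lambda>y. fderiv f y u) x v =
    fderiv (\<lambda>y. fderiv f y v) x u"
proof (rule tendsto_unique[OF _ second_difference_limit[OF assms, of u v]])
  show "((\<lambda>t. (f (x + t *\<^sub>R u + t *\<^sub>R v) - f (x + t *\<^sub>R u) - f (x + t *\<^sub>R v) + f x) / t\<^sup>2) \<longlongrightarrow>
    fderiv (\<lambda>y. fderiv f y v) x u) (at_right 0)"
    using second_difference_limit[OF assms, of v u] by (simp add: algebra_simps)
qed auto

lemma frechet_derivative_inner:
  assumes "f differentiable (at x)"
  shows "fderiv (\<lambda>y. f y \<bullet> b) x v = fderiv f x v \<bullet> b"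
proof -
  have "((\<lambda>y. f y \<bullet> b) has_derivative (\<lambda>v. fderiv f x v \<bullet> b)) (at x)"
    by (rule bounded_linear.has_derivative[OF bounded_linear_inner_left has_derivative_frechet[OF assms]])
  from frechet_derivative_eq[OF this] show ?thesis by simp
qed

lemma second_derivative_symmetric:
  fixes f :: "'a::euclidean_space \<Rightarrow> 'b::euclidean_space"
  assumes S: "open S" "x \<in> S" and f: "smooth_on S f"
  shows "fderiv (\<lambda>y. fderiv f y u) x v =
    fderiv (\<lambda>y. fderiv f y v) x u"
proof (rule euclidean_eqI)
  fix b :: 'b
  have fb: "smooth_on S (\<lambda>y. f y \<bullet> b)" by (rule smooth_on_inner[OF S(1) f smooth_on_const])
  have *: "fderiv (\<lambda>y. fderiv f y u) x v \<bullet> b =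
     fderiv (\<lambda>y. fderiv (\<lambda>y. f y \<bullet> b) y u) x v" for u v
  proof -
    have "fderiv (\<lambda>y. fderiv f y u) x v \<bullet> b =
      fderiv (\<lambda>y. fderiv f y u \<bullet> b) x v"
      by (rule frechet_derivative_inner[symmetric])
        (rule smooth_on_differentiable[OF smooth_on_frechet_derivative[OF f] S(2)])
    also have "\<dots> = fderiv (\<lambda>y. fderiv (\<lambda>y. f y \<bullet> b) y u) x v"
      using frechet_derivative_cong_open[OF S, of "\<lambda>y. fderiv f y u \<bullet> b"
         "\<lambda>y. fderiv (\<lambda>y. f y \<bullet> b) y u"]
        frechet_derivative_inner[OF smooth_on_differentiable[OF f]] by auto
    finally show ?thesis .
  qed
  show "fderiv (\<lambda>y. fderiv f y u) x v \<bullet> b =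
    fderiv (\<lambda>y. fderiv f y v) x u \<bullet> b"
    unfolding * by (rule second_derivative_symmetric_real[OF S fb])
qed

lemma along_has_derivative: "(f has_derivative f') (at x) \<Longrightarrow> along X f x = f' (X x)"
  unfolding along_def by (simp add: frechet_derivative_eq)

lemma along_cong_open:
  "open S \<Longrightarrow> x \<in> S \<Longrightarrow> (\<And>y. y \<in> S \<Longrightarrow> f y = g y) \<Longrightarrow> along X f x = along X g x"
  unfolding along_def using frechet_derivative_cong_open[of S x f g] by simp

definition lie :: "('a::euclidean_space \<Rightarrow> 'a) \<Rightarrow> ('a \<Rightarrow> 'a) \<Rightarrow> 'a \<Rightarrow> 'a" where
  "lie X Y x = along X Y x - along Y X x"

subsection \<open>Lie brackets and exterior derivatives\<close>

lemma has_derivative_apply_linear: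
  fixes \<alpha> :: "'e::euclidean_space \<Rightarrow> 'b::euclidean_space \<Rightarrow> 'c::real_normed_vector"
  assumes \<phi>: "(\<phi> has_derivative \<phi>') (at x)" and Y: "(Y has_derivative Y') (at x)"
    and T: "open T" "\<phi> x \<in> T" and lin: "\<And>p. p \<in> T \<Longrightarrow> linear (\<alpha> p)"
    and diff: "\<And>v. (\<lambda>p. \<alpha> p v) differentiable (at (\<phi> x))"
  shows "((\<lambda>z. \<alpha> (\<phi> z) (Y z)) has_derivative
    (\<lambda>h. fderiv (\<lambda>p. \<alpha> p (Y x)) (\<phi> x) (\<phi>' h) + \<alpha> (\<phi> x) (Y' h))) (at x)"
proof -
  let ?D = "\<lambda>v. fderiv (\<lambda>p. \<alpha> p v) (\<phi> x)"
  have d\<alpha>: "((\<lambda>p. \<alpha> p v) has_derivative ?D v) (at (\<phi> x))" for v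
    by (rule has_derivative_frechet[OF diff])
  have sumD: "?D v h = (\<Sum>b\<in>Basis. (v \<bullet> b) *\<^sub>R ?D b h)" for v h
  proof -
    have "((\<lambda>p. \<Sum>b\<in>Basis. (v \<bullet> b) *\<^sub>R \<alpha> p b) has_derivative (\<lambda>h. \<Sum>b\<in>Basis. (v \<bullet> b) *\<^sub>R ?D b h)) (at (\<phi> x))"
      by (intro has_derivative_sum has_derivative_scaleR_right d\<alpha>)
    then have "((\<lambda>p. \<alpha> p v) has_derivative (\<lambda>h. \<Sum>b\<in>Basis. (v \<bullet> b) *\<^sub>R ?D b h)) (at (\<phi> x))"
      by (rule has_derivative_transform_within_open[OF _ T])
        (rule linear_sum_Basis[OF lin, symmetric])
    from frechet_derivative_eq[OF this] show ?thesis by (rule fun_cong)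
  qed
  have "((\<lambda>z. \<Sum>b\<in>Basis. (Y z \<bullet> b) *\<^sub>R \<alpha> (\<phi> z) b) has_derivative
    (\<lambda>h. \<Sum>b\<in>Basis. (Y x \<bullet> b) *\<^sub>R ?D b (\<phi>' h) + (Y' h \<bullet> b) *\<^sub>R \<alpha> (\<phi> x) b)) (at x)"
    by (intro has_derivative_sum has_derivative_scaleR has_derivative_inner_left Y
        has_derivative_compose[OF \<phi> d\<alpha>])
  moreover have "(\<Sum>b\<in>Basis. (Y x \<bullet> b) *\<^sub>R ?D b (\<phi>' h) + (Y' h \<bullet> b) *\<^sub>R \<alpha> (\<phi> x) b)
      = ?D (Y x) (\<phi>' h) + \<alpha> (\<phi> x) (Y' h)" for h
    unfolding sum.distrib sumD[of "Y x"] linear_sum_Basis[OF lin[OF T(2)], of "Y' h", symmetric] ..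
  ultimately have D: "((\<lambda>z. \<Sum>b\<in>Basis. (Y z \<bullet> b) *\<^sub>R \<alpha> (\<phi> z) b) has_derivative
    (\<lambda>h. ?D (Y x) (\<phi>' h) + \<alpha> (\<phi> x) (Y' h))) (at x)" by simp
  have "continuous (at x) \<phi>" using \<phi> by (rule has_derivative_continuous)
  from this[unfolded continuous_at_open, rule_format, OF conjI[OF T]]
  obtain U where "open U \<and> x \<in> U \<and> (\<forall>z\<in>U. \<phi> z \<in> T)" ..
  then have U: "open U" "x \<in> U" "\<And>z. z \<in> U \<Longrightarrow> \<phi> z \<in> T" by simp_all
  show ?thesis
    by (rule has_derivative_transform_within_open[OF D U(1,2)])
      (rule linear_sum_Basis[OF lin[OF U(3)], symmetric])
qed

lemma along_along:
  fixes f :: "'a::euclidean_space \<Rightarrow> 'b::euclidean_space"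
  assumes S: "open S" "x \<in> S" and f: "smooth_on S f" and Y: "smooth_on S Y"
  shows "along X (along Y f) x = fderiv (\<lambda>y. fderiv f y (Y x)) x (X x)
    + fderiv f x (along X Y x)"
proof -
  have lin: "linear (fderiv f p)" if "p \<in> S" for p
    by (rule linear_frechet_derivative[OF smooth_on_differentiable[OF f that]])
  have "(along Y f has_derivative (\<lambda>h. fderiv (\<lambda>p. fderiv f p (Y x)) x h
     + fderiv f x (fderiv Y x h))) (at x)"
    unfolding along_def
    by (rule has_derivative_apply_linear[OF has_derivative_ident smooth_on_has_derivative[OF Y S(2)] S lin
       smooth_on_differentiable[OF smooth_on_frechet_derivative[OF f] S(2)]])
  from along_has_derivative[OF this, of X] show ?thesis unfolding along_def[of X Y] .
qed

text \<open>The second-order terms cancel by symmetry of the second derivative; only derivatives of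
  the fields survive.\<close>

lemma along_commutator:
  fixes f :: "'a::euclidean_space \<Rightarrow> 'b::euclidean_space"
  assumes S: "open S" "x \<in> S" and f: "smooth_on S f" and X: "smooth_on S X" and Y: "smooth_on S Y"
  shows "along X (along Y f) x - along Y (along X f) x = fderiv f x (lie X Y x)"
proof -
  have "linear (fderiv f x)"
    by (rule linear_frechet_derivative[OF smooth_on_differentiable[OF f S(2)]])
  then show ?thesis
    using along_along[OF S f Y, of X] along_along[OF S f X, of Y]
      second_derivative_symmetric[OF S f, of "X x" "Y x"]
    by (simp add: lie_def linear_diff)
qed

text \<open>Cartan's formula, on fields pushed forward by \<open>\<phi>\<close>. It serves for three
  maps: a section of the frame bundle of the surface, its product with the Minkowski frames, and the
  identity of a coordinate domain.\<close>

lemma ext_deriv_pullback: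
  fixes \<alpha> :: "('e::euclidean_space, real) form" and \<phi> :: "'p::euclidean_space \<Rightarrow> 'e"
  assumes S: "open S" "x \<in> S" and \<phi>: "smooth_on S \<phi>" and X: "smooth_on S X" and Y: "smooth_on S Y"
    and T: "open T" "\<phi> x \<in> T" and lin: "\<And>p. p \<in> T \<Longrightarrow> linear (\<alpha> p)"
    and diff: "\<And>v. (\<lambda>p. \<alpha> p v) differentiable (at (\<phi> x))"
  shows "(\<lambda>z. \<alpha> (\<phi> z) (along Y \<phi> z)) differentiable (at x)"
    and "ext_deriv \<alpha> (\<phi> x) (along X \<phi> x) (along Y \<phi> x) =
      along X (\<lambda>z. \<alpha> (\<phi> z) (along Y \<phi> z)) x - along Y (\<lambda>z. \<alpha> (\<phi> z) (along X \<phi> z)) x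
      - \<alpha> (\<phi> x) (fderiv \<phi> x (lie X Y x))"
proof -
  have D: "((\<lambda>z. \<alpha> (\<phi> z) (along Z \<phi> z)) has_derivative
     (\<lambda>h. fderiv (\<lambda>p. \<alpha> p (along Z \<phi> x)) (\<phi> x) (fderiv \<phi> x h) +
        \<alpha> (\<phi> x) (fderiv (along Z \<phi>) x h))) (at x)" if "smooth_on S Z" for Z
    by (rule has_derivative_apply_linear[OF smooth_on_has_derivative[OF \<phi> S(2)]
       smooth_on_has_derivative[OF smooth_on_along[OF S(1) that \<phi>] S(2)] T lin diff])
  show "(\<lambda>z. \<alpha> (\<phi> z) (along Y \<phi> z)) differentiable (at x)"
    using D[OF Y] unfolding differentiable_def by blast
  have D': "along Z' (\<lambda>z. \<alpha> (\<phi> z) (along Z \<phi> z)) x =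
    fderiv (\<lambda>p. \<alpha> p (along Z \<phi> x)) (\<phi> x) (along Z' \<phi> x) + \<alpha> (\<phi> x) (along Z' (along Z \<phi>) x)"
    if "smooth_on S Z" for Z Z'
    using along_has_derivative[OF D[OF that], of Z'] by (simp add: along_def)
  show "ext_deriv \<alpha> (\<phi> x) (along X \<phi> x) (along Y \<phi> x) =
      along X (\<lambda>z. \<alpha> (\<phi> z) (along Y \<phi> z)) x - along Y (\<lambda>z. \<alpha> (\<phi> z) (along X \<phi> z)) x
      - \<alpha> (\<phi> x) (fderiv \<phi> x (lie X Y x))"
    unfolding D'[OF X] D'[OF Y] ext_deriv_def
    using along_commutator[OF S \<phi> X Y] linear_diff[OF lin[OF T(2)], of "along X (along Y \<phi>) x" "along Y (along X \<phi>) x"]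
    by simp
qed

subsection \<open>Tangent vectors\<close>

text \<open>Curves realizing tangent vectors have to be defined for all times, hence the sine.\<close>

lemma tangent_vectors_open:
  fixes S :: "'a::euclidean_space set"
  assumes "open S" "x \<in> S"
  shows "tangent_vectors S x = UNIV"
proof -
  have "\<exists>\<gamma>. (\<forall>t. \<gamma> t \<in> S) \<and> \<gamma> 0 = x \<and> (\<gamma> has_vector_derivative v) (at 0)" for v
  proof -
    obtain d where d: "0 < d" "ball x d \<subseteq> S" using assms openE by blast
    define m where "m = d / (norm v + 1)"
    have n: "0 < norm v + 1" by (smt (verit) norm_ge_zero)
    have m: "0 < m" using d n by (simp add: m_def)
    define \<gamma> where "\<gamma> = (\<lambda>t::real. x + (m * sin (t / m)) *\<^sub>R v)"
    have "\<gamma> t \<in> S" for t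
    proof -
      have "norm ((m * sin (t / m)) *\<^sub>R v) \<le> m * norm v"
        using m abs_sin_le_one[of "t / m"] by (simp add: abs_mult mult_left_le mult_right_mono)
      also have "\<dots> < m * (norm v + 1)" using m by simp
      also have "\<dots> = d" using n by (simp add: m_def)
      finally have "\<gamma> t \<in> ball x d" by (simp add: \<gamma>_def dist_norm)
      then show ?thesis using d by blast
    qed
    moreover have "\<gamma> 0 = x" by (simp add: \<gamma>_def)
    moreover have "(\<gamma> has_vector_derivative v) (at 0)"
    proof -
      have "((\<lambda>t. m * sin (t / m)) has_real_derivative 1) (at 0)"
        using m by (auto intro!: derivative_eq_intros)
      then have "((\<lambda>t. x + (m * sin (t / m)) *\<^sub>R v) has_vector_derivative 1 *\<^sub>R v) (at 0)"
        using m by (auto intro!: derivative_eq_intros)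
      then show ?thesis by (simp add: \<gamma>_def)
    qed
    ultimately show ?thesis by blast
  qed
  then show ?thesis unfolding tangent_vectors_def by blast
qed

lemma tangent_vectors_Times:
  assumes "u \<in> tangent_vectors M x" "v \<in> tangent_vectors N y"
  shows "(u, v) \<in> tangent_vectors (M \<times> N) (x, y)"
proof -
  obtain \<gamma> \<delta> where "\<forall>t. \<gamma> t \<in> M" "\<gamma> 0 = x" "(\<gamma> has_vector_derivative u) (at 0)"
    "\<forall>t. \<delta> t \<in> N" "\<delta> 0 = y" "(\<delta> has_vector_derivative v) (at 0)"
    using assms unfolding tangent_vectors_def by blast
  then show ?thesis unfolding tangent_vectors_def
    by (auto intro!: exI[of _ "\<lambda>t. (\<gamma> t, \<delta> t)"] has_vector_derivative_Pair)
qed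

lemma tangent_vectors_image:
  assumes v: "v \<in> tangent_vectors M x" and D: "(\<phi> has_derivative \<phi>') (at x)"
    and \<phi>: "\<And>z. z \<in> M \<Longrightarrow> \<phi> z \<in> N"
  shows "\<phi>' v \<in> tangent_vectors N (\<phi> x)"
proof -
  obtain \<gamma> where \<gamma>: "\<forall>t. \<gamma> t \<in> M" "\<gamma> 0 = x" "(\<gamma> has_vector_derivative v) (at 0)"
    using v unfolding tangent_vectors_def by blast
  have "((\<lambda>t. \<phi> (\<gamma> t)) has_derivative (\<lambda>h. \<phi>' (h *\<^sub>R v))) (at 0)"
    using has_derivative_compose[OF \<gamma>(3)[unfolded has_vector_derivative_def], of \<phi> \<phi>'] D \<gamma>(2) by simp
  then have "((\<lambda>t. \<phi> (\<gamma> t)) has_vector_derivative \<phi>' v) (at 0)"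
    unfolding has_vector_derivative_def using linear_scale[OF has_derivative_linear[OF D]] by simp
  then show ?thesis unfolding tangent_vectors_def
    using \<gamma>(1,2) \<phi> by (auto intro!: exI[of _ "\<lambda>t. \<phi> (\<gamma> t)"])
qed

text \<open>\<open>F\<close> vanishes along the curve that realizes \<open>v\<close>. This is the
  device for differentiating identities that hold only on a submanifold.\<close>

lemma derivative_tangent_eq_0:
  fixes F :: "'a::euclidean_space \<Rightarrow> 'b::euclidean_space"
  assumes v: "v \<in> tangent_vectors M x" and D: "(F has_derivative F') (at x)"
    and U: "open U" "x \<in> U" and F0: "\<And>z. z \<in> M \<Longrightarrow> z \<in> U \<Longrightarrow> F z = 0"
  shows "F' v = 0"
proof -
  obtain \<gamma> where \<gamma>: "\<forall>t. \<gamma> t \<in> M" "\<gamma> 0 = x" "(\<gamma> has_vector_derivative v) (at 0)"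
    using v unfolding tangent_vectors_def by blast
  have "((\<lambda>t. F (\<gamma> t)) has_derivative (\<lambda>h. F' (h *\<^sub>R v))) (at 0)"
    using has_derivative_compose[OF \<gamma>(3)[unfolded has_vector_derivative_def], of F F'] D \<gamma>(2) by simp
  moreover have "continuous (at 0) \<gamma>" using \<gamma>(3) by (rule has_vector_derivative_continuous)
  from this[unfolded continuous_at_open, rule_format, of U]
  obtain V where V: "open V" "0 \<in> V" "\<And>t. t \<in> V \<Longrightarrow> \<gamma> t \<in> U"
    using U \<gamma>(2) by auto
  ultimately have "((\<lambda>t. 0) has_derivative (\<lambda>h. F' (h *\<^sub>R v))) (at (0::real))"
    using has_derivative_transform_within_open[OF _ V(1,2), of "\<lambda>t. F (\<gamma> t)" _ UNIV "\<lambda>t. 0"] F0 \<gamma>(1) by auto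
  then have "(\<lambda>h::real. F' (h *\<^sub>R v)) = (\<lambda>h. 0)"
    using has_derivative_unique[OF _ has_derivative_const[of 0]] by blast
  from fun_cong[OF this, of 1] show ?thesis by simp
qed

subsection \<open>Moving frames on a Lorentzian surface\<close>

lemma eta1_eq: "eta1 g p v = g (fst p) (fst v) (fst (snd p))"
  by (cases p; cases v) simp

lemma eta2_eq: "eta2 g p v = - g (fst p) (fst v) (snd (snd p))"
  by (cases p; cases v) simp

lemma bilinear_linear1: "bilinear h \<Longrightarrow> linear (\<lambda>x. h x y)"
  by (simp add: bilinear_def)

lemma bilinear_linear2: "bilinear h \<Longrightarrow> linear (h x)"
  using bilinear_def[of h] by (simp add: eta_contract_eq)

lemma smooth_on_bilinear_apply:
  fixes g :: "'a::euclidean_space \<Rightarrow> 'b::euclidean_space \<Rightarrow> 'b \<Rightarrow> real"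
  assumes S: "open S" and T: "open T" and g: "\<And>a b. smooth_on T (\<lambda>x. g x a b)"
    and bil: "\<And>x. x \<in> T \<Longrightarrow> bilinear (g x)"
    and \<phi>: "smooth_on S \<phi>" "\<And>x. x \<in> S \<Longrightarrow> \<phi> x \<in> T" and XY: "smooth_on S X" "smooth_on S Y"
  shows "smooth_on S (\<lambda>x. g (\<phi> x) (X x) (Y x))"
proof -
  let ?G = "\<lambda>x v. g (\<phi> x) v (Y x)"
  have 1: "smooth_on S (\<lambda>x. ?G x v)" for v
    by (rule smooth_on_apply_linear[where \<alpha> = "\<lambda>x. g x v", OF S T g bilinear_linear2[OF bil] \<phi> XY(2)])
  show ?thesis
    by (rule smooth_on_apply_linear[where \<alpha> = ?G and \<phi> = "\<lambda>x. x", OF S S 1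
          bilinear_linear1[OF bil[OF \<phi>(2)]] smooth_on_ident _ XY(1)])
qed

text \<open>Orthonormality forces linear independence, so Cramer's rule expands \<open>v\<close>;
  the minus sign is the square -1 of \<open>e2\<close>.\<close>

lemma orthonormal_pair_basis:
  fixes v :: "real^2"
  assumes bil: "bilinear (g x)" and sym: "\<And>a b. g x a b = g x b a" and on: "orthonormal_pair g x e1 e2"
  shows "v = g x v e1 *\<^sub>R e1 - g x v e2 *\<^sub>R e2"
proof -
  note L = bilinear_ladd[OF bil] bilinear_lmul[OF bil] bilinear_lsub[OF bil] bilinear_lzero[OF bil]
  have o: "g x e1 e1 = 1" "g x e2 e2 = -1" "g x e1 e2 = 0" "g x e2 e1 = 0"
    using on sym unfolding orthonormal_pair_def by auto
  define d where "d = e1$1 * e2$2 - e1$2 * e2$1"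
  have indep: "a = 0 \<and> b = 0" if "a *\<^sub>R e1 + b *\<^sub>R e2 = 0" for a b
  proof -
    have "g x (a *\<^sub>R e1 + b *\<^sub>R e2) e1 = 0" "g x (a *\<^sub>R e1 + b *\<^sub>R e2) e2 = 0"
      using that by (simp_all add: L)
    then show ?thesis by (simp add: L o)
  qed
  have "d \<noteq> 0"
  proof
    assume "d = 0"
    then have "e2$2 *\<^sub>R e1 + (- e1$2) *\<^sub>R e2 = 0" "e2$1 *\<^sub>R e1 + (- e1$1) *\<^sub>R e2 = 0"
      by (simp_all add: d_def vec_eq_iff forall_2 algebra_simps)
    then have "e1$1 = 0" "e1$2 = 0" using indep[of "e2$1" "- e1$1"] indep[of "e2$2" "- e1$2"] by simp_all
    then have "e1 = 0" by (simp add: vec_eq_iff forall_2)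
    then show False using o(1) by (simp add: L)
  qed
  define a where "a = (v$1 * e2$2 - v$2 * e2$1) / d"
  define b where "b = (e1$1 * v$2 - e1$2 * v$1) / d"
  have "d * (a * e1$i + b * e2$i) = d * v$i" for i
  proof -
    have "d * (a * e1$i + b * e2$i) = (d * a) * e1$i + (d * b) * e2$i" by (simp add: algebra_simps)
    also have "\<dots> = (v$1 * e2$2 - v$2 * e2$1) * e1$i + (e1$1 * v$2 - e1$2 * v$1) * e2$i"
      using \<open>d \<noteq> 0\<close> by (simp add: a_def b_def)
    also have "\<dots> = d * v$i"
      using exhaust_2[of i] by (auto simp: d_def algebra_simps)
    finally show ?thesis .
  qed
  then have v: "v = a *\<^sub>R e1 + b *\<^sub>R e2" using \<open>d \<noteq> 0\<close> by (simp add: vec_eq_iff)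
  have "g x v e1 = a" "g x v e2 = - b" unfolding v by (simp_all add: L o)
  then show ?thesis using v by simp
qed

text \<open>\<open>D\<close> is a chart domain and \<open>S\<close> a piece of it carrying an
  orthonormal frame. Along this section of the frame bundle the structure equations turn into
  identities between functions on \<open>S\<close>.\<close>

locale moving_frame =
  fixes D S :: "(real^2) set" and g :: local_metric and \<omega> :: "(frame2, real) form"
    and \<kappa> :: "real^2 \<Rightarrow> real" and e1 e2 :: "real^2 \<Rightarrow> real^2"
  assumes D: "open D" and S: "open S" "S \<subseteq> D"
    and g_smooth: "\<And>a b. smooth_on D (\<lambda>x. g x a b)"
    and g_bilinear: "\<And>x. x \<in> D \<Longrightarrow> bilinear (g x)"
    and g_sym: "\<And>x a b. x \<in> D \<Longrightarrow> g x a b = g x b a"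
    and structure_eqs: "structure_equations D g \<omega> \<kappa>"
    and e1: "smooth_on S e1" and e2: "smooth_on S e2"
    and orthonormal: "\<And>x. x \<in> S \<Longrightarrow> orthonormal_pair g x (e1 x) (e2 x)"
begin

lemmas smooth_ops = smooth_on_const smooth_on_add[OF S(1)] smooth_on_diff[OF S(1)] smooth_on_mult[OF S(1)]
  smooth_on_minus[OF S(1)] smooth_on_power[OF S(1)] smooth_on_sqrt[OF S(1)] smooth_on_inverse[OF S(1)]
  smooth_on_divide[OF S(1)]

definition frame_at :: "real^2 \<Rightarrow> frame2" where
  "frame_at x = (x, e1 x, e2 x)"

text \<open>The components of the pulled-back connection form: along the section it equals
  \<open>w1 \<eta>\<^sup>1 + w2 \<eta>\<^sup>2\<close>.\<close>

definition w1 :: "real^2 \<Rightarrow> real" where "w1 x = \<omega> (frame_at x) (along e1 frame_at x)"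
definition w2 :: "real^2 \<Rightarrow> real" where "w2 x = \<omega> (frame_at x) (along e2 frame_at x)"

lemma metric_frame:
  assumes "x \<in> S"
  shows "g x (e1 x) (e1 x) = 1" "g x (e2 x) (e2 x) = -1" "g x (e1 x) (e2 x) = 0" "g x (e2 x) (e1 x) = 0"
  using orthonormal[OF assms] g_sym[of x "e2 x" "e1 x"] S(2) assms unfolding orthonormal_pair_def by auto

lemma smooth_frame_at: "smooth_on S frame_at"
proof -
  have "smooth_on S (\<lambda>x. (x, e1 x, e2 x))"
    by (intro smooth_on_Pair[OF S(1)] smooth_on_ident e1 e2)
  then show ?thesis unfolding frame_at_def .
qed

lemma along_frame_at:
  assumes "x \<in> S"
  shows "along X frame_at x = (X x, along X e1 x, along X e2 x)"
proof -
  have "((\<lambda>x. (x, e1 x, e2 x)) has_derivative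
     (\<lambda>h. (h, fderiv e1 x h, fderiv e2 x h))) (at x)"
    by (intro has_derivative_Pair has_derivative_ident smooth_on_has_derivative[OF e1 assms]
        smooth_on_has_derivative[OF e2 assms])
  from along_has_derivative[OF this, of X] show ?thesis unfolding frame_at_def by (simp add: along_def)
qed

lemma frame_at_in: "x \<in> S \<Longrightarrow> frame_at x \<in> frame_bundle D g"
  using orthonormal S(2) unfolding frame_bundle_def frame_at_def by auto

lemma frame_at_in_open: "x \<in> S \<Longrightarrow> frame_at x \<in> D \<times> UNIV"
  using S(2) unfolding frame_at_def by auto

lemma tangent_frame_at:
  assumes "x \<in> S"
  shows "along X frame_at x \<in> tangent_vectors (frame_bundle D g) (frame_at x)"
  unfolding along_def
  by (rule tangent_vectors_image[OF _ smooth_on_has_derivative[OF smooth_frame_at assms] frame_at_in])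
    (simp_all add: tangent_vectors_open[OF S(1) assms])

lemma connection_form:
  shows "open (D \<times> (UNIV :: ((real^2) \<times> (real^2)) set))"
    and "p \<in> D \<times> UNIV \<Longrightarrow> linear (\<omega> p)" and "smooth_on (D \<times> UNIV) (\<lambda>p. \<omega> p v)"
proof -
  show "open (D \<times> (UNIV :: ((real^2) \<times> (real^2)) set))" using D by (simp add: open_Times)
  have "(\<forall>p\<in>D \<times> UNIV. linear (\<omega> p)) \<and> (\<forall>v. smooth_on (D \<times> UNIV) (\<lambda>p. \<omega> p v))"
    using structure_eqs unfolding structure_equations_def smooth_form_def by (rule conjunct1)
  then show "p \<in> D \<times> UNIV \<Longrightarrow> linear (\<omega> p)" and "smooth_on (D \<times> UNIV) (\<lambda>p. \<omega> p v)"
    by blast+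
qed

lemma smooth_w:
  shows "smooth_on S w1" "smooth_on S w2"
proof -
  note r = smooth_on_apply_linear[OF S(1) connection_form(1) connection_form(3) connection_form(2)
        smooth_frame_at frame_at_in_open]
  show "smooth_on S w1" unfolding w1_def by (rule r[OF _ _ smooth_on_along[OF S(1) e1 smooth_frame_at]])
  show "smooth_on S w2" unfolding w2_def by (rule r[OF _ _ smooth_on_along[OF S(1) e2 smooth_frame_at]])
qed

lemma linear_eta:
  assumes "p \<in> D \<times> UNIV"
  shows "linear (eta1 g p)" "linear (eta2 g p)"
proof -
  have "fst p \<in> D" using assms by auto
  note b = bilinear_ladd[OF g_bilinear[OF this]] bilinear_lmul[OF g_bilinear[OF this]]
  show "linear (eta1 g p)" "linear (eta2 g p)"
    by (rule linearI; simp add: eta1_eq eta2_eq b)+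
qed

lemma smooth_eta:
  shows "smooth_on (D \<times> UNIV) (\<lambda>p. eta1 g p v)" "smooth_on (D \<times> UNIV) (\<lambda>p. eta2 g p v)"
proof -
  note o = connection_form(1)
  have f: "smooth_on (D \<times> UNIV) (\<lambda>p::frame2. fst p)" "smooth_on (D \<times> UNIV) (\<lambda>p::frame2. fst (snd p))"
    "smooth_on (D \<times> UNIV) (\<lambda>p::frame2. snd (snd p))"
    by (intro smooth_on_linear bounded_linear_fst bounded_linear_snd
        bounded_linear_compose[OF bounded_linear_fst bounded_linear_snd]
        bounded_linear_compose[OF bounded_linear_snd bounded_linear_snd])+
  show "smooth_on (D \<times> UNIV) (\<lambda>p. eta1 g p v)"
    unfolding eta1_eq
    by (rule smooth_on_bilinear_apply[OF o D g_smooth g_bilinear f(1) _ smooth_on_const f(2)]) auto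
  show "smooth_on (D \<times> UNIV) (\<lambda>p. eta2 g p v)"
    unfolding eta2_eq
    by (rule smooth_on_minus[OF o], rule smooth_on_bilinear_apply[OF o D g_smooth g_bilinear f(1) _ smooth_on_const f(3)]) auto
qed

lemma eta_frame:
  assumes "x \<in> S"
  shows "eta1 g (frame_at x) (along e1 frame_at x) = 1" "eta1 g (frame_at x) (along e2 frame_at x) = 0"
    "eta2 g (frame_at x) (along e1 frame_at x) = 0" "eta2 g (frame_at x) (along e2 frame_at x) = 1"
  using metric_frame[OF assms] unfolding along_frame_at[OF assms] by (simp_all add: frame_at_def)

lemma along_locally_const:
  assumes "x \<in> S" "\<And>z. z \<in> S \<Longrightarrow> f z = c"
  shows "along X f x = 0"
  using along_cong_open[OF S(1) assms(1), of f "\<lambda>_. c" X] assms(2) by (simp add: along_def)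

lemma structure_equations_frame:
  assumes x: "x \<in> S"
  shows "ext_deriv (eta1 g) (frame_at x) (along e1 frame_at x) (along e2 frame_at x) = - w1 x"
    and "ext_deriv (eta2 g) (frame_at x) (along e1 frame_at x) (along e2 frame_at x) = w2 x"
    and "ext_deriv \<omega> (frame_at x) (along e1 frame_at x) (along e2 frame_at x) = - \<kappa> x"
  using structure_eqs frame_at_in[OF x] tangent_frame_at[OF x, of e1] tangent_frame_at[OF x, of e2]
  unfolding structure_equations_def
  by (simp_all add: wedge_def eta_frame[OF x] w1_def w2_def) (simp add: frame_at_def)

text \<open>The values of the canonical forms on the frame are constant, so in Cartan's formula only
  the bracket term remains, and the two torsion-free equations give its components.\<close>

lemma lie_frame:
  assumes x: "x \<in> S"
  shows "lie e1 e2 x = w1 x *\<^sub>R e1 x - w2 x *\<^sub>R e2 x"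
proof -
  let ?V = "fderiv frame_at x (lie e1 e2 x)"
  have V: "?V = (lie e1 e2 x, along (\<lambda>_. lie e1 e2 x) e1 x, along (\<lambda>_. lie e1 e2 x) e2 x)"
    using along_frame_at[OF x, of "\<lambda>_. lie e1 e2 x"] by (simp add: along_def)
  have "eta1 g (frame_at x) ?V = w1 x"
    using ext_deriv_pullback(2)[OF S(1) x smooth_frame_at e1 e2 connection_form(1) frame_at_in_open[OF x]
        linear_eta(1) smooth_on_differentiable[OF smooth_eta(1) frame_at_in_open[OF x]]]
      along_locally_const[OF x eta_frame(2)] along_locally_const[OF x eta_frame(1)]
      structure_equations_frame(1)[OF x] by simp
  then have 1: "g x (lie e1 e2 x) (e1 x) = w1 x" unfolding V by (simp add: frame_at_def)
  have "eta2 g (frame_at x) ?V = - w2 x"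
    using ext_deriv_pullback(2)[OF S(1) x smooth_frame_at e1 e2 connection_form(1) frame_at_in_open[OF x]
        linear_eta(2) smooth_on_differentiable[OF smooth_eta(2) frame_at_in_open[OF x]]]
      along_locally_const[OF x eta_frame(4)] along_locally_const[OF x eta_frame(3)]
      structure_equations_frame(2)[OF x] by simp
  then have 2: "g x (lie e1 e2 x) (e2 x) = w2 x" unfolding V by (simp add: frame_at_def)
  have "x \<in> D" using x S(2) by blast
  from orthonormal_pair_basis[of g x "e1 x" "e2 x", OF g_bilinear[OF this] g_sym[OF this] orthonormal[OF x], of "lie e1 e2 x"]
  show ?thesis by (simp add: 1 2)
qed

lemma curvature_frame:
  assumes x: "x \<in> S"
  shows "along e1 w2 x - along e2 w1 x - (w1 x)\<^sup>2 + (w2 x)\<^sup>2 = - \<kappa> x"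
proof -
  note lin = connection_form(2)[OF frame_at_in_open[OF x]]
  have lf: "linear (fderiv frame_at x)"
    by (rule linear_frechet_derivative[OF smooth_on_differentiable[OF smooth_frame_at x]])
  have "\<omega> (frame_at x) (fderiv frame_at x (lie e1 e2 x)) = (w1 x)\<^sup>2 - (w2 x)\<^sup>2"
    unfolding lie_frame[OF x] linear_diff[OF lf] linear_scale[OF lf] linear_diff[OF lin] linear_scale[OF lin]
    by (simp add: w1_def w2_def along_def power2_eq_square)
  then show ?thesis
    using ext_deriv_pullback(2)[OF S(1) x smooth_frame_at e1 e2 connection_form(1) frame_at_in_open[OF x]
        connection_form(2) smooth_on_differentiable[OF connection_form(3) frame_at_in_open[OF x]]]
      structure_equations_frame(3)[OF x]
    unfolding w1_def[symmetric] w2_def[symmetric] by simp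
qed

text \<open>\<open>\<kappa>\<close> enters the structure equations only through its values;
  \<open>curvature_frame\<close> expresses it by smooth functions.\<close>

lemma smooth_curvature: "smooth_on S \<kappa>"
proof (rule smooth_on_cong[OF S(1)])
  show "smooth_on S (\<lambda>x. - (along e1 w2 x - along e2 w1 x - (w1 x)\<^sup>2 + (w2 x)\<^sup>2))"
    by (intro smooth_ops smooth_on_along[OF S(1) e1] smooth_on_along[OF S(1) e2] smooth_w)
qed (simp add: curvature_frame)

end

text \<open>Gram-Schmidt on the constant fields \<open>a\<close>, \<open>b\<close>, which are
  orthonormal at \<open>x0\<close> and keep their causal types nearby. \<open>h\<close> is minus the
  square of the part of \<open>b\<close> orthogonal to \<open>a\<close>.\<close>

lemma local_orthonormal_frame:
  fixes g :: local_metric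
  assumes D: "open D" and g_smooth: "\<And>a b. smooth_on D (\<lambda>x. g x a b)"
    and bil: "\<And>x. x \<in> D \<Longrightarrow> bilinear (g x)" and sym: "\<And>x a b. x \<in> D \<Longrightarrow> g x a b = g x b a"
    and x0: "x0 \<in> D" and on: "orthonormal_pair g x0 a b"
  shows "\<exists>S e1 e2. open S \<and> x0 \<in> S \<and> S \<subseteq> D \<and> smooth_on S e1 \<and> smooth_on S e2 \<and>
    (\<forall>x\<in>S. orthonormal_pair g x (e1 x) (e2 x))"
proof -
  define f where "f = (\<lambda>x. g x a a)"
  define h where "h = (\<lambda>x. (g x a b)\<^sup>2 / g x a a - g x b b)"
  define S1 where "S1 = {x \<in> D. 0 < f x}"
  have sf: "smooth_on D f" unfolding f_def by (rule g_smooth)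
  have "open S1"
    unfolding S1_def using continuous_open_preimage[OF smooth_on_continuous_on[OF sf] D, of "{0<..}"]
    by (simp add: vimage_def Int_def)
  have S1D: "S1 \<subseteq> D" by (auto simp: S1_def)
  have pos: "\<And>x. x \<in> S1 \<Longrightarrow> 0 < g x a a" by (simp add: S1_def f_def)
  have gs: "smooth_on S1 (\<lambda>x. g x u v)" for u v using smooth_on_subset[OF g_smooth S1D] .
  have sh: "smooth_on S1 h" unfolding h_def
    by (intro smooth_on_diff smooth_on_divide smooth_on_power gs \<open>open S1\<close>) (use pos in fastforce)
  define S where "S = {x \<in> S1. 0 < h x}"
  have oS: "open S"
    unfolding S_def using continuous_open_preimage[OF smooth_on_continuous_on[OF sh] \<open>open S1\<close>, of "{0<..}"]
    by (simp add: vimage_def Int_def)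
  have SS: "S \<subseteq> S1" by (auto simp: S_def)
  have pos': "\<And>x. x \<in> S \<Longrightarrow> 0 < g x a a" "\<And>x. x \<in> S \<Longrightarrow> 0 < h x" using pos SS by (auto simp: S_def)
  note gs' = smooth_on_subset[OF gs SS] and hs = smooth_on_subset[OF sh SS]
  define e1 where "e1 = (\<lambda>x. inverse (sqrt (g x a a)) *\<^sub>R a)"
  define e2 where "e2 = (\<lambda>x. inverse (sqrt (h x)) *\<^sub>R (b - (g x a b / g x a a) *\<^sub>R a))"
  have s1: "smooth_on S e1" unfolding e1_def
  proof (intro smooth_on_scaleR[OF oS] smooth_on_inverse[OF oS] smooth_on_sqrt[OF oS] gs' smooth_on_const)
    show "\<And>x. x \<in> S \<Longrightarrow> sqrt (g x a a) \<noteq> 0" using pos'(1) by fastforce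
  qed (rule pos')
  have s2: "smooth_on S e2" unfolding e2_def
  proof (intro smooth_on_scaleR[OF oS] smooth_on_inverse[OF oS] smooth_on_sqrt[OF oS] gs' hs smooth_on_const
      smooth_on_diff[OF oS] smooth_on_divide[OF oS])
    show "\<And>x. x \<in> S \<Longrightarrow> sqrt (h x) \<noteq> 0" using pos'(2) by fastforce
    show "\<And>x. x \<in> S \<Longrightarrow> g x a a \<noteq> 0" using pos'(1) by fastforce
  qed (rule pos')
  have "orthonormal_pair g x (e1 x) (e2 x)" if x: "x \<in> S" for x
  proof -
    have xD: "x \<in> D" using x SS S1D by blast
    note B = bilinear_ladd[OF bil[OF xD]] bilinear_radd[OF bil[OF xD]] bilinear_lmul[OF bil[OF xD]]
      bilinear_rmul[OF bil[OF xD]] bilinear_lsub[OF bil[OF xD]] bilinear_rsub[OF bil[OF xD]]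
    have A: "g x a a > 0" "h x > 0" using pos' x by auto
    define s where "s = sqrt (g x a a)"
    define t where "t = sqrt (h x)"
    have s: "s > 0" "s * s = g x a a" and t: "t > 0" "t * t = h x" using A by (auto simp: s_def t_def)
    have "g x (e1 x) (e1 x) = 1"
      unfolding e1_def B s_def[symmetric] using s by (simp add: s(2)[symmetric] field_simps)
    moreover have "g x (e1 x) (e2 x) = 0"
      unfolding e1_def e2_def B using A by simp
    moreover have "g x (e2 x) (e2 x) = -1"
    proof -
      have "g x (b - (g x a b / g x a a) *\<^sub>R a) (b - (g x a b / g x a a) *\<^sub>R a) = - h x"
        unfolding B h_def using A by (simp add: sym[OF xD, of b a] field_simps power2_eq_square)
      then have "g x (e2 x) (e2 x) = inverse t * (inverse t * (- (t * t)))"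
        unfolding e2_def bilinear_lmul[OF bil[OF xD]] bilinear_rmul[OF bil[OF xD]] t_def[symmetric] t(2)
        by simp
      then show ?thesis using t(1) by (simp add: field_simps)
    qed
    ultimately show ?thesis by (simp add: orthonormal_pair_def)
  qed
  moreover have "x0 \<in> S"
    using on x0 unfolding orthonormal_pair_def S_def S1_def f_def h_def by simp
  ultimately show ?thesis using oS SS S1D s1 s2 by blast
qed

subsection \<open>The Poincare algebra acting on Minkowski frames\<close>

text \<open>The element \<open>(t\<^sub>1, t\<^sub>2, t\<^sub>3, c, p, q)\<close> is the value of
  \<open>(\<omega>\<^sup>1, \<omega>\<^sup>2, \<omega>\<^sup>3, \<omega>\<^sup>1\<^sub>2, \<omega>\<^sup>3\<^sub>1, \<omega>\<^sup>3\<^sub>2)\<close> on a left invariant vector field.\<close>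

type_synonym poincare = "real \<times> real \<times> real \<times> real \<times> real \<times> real"

fun act :: "poincare \<Rightarrow> frame3 \<Rightarrow> frame3" where
  "act (t1, t2, t3, c, p, q) (\<rho>, e1, e2, e3) =
     (t1 *\<^sub>R e1 + t2 *\<^sub>R e2 + t3 *\<^sub>R e3, c *\<^sub>R e2 + p *\<^sub>R e3, c *\<^sub>R e1 + q *\<^sub>R e3, p *\<^sub>R e1 - q *\<^sub>R e2)"

fun bracket :: "poincare \<Rightarrow> poincare \<Rightarrow> poincare" where
  "bracket (t1, t2, t3, c, p, q) (t1', t2', t3', c', p', q') =
     (c * t2' + p * t3' - c' * t2 - p' * t3, c * t1' - q * t3' - c' * t1 + q' * t3,
      p * t1' + q * t2' - p' * t1 - q' * t2, q' * p - q * p', q * c' - q' * c, p * c' - p' * c)"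

text \<open>Both fields are linear in the frame, so the left side is the Lie bracket of
  \<open>act a\<close> and \<open>act b\<close>; the reversed order of composition comes from each
  field being differentiated along the other.\<close>

lemma act_bracket: "act b (act a f) - act a (act b f) = act (bracket a b) f"
  by (cases a; cases b; cases f) (simp add: algebra_simps)

lemma bounded_bilinear_act: "bounded_bilinear act"
  unfolding bilinear_conv_bounded_bilinear[symmetric] bilinear_def
  by (auto intro!: linearI simp: algebra_simps)

lemma mink_simps:
  "mink (a + b) c = mink a c + mink b c" "mink c (a + b) = mink c a + mink c b"
  "mink (a - b) c = mink a c - mink b c" "mink c (a - b) = mink c a - mink c b"
  "mink (r *\<^sub>R a) c = r * mink a c" "mink c (r *\<^sub>R a) = r * mink c a"
  "mink 0 c = 0" "mink c 0 = 0"
  by (simp_all add: mink_def algebra_simps)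

lemma mink_commute: "mink a b = mink b a"
  by (simp add: mink_def)

definition mink_orthonormal :: "real^3 \<Rightarrow> real^3 \<Rightarrow> real^3 \<Rightarrow> bool" where
  "mink_orthonormal e1 e2 e3 \<longleftrightarrow> mink e1 e1 = 1 \<and> mink e2 e2 = -1 \<and> mink e3 e3 = -1 \<and>
     mink e1 e2 = 0 \<and> mink e1 e3 = 0 \<and> mink e2 e3 = 0"

lemma mink_frame_bundle_iff: "(\<rho>, e1, e2, e3) \<in> mink_frame_bundle \<longleftrightarrow> mink_orthonormal e1 e2 e3"
  by (simp add: mink_frame_bundle_def mink_orthonormal_def)

lemma mink_orthonormalD:
  assumes "mink_orthonormal e1 e2 e3"
  shows "mink e1 e1 = 1" "mink e2 e2 = -1" "mink e3 e3 = -1" "mink e1 e2 = 0" "mink e1 e3 = 0" "mink e2 e3 = 0"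
    "mink e2 e1 = 0" "mink e3 e1 = 0" "mink e3 e2 = 0"
  using assms mink_commute[of e2 e1] mink_commute[of e3 e1] mink_commute[of e3 e2]
  unfolding mink_orthonormal_def by simp_all

lemma mink_orthonormal_boost12:
  assumes "mink_orthonormal e1 e2 e3" and "C * C - S * S = 1"
  shows "mink_orthonormal (C *\<^sub>R e1 + S *\<^sub>R e2) (S *\<^sub>R e1 + C *\<^sub>R e2) e3"
  unfolding mink_orthonormal_def using assms(2)
  by (simp add: mink_simps mink_orthonormalD[OF assms(1)])

lemma mink_orthonormal_boost13:
  assumes "mink_orthonormal e1 e2 e3" and "C * C - S * S = 1"
  shows "mink_orthonormal (C *\<^sub>R e1 + S *\<^sub>R e3) e2 (S *\<^sub>R e1 + C *\<^sub>R e3)"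
  unfolding mink_orthonormal_def using assms(2)
  by (simp add: mink_simps mink_orthonormalD[OF assms(1)])

lemma mink_orthonormal_rotation23:
  assumes "mink_orthonormal e1 e2 e3" and "C * C + S * S = 1"
  shows "mink_orthonormal e1 (C *\<^sub>R e2 + S *\<^sub>R e3) ((- S) *\<^sub>R e2 + C *\<^sub>R e3)"
  unfolding mink_orthonormal_def using assms(2)
  by (simp add: mink_simps mink_orthonormalD[OF assms(1)])

text \<open>A curve of exact Minkowski frames with the right velocity: a boost in the plane of
  \<open>e1\<close>, \<open>e2\<close>, a boost involving \<open>e3\<close> and a rotation,
  composed. To first order at t = 0 the three contributions simply add.\<close>

lemma act_tangent:
  assumes "f \<in> mink_frame_bundle"
  shows "act a f \<in> tangent_vectors mink_frame_bundle f"
proof -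
  obtain \<rho> e1 e2 e3 where f: "f = (\<rho>, e1, e2, e3)" by (cases f)
  obtain t1 t2 t3 c p q where a: "a = (t1, t2, t3, c, p, q)" by (cases a)
  have on: "mink_orthonormal e1 e2 e3" using assms unfolding f mink_frame_bundle_iff .
  let ?C = "\<lambda>t. cosh (c * t)" and ?S = "\<lambda>t. sinh (c * t)"
  let ?P = "\<lambda>t. cosh (p * t)" and ?Q = "\<lambda>t. sinh (p * t)"
  let ?R = "\<lambda>t. cos (q * t)" and ?T = "\<lambda>t. sin (q * t)"
  define E1 where "E1 = (\<lambda>t. ?P t *\<^sub>R (?C t *\<^sub>R e1 + ?S t *\<^sub>R e2) + ?Q t *\<^sub>R e3)"
  define F2 where "F2 = (\<lambda>t. ?S t *\<^sub>R e1 + ?C t *\<^sub>R e2)"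
  define F3 where "F3 = (\<lambda>t. ?Q t *\<^sub>R (?C t *\<^sub>R e1 + ?S t *\<^sub>R e2) + ?P t *\<^sub>R e3)"
  define E2 where "E2 = (\<lambda>t. ?R t *\<^sub>R F2 t + ?T t *\<^sub>R F3 t)"
  define E3 where "E3 = (\<lambda>t. (- ?T t) *\<^sub>R F2 t + ?R t *\<^sub>R F3 t)"
  define \<gamma> where "\<gamma> = (\<lambda>t. (\<rho> + t *\<^sub>R (t1 *\<^sub>R e1 + t2 *\<^sub>R e2 + t3 *\<^sub>R e3), E1 t, E2 t, E3 t))"
  have h: "cosh x * cosh x - sinh x * sinh x = 1" for x :: real
    using hyperbolic_pythagoras[of x] by (simp add: power2_eq_square)
  have r: "cos x * cos x + sin x * sin x = 1" for x :: real
    using sin_cos_squared_add3[of x] by simp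
  have "mink_orthonormal (E1 t) (F2 t) (F3 t)" for t
    unfolding E1_def F2_def F3_def
    by (rule mink_orthonormal_boost13[OF mink_orthonormal_boost12[OF on h] h])
  then have "mink_orthonormal (E1 t) (E2 t) (E3 t)" for t
    unfolding E2_def E3_def by (rule mink_orthonormal_rotation23[OF _ r])
  then have "\<forall>t. \<gamma> t \<in> mink_frame_bundle"
    by (simp add: mink_frame_bundle_iff \<gamma>_def)
  moreover have "\<gamma> 0 = f" by (simp add: \<gamma>_def f E1_def E2_def E3_def F2_def F3_def)
  moreover have "(\<gamma> has_vector_derivative act a f) (at 0)"
    unfolding \<gamma>_def E1_def E2_def E3_def F2_def F3_def f a act.simps
    by (intro has_vector_derivative_Pair) (auto intro!: derivative_eq_intros)
  ultimately show ?thesis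
    unfolding tangent_vectors_def by blast
qed

lemma in_span_at_zero:
  assumes "in_span_at N gs y \<xi>" "v \<in> tangent_vectors N y" "\<And>h. h \<in> set gs \<Longrightarrow> h y v = 0"
  shows "\<xi> v = 0"
proof -
  obtain c where "\<xi> v = (\<Sum>i<length gs. c i * (gs ! i) y v)" using assms(1,2) unfolding in_span_at_def by blast
  also have "\<dots> = 0" using assms(3) by (intro sum.neutral) auto
  finally show ?thesis .
qed

section \<open>The Frobenius subbundle pulled back to the base times the Minkowski frames\<close>

abbreviation frame_pairs :: "(real^2) set \<Rightarrow> local_metric \<Rightarrow> (frame2 \<times> frame3) set" where
  "frame_pairs D g \<equiv> frame_bundle D g \<times> mink_frame_bundle"

text \<open>A product neighbourhood carrying one Frobenius frame inside the singular system with s =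
  1. \<open>D1\<close> is kept apart from \<open>S\<close> so that the base can be shrunk while the
  moving frame stays; \<open>f0\<close> witnesses that \<open>F\<close> contains a Minkowski
  frame.\<close>

locale frobenius_patch = moving_frame +
  fixes k :: "real^2 \<Rightarrow> real" and D1 :: "(real^2) set" and F :: "frame3 set" and f0 :: frame3
    and W :: "(frame2 \<times> frame3) set" and r :: nat and \<alpha> :: "nat \<Rightarrow> (frame2 \<times> frame3, real) form"
  assumes k: "\<And>x. k x = sqrt \<bar>\<kappa> x\<bar>" and negative: "\<And>x. x \<in> S \<Longrightarrow> \<kappa> x < 0"
    and D1: "open D1" "D1 \<subseteq> S" and F: "open F" and f0: "f0 \<in> F" "f0 \<in> mink_frame_bundle"
    and W: "open W" "\<And>x f. x \<in> D1 \<Longrightarrow> f \<in> F \<Longrightarrow> (frame_at x, f) \<in> W" and r: "2 \<le> r"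
    and frobenius: "frobenius_frame (frame_pairs D g) W r \<alpha>"
    and span: "\<And>y i. y \<in> frame_pairs D g \<inter> W \<Longrightarrow> i < r \<Longrightarrow>
      in_span_at (frame_pairs D g) (singular_system g \<omega> \<kappa> 1) y (\<alpha> i y)"
    and transverse: "\<And>y c. y \<in> frame_pairs D g \<inter> W \<Longrightarrow>
      in_span_at (frame_pairs D g) (embedding_system g \<omega>) y (\<lambda>v. \<Sum>i<r. c i * \<alpha> i y v) \<Longrightarrow>
      \<forall>v\<in>tangent_vectors (frame_pairs D g) y. (\<Sum>i<r. c i * \<alpha> i y v) = 0"
begin

lemmas smooth_ops1 = smooth_on_const smooth_on_add[OF D1(1)] smooth_on_diff[OF D1(1)] smooth_on_mult[OF D1(1)]
  smooth_on_minus[OF D1(1)] smooth_on_divide[OF D1(1)]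

abbreviation "N \<equiv> frame_pairs D g"

text \<open>The values that the singular system forces on the Minkowski forms along
  \<open>e1\<close> and \<open>e2\<close>. The last two entries say
  \<open>\<omega>\<^sup>3\<^sub>1 = k \<eta>\<^sup>2\<close> and
  \<open>\<omega>\<^sup>3\<^sub>2 = - k \<eta>\<^sup>1\<close>: a skew second fundamental
  form.\<close>

definition A1 :: "real^2 \<Rightarrow> poincare" where "A1 x = (1, 0, 0, w1 x, 0, - k x)"
definition A2 :: "real^2 \<Rightarrow> poincare" where "A2 x = (0, 1, 0, w2 x, k x, 0)"

definition embed :: "(real^2) \<times> frame3 \<Rightarrow> frame2 \<times> frame3" where
  "embed z = (frame_at (fst z), snd z)"

definition field :: "(real^2 \<Rightarrow> real^2) \<Rightarrow> (real^2 \<Rightarrow> poincare) \<Rightarrow> (real^2) \<times> frame3 \<Rightarrow> (real^2) \<times> frame3" where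
  "field s a z = (s (fst z), act (a (fst z)) (snd z))"

text \<open>The field is defined on the whole ambient space through \<open>act\<close>, but
  annihilation is required only at orthonormal frames, since off the bundle nothing is known about
  \<open>\<alpha>\<close>.\<close>

definition killed :: "(real^2 \<Rightarrow> real^2) \<Rightarrow> (real^2 \<Rightarrow> poincare) \<Rightarrow> bool" where
  "killed s a \<longleftrightarrow> (\<forall>x\<in>D1. \<forall>f\<in>F \<inter> mink_frame_bundle. \<forall>i<r.
     \<alpha> i (frame_at x, f) (along s frame_at x, act (a x) f) = 0)"

lemma open_P: "open (D1 \<times> (UNIV :: frame3 set))"
  using D1 by (simp add: open_Times)

lemma smooth_fst:
  fixes s :: "real^2 \<Rightarrow> 'z::real_normed_vector"
  assumes "smooth_on D1 s"
  shows "smooth_on (D1 \<times> (UNIV::frame3 set)) (\<lambda>z. s (fst z))"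
  by (rule smooth_on_compose[OF open_P D1(1) assms smooth_on_linear[OF bounded_linear_fst]]) auto

lemma smooth_embed: "smooth_on (D1 \<times> UNIV) embed"
  unfolding embed_def
  by (intro smooth_on_Pair[OF open_P] smooth_fst smooth_on_linear[OF bounded_linear_snd]
      smooth_on_subset[OF smooth_frame_at D1(2)])

lemma smooth_field:
  assumes "smooth_on D1 s" "smooth_on D1 a"
  shows "smooth_on (D1 \<times> UNIV) (field s a)"
  unfolding field_def
  by (rule smooth_on_Pair[OF open_P smooth_fst[OF assms(1)] smooth_on_bilinear[OF open_P bounded_bilinear_act
      smooth_fst[OF assms(2)] smooth_on_linear[OF bounded_linear_snd]]])

lemma has_derivative_fst_compose:
  fixes b :: "real^2 \<Rightarrow> 'z::real_normed_vector" and f :: frame3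
  assumes "(b has_derivative b') (at x)"
  shows "((\<lambda>z. b (fst z)) has_derivative (\<lambda>h. b' (fst h))) (at (x, f))"
  using has_derivative_compose[OF bounded_linear_imp_has_derivative[OF bounded_linear_fst], of b b' "(x, f)"]
    assms by simp

lemma embed_derivative:
  assumes "x \<in> D1"
  shows "fderiv embed (x, f) (u, v) = (fderiv frame_at x u, v)"
proof -
  have x: "x \<in> S" using assms D1 by blast
  have "((\<lambda>z. (frame_at (fst z), snd z)) has_derivative
      (\<lambda>h. (fderiv frame_at x (fst h), snd h))) (at (x, f))"
    by (rule has_derivative_Pair[OF has_derivative_fst_compose[OF smooth_on_has_derivative[OF smooth_frame_at x]]
       bounded_linear_imp_has_derivative[OF bounded_linear_snd]])
  from frechet_derivative_eq[OF this] show ?thesis unfolding embed_def by simp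
qed

lemma along_embed: "x \<in> D1 \<Longrightarrow> along (field s a) embed (x, f) = (along s frame_at x, act (a x) f)"
  unfolding along_def field_def by (simp add: embed_derivative)

lemma along_field:
  assumes x: "x \<in> D1" and s': "smooth_on D1 s'" and a': "smooth_on D1 a'"
  shows "along (field s a) (field s' a') (x, f) = (along s s' x, act (along s a' x) f + act (a' x) (act (a x) f))"
proof -
  have "((\<lambda>z. (s' (fst z), act (a' (fst z)) (snd z))) has_derivative
      (\<lambda>h. (fderiv s' x (fst h), act (a' (fst (x, f))) (snd h) +
         act (fderiv a' x (fst h)) (snd (x, f))))) (at (x, f))"
    by (rule has_derivative_Pair[OF has_derivative_fst_compose[OF smooth_on_has_derivative[OF s' x]]
        bounded_bilinear.FDERIV[OF bounded_bilinear_act has_derivative_fst_compose[OF smooth_on_has_derivative[OF a' x]]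
        bounded_linear_imp_has_derivative[OF bounded_linear_snd]]])
  from along_has_derivative[OF this, of "field s a"] show ?thesis
    unfolding field_def along_def by (simp add: add.commute)
qed

lemma lie_field:
  assumes x: "x \<in> D1" and s: "smooth_on D1 s" "smooth_on D1 s'" and a: "smooth_on D1 a" "smooth_on D1 a'"
  shows "lie (field s a) (field s' a') (x, f) =
    (lie s s' x, act (along s a' x - along s' a x + bracket (a x) (a' x)) f)"
  unfolding lie_def along_field[OF x s(2) a(2)] along_field[OF x s(1) a(1)]
  using act_bracket[of "a' x" "a x" f]
  by (simp add: bounded_bilinear.diff_left[OF bounded_bilinear_act] bounded_bilinear.add_left[OF bounded_bilinear_act])

lemma N_W: "x \<in> D1 \<Longrightarrow> f \<in> F \<Longrightarrow> f \<in> mink_frame_bundle \<Longrightarrow> (frame_at x, f) \<in> N \<inter> W"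
  using W(2) frame_at_in D1 by blast

lemma form_linear: "i < r \<Longrightarrow> y \<in> W \<Longrightarrow> linear (\<alpha> i y)"
  using frobenius unfolding frobenius_frame_def smooth_form_def by blast

lemma form_smooth: "i < r \<Longrightarrow> smooth_on W (\<lambda>p. \<alpha> i p v)"
  using frobenius unfolding frobenius_frame_def smooth_form_def by blast

lemma tangent_embed:
  assumes "x \<in> D1" "f \<in> mink_frame_bundle"
  shows "(along s frame_at x, act a f) \<in> tangent_vectors N (frame_at x, f)"
  by (rule tangent_vectors_Times[OF tangent_frame_at act_tangent]) (use assms D1 in auto)

text \<open>The Frobenius condition makes the differential of each \<open>\<alpha> i\<close> vanish
  on a pair of annihilated fields X, Y. In Cartan's formula the terms X(\<open>\<alpha> i\<close> Y)
  and Y(\<open>\<alpha> i\<close> X) vanish as well, because these functions are zero on the frame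
  bundle near the point and both fields are tangent to it. What is left is \<open>\<alpha> i\<close>
  on the bracket.\<close>

lemma killed_bracket:
  assumes ka: "killed s a" and kb: "killed s' a'"
    and s: "smooth_on D1 s" "smooth_on D1 s'" and a: "smooth_on D1 a" "smooth_on D1 a'"
  shows "killed (lie s s') (\<lambda>x. along s a' x - along s' a x + bracket (a x) (a' x))"
  unfolding killed_def
proof (intro ballI allI impI)
  fix x f i assume x: "x \<in> D1" and f: "f \<in> F \<inter> mink_frame_bundle" and i: "i < r"
  let ?z = "(x, f)" and ?p = "(frame_at x, f)"
  let ?X = "field s a" and ?Y = "field s' a'"
  have p: "embed ?z = ?p" by (simp add: embed_def)
  have pNW: "?p \<in> N \<inter> W" using N_W x f by blast
  then have eW: "embed ?z \<in> W" unfolding p by blast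
  have zP: "?z \<in> D1 \<times> UNIV" using x by simp
  have X: "along ?X embed ?z = (along s frame_at x, act (a x) f)"
    and Y: "along ?Y embed ?z = (along s' frame_at x, act (a' x) f)" using along_embed[OF x] by auto
  have tX: "along ?X embed ?z \<in> tangent_vectors N ?p" and tY: "along ?Y embed ?z \<in> tangent_vectors N ?p"
    unfolding X Y using tangent_embed[OF x] f by auto
  have E: "ext_deriv (\<alpha> i) ?p (along ?X embed ?z) (along ?Y embed ?z) = 0"
  proof -
    obtain \<beta> where \<beta>: "ext_deriv (\<alpha> i) ?p (along ?X embed ?z) (along ?Y embed ?z) =
       (\<Sum>j<r. wedge (\<beta> j) (\<alpha> j ?p) (along ?X embed ?z) (along ?Y embed ?z))"
      using frobenius i pNW tX tY unfolding frobenius_frame_def by meson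
    have "\<forall>j<r. \<alpha> j ?p (along ?X embed ?z) = 0" "\<forall>j<r. \<alpha> j ?p (along ?Y embed ?z) = 0"
      unfolding X Y using ka kb x f unfolding killed_def by auto
    then show ?thesis unfolding \<beta> wedge_def by simp
  qed
  note pull = ext_deriv_pullback[OF open_P zP smooth_embed _ _ W(1) eW
          form_linear[OF i] smooth_on_differentiable[OF form_smooth[OF i] eW]]
  have zero: "along (field t d) (\<lambda>z. \<alpha> i (embed z) (along (field u b) embed z)) ?z = 0"
    if k: "killed u b" and sm: "smooth_on D1 u" "smooth_on D1 b" for t d u b
  proof -
    have diff: "(\<lambda>z. \<alpha> i (embed z) (along (field u b) embed z)) differentiable (at ?z)"
      by (rule pull(1)[OF smooth_field[OF sm] smooth_field[OF sm]])
    show ?thesis unfolding along_def[of "field t d"]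
    proof (rule derivative_tangent_eq_0[OF _ has_derivative_frechet[OF diff], of _ "D1 \<times> mink_frame_bundle" "D1 \<times> F"])
      show "field t d ?z \<in> tangent_vectors (D1 \<times> mink_frame_bundle) ?z"
        unfolding field_def
        using tangent_vectors_Times[of "t x" D1 x "act (d x) f"] act_tangent[of f] tangent_vectors_open[OF D1(1) x] f by simp
      show "open (D1 \<times> F)" using D1 F by (simp add: open_Times)
      show "?z \<in> D1 \<times> F" using x f by simp
      show "\<alpha> i (embed z) (along (field u b) embed z) = 0" if z: "z \<in> D1 \<times> mink_frame_bundle" "z \<in> D1 \<times> F" for z
      proof -
        obtain y h where y: "z = (y, h)" "y \<in> D1" "h \<in> F \<inter> mink_frame_bundle" using z by auto
        show ?thesis unfolding y(1) along_embed[OF y(2)] using k i y(2,3) unfolding killed_def by (simp add: embed_def)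
      qed
    qed
  qed
  have "\<alpha> i ?p (fderiv embed ?z (lie ?X ?Y ?z)) = 0"
    using pull(2)[OF smooth_field[OF s(1) a(1)] smooth_field[OF s(2) a(2)]]
    unfolding zero[OF ka s(1) a(1)] zero[OF kb s(2) a(2)] p E by simp
  then show "\<alpha> i ?p (along (lie s s') frame_at x, act (along s a' x - along s' a x + bracket (a x) (a' x)) f) = 0"
    unfolding lie_field[OF x s a] embed_derivative[OF x] by (simp add: along_def)
qed

end

subsection \<open>The holonomy algebra of the singular system\<close>

lemma along_const [simp]: "along X (\<lambda>x. c) x = 0"
  by (simp add: along_def)

lemma along_add:
  assumes "f differentiable (at x)" "g differentiable (at x)"
  shows "along X (\<lambda>x. f x + g x) x = along X f x + along X g x"
  using along_has_derivative[OF has_derivative_add[OF assms[THEN has_derivative_frechet]], of X]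
  by (simp add: along_def)

lemma along_diff:
  assumes "f differentiable (at x)" "g differentiable (at x)"
  shows "along X (\<lambda>x. f x - g x) x = along X f x - along X g x"
  using along_has_derivative[OF has_derivative_diff[OF assms[THEN has_derivative_frechet]], of X]
  by (simp add: along_def)

lemma along_minus:
  assumes "f differentiable (at x)"
  shows "along X (\<lambda>x. - f x) x = - along X f x"
  using along_has_derivative[OF has_derivative_minus[OF assms[THEN has_derivative_frechet]], of X]
  by (simp add: along_def)

lemma along_mult:
  fixes f g :: "'a::euclidean_space \<Rightarrow> real"
  assumes "f differentiable (at x)" "g differentiable (at x)"
  shows "along X (\<lambda>x. f x * g x) x = along X f x * g x + f x * along X g x"
  using along_has_derivative[OF has_derivative_mult[OF assms[THEN has_derivative_frechet]], of X]
  by (simp add: along_def)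

lemma along_Pair:
  assumes "f differentiable (at x)" "g differentiable (at x)"
  shows "along X (\<lambda>x. (f x, g x)) x = (along X f x, along X g x)"
  using along_has_derivative[OF has_derivative_Pair[OF assms[THEN has_derivative_frechet]], of X]
  by (simp add: along_def)

lemma sum_lessThan_two:
  fixes f :: "nat \<Rightarrow> real"
  assumes "2 \<le> r"
  shows "(\<Sum>i<r. (if i = 0 then u else if i = 1 then v else 0) * f i) = u * f 0 + v * f 1"
proof -
  have "(\<Sum>i<r. (if i = 0 then u else if i = 1 then v else 0) * f i) =
      (\<Sum>i\<in>{0,1}. (if i = 0 then u else if i = 1 then v else 0) * f i)"
    by (rule sum.mono_neutral_right) (use assms in auto)
  then show ?thesis by simp
qed

context frobenius_patch
begin

lemma killed_frame: "killed e1 A1" "killed e2 A2"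
proof -
  have "\<alpha> i (frame_at x, f) (along e1 frame_at x, act (A1 x) f) = 0 \<and>
      \<alpha> i (frame_at x, f) (along e2 frame_at x, act (A2 x) f) = 0"
    if x: "x \<in> D1" and f: "f \<in> F" "f \<in> mink_frame_bundle" and i: "i < r" for x f i
  proof -
    obtain \<rho> a b c where fe: "f = (\<rho>, a, b, c)" by (cases f)
    have on: "mink_orthonormal a b c" using f(2) unfolding fe mink_frame_bundle_iff .
    note m = mink_orthonormalD[OF on]
    have xS: "x \<in> S" using x D1 by blast
    have fx: "fst (frame_at x) = x" by (simp add: frame_at_def)
    note sp = span[OF N_W[OF x f] i]
    show ?thesis
      by (intro conjI in_span_at_zero[OF sp tangent_embed[OF x f(2)]])
        (auto simp: singular_system_def embedding_system_def lift1_def lift2_def fe A1_def A2_def mink_simps m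
          eta_frame[OF xS] w1_def w2_def fx k)
  qed
  then show "killed e1 A1" "killed e2 A2" unfolding killed_def by auto
qed

lemma killed_combination:
  assumes "killed s a" "killed s' b"
    and "\<And>x. x \<in> D1 \<Longrightarrow> s'' x = u x *\<^sub>R s x + v x *\<^sub>R s' x"
    and "\<And>x. x \<in> D1 \<Longrightarrow> c x = u x *\<^sub>R a x + v x *\<^sub>R b x"
  shows "killed s'' c"
  unfolding killed_def
proof (intro ballI allI impI)
  fix x f i assume x: "x \<in> D1" and f: "f \<in> F \<inter> mink_frame_bundle" and i: "i < r"
  have xS: "x \<in> S" using x D1 by blast
  have lin: "linear (\<alpha> i (frame_at x, f))" using form_linear[OF i] N_W x f by blast
  have lf: "linear (fderiv frame_at x)"
    by (rule linear_frechet_derivative[OF smooth_on_differentiable[OF smooth_frame_at xS]])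
  have "(along s'' frame_at x, act (c x) f) =
      u x *\<^sub>R (along s frame_at x, act (a x) f) + v x *\<^sub>R (along s' frame_at x, act (b x) f)"
    unfolding along_def assms(3,4)[OF x]
    by (simp add: linear_add[OF lf] linear_scale[OF lf] bounded_bilinear.add_left[OF bounded_bilinear_act]
        bounded_bilinear.scaleR_left[OF bounded_bilinear_act])
  moreover have "\<alpha> i (frame_at x, f) (along s frame_at x, act (a x) f) = 0"
    "\<alpha> i (frame_at x, f) (along s' frame_at x, act (b x) f) = 0"
    using assms(1,2) x f i unfolding killed_def by blast+
  ultimately show "\<alpha> i (frame_at x, f) (along s'' frame_at x, act (c x) f) = 0"
    by (simp only: linear_add[OF lin] linear_scale[OF lin]) simp
qed

text \<open>\<open>vertical a\<close> expresses that \<open>a\<close> takes values in the holonomy algebra.\<close>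

definition vertical :: "(real^2 \<Rightarrow> poincare) \<Rightarrow> bool" where
  "vertical a \<longleftrightarrow> killed (\<lambda>_. 0) a"

lemma vertical_combination:
  assumes "vertical a" "vertical b" "\<And>x. x \<in> D1 \<Longrightarrow> c x = u x *\<^sub>R a x + v x *\<^sub>R b x"
  shows "vertical c"
  using killed_combination[of "\<lambda>_. 0" a "\<lambda>_. 0" b "\<lambda>_. 0" u v c] assms unfolding vertical_def by simp

text \<open>All \<theta>'s vanish on such an element. Modulo the \<theta>'s the forms
  \<open>\<alpha> 0\<close>, \<open>\<alpha> 1\<close> are combinations of the last two generators;
  if both annihilate a nonzero (p, q), their coefficient rows are dependent, and a nontrivial
  combination falls into the span of the \<theta>'s, against transversality and
  independence.\<close>

lemma vertical_zero:
  assumes a: "vertical a" and x: "x \<in> D1" and ax: "a x = (0, 0, 0, 0, p, q)"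
  shows "p = 0 \<and> q = 0"
proof (rule ccontr)
  assume pq: "\<not> (p = 0 \<and> q = 0)"
  let ?y = "(frame_at x, f0)"
  have y: "?y \<in> N \<inter> W" by (rule N_W[OF x f0])
  have xS: "x \<in> S" using x D1 by blast
  obtain \<rho> a1 a2 a3 where fe: "f0 = (\<rho>, a1, a2, a3)" by (cases f0)
  have on: "mink_orthonormal a1 a2 a3" using f0(2) unfolding fe mink_frame_bundle_iff .
  note m = mink_orthonormalD[OF on]
  let ?gs = "singular_system g \<omega> \<kappa> (1::real)" and ?ts = "embedding_system g \<omega> :: (frame2 \<times> frame3, real) form list"
  define \<pi> where "\<pi> n = (?gs ! n) ?y" for n
  have len: "length ?ts = 4" "length ?gs = 6" by (simp_all add: embedding_system_def singular_system_def)
  have gs: "(?gs ! n) ?y = (?ts ! n) ?y" if "n < 4" for n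
    using that len by (simp add: singular_system_def nth_append)
  have ex: "\<exists>c. \<forall>v\<in>tangent_vectors N ?y. \<alpha> i ?y v = (\<Sum>n<4. c n * (?ts ! n) ?y v) + c 4 * \<pi> 4 v + c 5 * \<pi> 5 v"
    if i: "i < r" for i
  proof -
    obtain c where c: "\<forall>v\<in>tangent_vectors N ?y. \<alpha> i ?y v = (\<Sum>n<6. c n * (?gs ! n) ?y v)"
      using span[OF y i] unfolding in_span_at_def len by blast
    have "(\<Sum>n<6. c n * (?gs ! n) ?y v) = (\<Sum>n<4. c n * (?ts ! n) ?y v) + c 4 * \<pi> 4 v + c 5 * \<pi> 5 v" for v
    proof -
      have "(\<Sum>n<6. c n * (?gs ! n) ?y v) = (\<Sum>n<4. c n * (?gs ! n) ?y v) + c 4 * \<pi> 4 v + c 5 * \<pi> 5 v"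
        using sum.lessThan_Suc[of "\<lambda>n. c n * (?gs ! n) ?y v" 5] sum.lessThan_Suc[of "\<lambda>n. c n * (?gs ! n) ?y v" 4]
        by (simp add: \<pi>_def)
      also have "(\<Sum>n<4. c n * (?gs ! n) ?y v) = (\<Sum>n<4. c n * (?ts ! n) ?y v)"
        by (rule sum.cong) (use gs in auto)
      finally show ?thesis .
    qed
    then show ?thesis using c by auto
  qed
  have r01: "0 < r" "1 < r" using r by auto
  obtain c where c: "\<forall>v\<in>tangent_vectors N ?y. \<alpha> 0 ?y v = (\<Sum>n<4. c n * (?ts ! n) ?y v) + c 4 * \<pi> 4 v + c 5 * \<pi> 5 v"
    using ex[OF r01(1)] by blast
  obtain d where d: "\<forall>v\<in>tangent_vectors N ?y. \<alpha> 1 ?y v = (\<Sum>n<4. d n * (?ts ! n) ?y v) + d 4 * \<pi> 4 v + d 5 * \<pi> 5 v"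
    using ex[OF r01(2)] by blast
  let ?v = "(along (\<lambda>_. 0) frame_at x, act (a x) f0)"
  have v: "?v \<in> tangent_vectors N ?y" by (rule tangent_embed[OF x f0(2)])
  have v0: "along (\<lambda>_. 0) frame_at x = 0"
    using linear_0[OF linear_frechet_derivative[OF smooth_on_differentiable[OF smooth_frame_at xS]]]
    by (simp add: along_def)
  have e0: "eta1 g (frame_at x) 0 = 0" "eta2 g (frame_at x) 0 = 0" "\<omega> (frame_at x) 0 = 0"
    using linear_0[OF linear_eta(1)] linear_0[OF linear_eta(2)] linear_0[OF connection_form(2)] frame_at_in_open[OF xS] by auto
  have t0: "h ?y ?v = 0" if "h \<in> set ?ts" for h
    using that unfolding v0 ax fe by (auto simp: embedding_system_def lift1_def lift2_def mink_simps m e0)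
  have s0: "(\<Sum>n<4. c n * (?ts ! n) ?y ?v) = 0" for c
    by (intro sum.neutral ballI) (simp add: t0 len)
  have \<pi>v: "\<pi> 4 ?v = p" "\<pi> 5 ?v = q"
    unfolding v0 ax fe \<pi>_def
    by (simp_all add: singular_system_def embedding_system_def lift1_def lift2_def mink_simps m e0 Let_def)
  have rel: "c 4 * p + c 5 * q = 0" "d 4 * p + d 5 * q = 0"
  proof -
    have "\<alpha> 0 ?y ?v = 0" "\<alpha> 1 ?y ?v = 0"
      using a x f0 r01 unfolding vertical_def killed_def by blast+
    then show "c 4 * p + c 5 * q = 0" "d 4 * p + d 5 * q = 0"
      using c d v s0 \<pi>v by simp_all
  qed
  \<comment> \<open>The rows (c 4, c 5) and (d 4, d 5) are both orthogonal to the nonzero (p, q),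
    hence dependent; the cases choose an entry that can serve as pivot.\<close>
  obtain u w where uw: "u \<noteq> 0 \<or> w \<noteq> 0" "u * c 4 + w * d 4 = 0" "u * c 5 + w * d 5 = 0"
  proof (cases "p = 0")
    case True
    then have "c 5 = 0" "d 5 = 0" using pq rel by auto
    then show ?thesis
      using that[of 1 0] that[of "d 4" "- c 4"] by (cases "c 4 = 0") auto
  next
    case False
    then have 4: "c 4 = - c 5 * q / p" "d 4 = - d 5 * q / p" using rel by (simp_all add: field_simps)
    show ?thesis
    proof (cases "c 5 = 0")
      case True
      then show ?thesis using that[of 1 0] 4 by simp
    next
      case False
      then show ?thesis using that[of "d 5" "- c 5"] 4 by simp
    qed
  qed
  define e where "e = (\<lambda>i::nat. if i = 0 then u else if i = 1 then w else 0)"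
  have sum: "(\<Sum>i<r. e i * \<alpha> i ?y v) = u * \<alpha> 0 ?y v + w * \<alpha> 1 ?y v" for v
    unfolding e_def by (rule sum_lessThan_two[OF r])
  have "in_span_at N ?ts ?y (\<lambda>v. \<Sum>i<r. e i * \<alpha> i ?y v)"
    unfolding in_span_at_def len
  proof (intro exI[of _ "\<lambda>n. u * c n + w * d n"] ballI)
    fix v assume v: "v \<in> tangent_vectors N ?y"
    have "(\<Sum>i<r. e i * \<alpha> i ?y v) = u * (\<Sum>n<4. c n * (?ts ! n) ?y v) + w * (\<Sum>n<4. d n * (?ts ! n) ?y v)
       + (u * c 4 + w * d 4) * \<pi> 4 v + (u * c 5 + w * d 5) * \<pi> 5 v"
      unfolding sum using c d v by (simp add: algebra_simps)
    then show "(\<Sum>i<r. e i * \<alpha> i ?y v) = (\<Sum>n<4. (u * c n + w * d n) * (?ts ! n) ?y v)"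
      unfolding uw(2,3) by (simp add: sum_distrib_left sum.distrib algebra_simps)
  qed
  from transverse[OF y this]
  have z: "\<forall>v\<in>tangent_vectors N ?y. (\<Sum>i<r. e i * \<alpha> i ?y v) = 0" .
  have "independent_at N r \<alpha> ?y" using frobenius y unfolding frobenius_frame_def by blast
  then have "\<forall>i<r. e i = 0" using z unfolding independent_at_def by blast
  then have "e 0 = 0" "e 1 = 0" using r01 by auto
  then show False using uw(1) by (simp add: e_def)
qed

lemma x_in_S: "x \<in> D1 \<Longrightarrow> x \<in> S" using D1 by blast

lemma smooth_e: "smooth_on D1 e1" "smooth_on D1 e2"
  by (rule smooth_on_subset[OF e1 D1(2)], rule smooth_on_subset[OF e2 D1(2)])

lemma smooth_ww: "smooth_on D1 w1" "smooth_on D1 w2"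
  using smooth_on_subset[OF smooth_w(1) D1(2)] smooth_on_subset[OF smooth_w(2) D1(2)] by auto

lemma k_pos: "x \<in> D1 \<Longrightarrow> 0 < k x"
  by (frule negative[OF x_in_S]) (simp add: k)

lemma k_square: "x \<in> D1 \<Longrightarrow> (k x)\<^sup>2 = - \<kappa> x"
  by (frule negative[OF x_in_S]) (simp add: k)

lemma smooth_k: "smooth_on D1 k"
proof (rule smooth_on_cong[OF D1(1)])
  show "smooth_on D1 (\<lambda>x. sqrt (- \<kappa> x))"
    by (rule smooth_on_sqrt[OF D1(1) smooth_on_minus[OF D1(1) smooth_on_subset[OF smooth_curvature D1(2)]]])
      (simp add: negative x_in_S)
  show "sqrt (- \<kappa> x) = k x" if "x \<in> D1" for x
    using negative[OF x_in_S[OF that]] by (simp add: k)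
qed

lemma differentiable: "smooth_on D1 f \<Longrightarrow> x \<in> D1 \<Longrightarrow> f differentiable (at x)"
  by (rule smooth_on_differentiable)

lemma smooth_A: "smooth_on D1 A1" "smooth_on D1 A2"
proof -
  have "smooth_on D1 (\<lambda>x. (1::real, 0::real, 0::real, w1 x, 0::real, - k x))"
    by (intro smooth_on_Pair[OF D1(1)] smooth_ww smooth_ops1 smooth_k)
  then show "smooth_on D1 A1" unfolding A1_def .
  have "smooth_on D1 (\<lambda>x. (0::real, 1::real, 0::real, w2 x, k x, 0::real))"
    by (intro smooth_on_Pair[OF D1(1)] smooth_on_const smooth_ww smooth_k)
  then show "smooth_on D1 A2" unfolding A2_def .
qed

text \<open>The bracket of \<open>e\<^sub>i + A\<^sub>i\<close> with a vertical field is vertical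
  again, with value the derivative of \<open>a\<close> along \<open>e\<^sub>i\<close> plus the
  algebra bracket of \<open>A\<^sub>i\<close> with \<open>a\<close>: the covariant derivative of
  \<open>a\<close>.\<close>

lemma vertical_nabla:
  assumes a: "vertical (\<lambda>x. (t1 x, t2 x, t3 x, c x, p x, q x))"
    and sm: "smooth_on D1 t1" "smooth_on D1 t2" "smooth_on D1 t3" "smooth_on D1 c" "smooth_on D1 p" "smooth_on D1 q"
  shows "vertical (\<lambda>x. (along e1 t1 x + w1 x * t2 x, along e1 t2 x + w1 x * t1 x + k x * t3 x - c x,
      along e1 t3 x - k x * t2 x - p x, along e1 c x + k x * p x, along e1 p x - k x * c x - w1 x * q x,
      along e1 q x - w1 x * p x))" (is "vertical ?N1")
    and "vertical (\<lambda>x. (along e2 t1 x + w2 x * t2 x + k x * t3 x - c x, along e2 t2 x + w2 x * t1 x,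
      along e2 t3 x + k x * t1 x - q x, along e2 c x + k x * q x, along e2 p x - w2 x * q x,
      along e2 q x + k x * c x - w2 x * p x))" (is "vertical ?N2")
proof -
  let ?a = "\<lambda>x. (t1 x, t2 x, t3 x, c x, p x, q x)"
  have sa: "smooth_on D1 ?a" by (intro smooth_on_Pair[OF D1(1)] sm)
  have al: "along X ?a x = (along X t1 x, along X t2 x, along X t3 x, along X c x, along X p x, along X q x)"
    if "x \<in> D1" for X x
    using that sm by (simp add: along_Pair differentiable smooth_on_Pair[OF D1(1)])
  have 0: "along (\<lambda>_. 0) f x = 0" if "smooth_on D1 f" "x \<in> D1" for f :: "real^2 \<Rightarrow> 'z::real_normed_vector" and x
    using linear_0[OF linear_frechet_derivative[OF differentiable[OF that]]] by (simp add: along_def)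
  have k1: "killed (lie e1 (\<lambda>_. 0)) (\<lambda>x. along e1 ?a x - along (\<lambda>_. 0) A1 x + bracket (A1 x) (?a x))"
    by (rule killed_bracket[OF killed_frame(1) a[unfolded vertical_def] smooth_e(1) smooth_on_const smooth_A(1) sa])
  show "vertical ?N1"
    unfolding vertical_def
    by (rule killed_combination[OF k1 k1, of _ "\<lambda>_. 1" "\<lambda>_. 0"])
      (simp_all add: lie_def 0 smooth_e smooth_A al, simp add: A1_def algebra_simps)
  have k2: "killed (lie e2 (\<lambda>_. 0)) (\<lambda>x. along e2 ?a x - along (\<lambda>_. 0) A2 x + bracket (A2 x) (?a x))"
    by (rule killed_bracket[OF killed_frame(2) a[unfolded vertical_def] smooth_e(2) smooth_on_const smooth_A(2) sa])
  show "vertical ?N2"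
    unfolding vertical_def
    by (rule killed_combination[OF k2 k2, of _ "\<lambda>_. 1" "\<lambda>_. 0"])
      (simp_all add: lie_def 0 smooth_e smooth_A al, simp add: A2_def algebra_simps)
qed

text \<open>The bracket of the two frame fields, less the combination of them with the same base
  part, has the value (0, 0, -2 k, 2 k^2, \<open>e1\<close> k, \<open>e2\<close> k), which is
  divided by -2 k. The third entry measures the skewness of the second fundamental form; the fourth
  is the sum of - K = k^2 and of the determinant k^2 of that form.\<close>

lemma vertical_curvature:
  "vertical (\<lambda>x. (0, 0, 1, - k x, - (along e1 k x / (2 * k x)), - (along e2 k x / (2 * k x))))"
proof -
  have A: "along X A1 x = (0, 0, 0, along X w1 x, 0, - along X k x)"
    "along X A2 x = (0, 0, 0, along X w2 x, along X k x, 0)" if "x \<in> D1" for X x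
    unfolding A1_def A2_def
    using that smooth_ww smooth_k
    by (simp_all add: along_Pair along_minus differentiable smooth_on_Pair[OF D1(1)] smooth_on_minus[OF D1(1)])
  have 1: "killed (lie e1 e2) (\<lambda>x. along e1 A2 x - along e2 A1 x + bracket (A1 x) (A2 x))"
    by (rule killed_bracket[OF killed_frame smooth_e smooth_A])
  have 2: "killed (lie e1 e2) (\<lambda>x. w1 x *\<^sub>R A1 x + (- w2 x) *\<^sub>R A2 x)"
    by (rule killed_combination[OF killed_frame, of _ w1 "\<lambda>x. - w2 x"]) (simp_all add: lie_frame x_in_S)
  show ?thesis
    unfolding vertical_def
  proof (rule killed_combination[OF 1 2, of _ "\<lambda>x. - inverse (2 * k x)" "\<lambda>x. inverse (2 * k x)"])
    fix x assume x: "x \<in> D1"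
    have "along e1 w2 x - along e2 w1 x = (k x)\<^sup>2 + (w1 x)\<^sup>2 - (w2 x)\<^sup>2"
      using curvature_frame[OF x_in_S[OF x]] k_square[OF x] by simp
    then have W: "along e1 w2 x = along e2 w1 x + (k x)\<^sup>2 + (w1 x)\<^sup>2 - (w2 x)\<^sup>2" by simp
    show "(0, 0, 1, - k x, - (along e1 k x / (2 * k x)), - (along e2 k x / (2 * k x))) =
         (- inverse (2 * k x)) *\<^sub>R (along e1 A2 x - along e2 A1 x + bracket (A1 x) (A2 x)) +
         inverse (2 * k x) *\<^sub>R (w1 x *\<^sub>R A1 x + - w2 x *\<^sub>R A2 x)"
      using k_pos[OF x] unfolding A[OF x] by (simp add: A1_def A2_def W field_simps power2_eq_square)
  qed simp
qed


section \<open>Derived holonomy elements and the Hessian of l = ln k / 2\<close>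

definition l1 :: "real^2 \<Rightarrow> real" where "l1 x = along e1 k x / (2 * k x)"
definition l2 :: "real^2 \<Rightarrow> real" where "l2 x = along e2 k x / (2 * k x)"

text \<open>With \<open>l = ln k / 2\<close>, the \<open>H\<^sub>i\<^sub>j\<close> are the components of \<open>(dl \<otimes> dl - \<nabla>\<nabla>l) / (2 k)\<close>.\<close>

definition H11 :: "real^2 \<Rightarrow> real" where
  "H11 x = (l1 x * l1 x - (along e1 l1 x - w1 x * l2 x)) / (2 * k x)"
definition H12 :: "real^2 \<Rightarrow> real" where
  "H12 x = (l1 x * l2 x - (along e2 l1 x - w2 x * l2 x)) / (2 * k x)"
definition H22 :: "real^2 \<Rightarrow> real" where
  "H22 x = (l2 x * l2 x - (along e2 l2 x - w2 x * l1 x)) / (2 * k x)"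

lemma k_nz: "x \<in> D1 \<Longrightarrow> k x \<noteq> 0" using k_pos by fastforce

lemma smooth_l: "smooth_on D1 l1" "smooth_on D1 l2"
  unfolding l1_def l2_def
  by (intro smooth_ops1 smooth_on_along[OF D1(1)] smooth_e smooth_k; simp add: k_nz)+

lemma smooth_H: "smooth_on D1 H11" "smooth_on D1 H12" "smooth_on D1 H22"
  unfolding H11_def H12_def H22_def
  by (intro smooth_ops1 smooth_on_along[OF D1(1)] smooth_e smooth_k smooth_l smooth_ww; simp add: k_nz)+

lemmas diffs = differentiable[OF smooth_k] differentiable[OF smooth_l(1)] differentiable[OF smooth_l(2)]
  differentiable[OF smooth_H(1)] differentiable[OF smooth_H(2)] differentiable[OF smooth_H(3)]

lemma along_k: "x \<in> D1 \<Longrightarrow> along e1 k x = 2 * k x * l1 x" "x \<in> D1 \<Longrightarrow> along e2 k x = 2 * k x * l2 x"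
  using k_nz by (auto simp: l1_def l2_def)

text \<open>Beyond solving the definitions for the derivatives, this contains the symmetry of the
  Hessian of l: the formula for \<open>along e1 l2\<close> comes from the commutator of the frame
  fields applied to \<open>k\<close>.\<close>

lemma along_l:
  assumes x: "x \<in> D1"
  shows "along e1 l1 x = l1 x * l1 x - 2 * k x * H11 x + w1 x * l2 x"
    and "along e2 l1 x = l1 x * l2 x - 2 * k x * H12 x + w2 x * l2 x"
    and "along e1 l2 x = l1 x * l2 x - 2 * k x * H12 x + w1 x * l1 x"
    and "along e2 l2 x = l2 x * l2 x - 2 * k x * H22 x + w2 x * l1 x"
proof -
  note nz = k_nz[OF x]
  show "along e1 l1 x = l1 x * l1 x - 2 * k x * H11 x + w1 x * l2 x"
    and 2: "along e2 l1 x = l1 x * l2 x - 2 * k x * H12 x + w2 x * l2 x"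
    and "along e2 l2 x = l2 x * l2 x - 2 * k x * H22 x + w2 x * l1 x"
    using nz by (simp_all add: H11_def H12_def H22_def)
  have kf: "along e1 (along e2 k) x - along e2 (along e1 k) x = w1 x * along e1 k x - w2 x * along e2 k x"
    using along_commutator[OF D1(1) x smooth_k smooth_e] lie_frame[OF x_in_S[OF x]]
      linear_frechet_derivative[OF diffs(1)[OF x]]
    by (simp add: along_def linear_diff linear_scale)
  have "along e1 (along e2 k) x = along e1 (\<lambda>x. 2 * k x * l2 x) x"
    by (rule along_cong_open[OF D1(1) x]) (rule along_k(2))
  also have "\<dots> = 2 * (2 * k x * l1 x) * l2 x + 2 * k x * along e1 l2 x"
    by (simp add: along_mult diffs x along_k)
  finally have a: "along e1 (along e2 k) x = 2 * (2 * k x * l1 x) * l2 x + 2 * k x * along e1 l2 x" .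
  have "along e2 (along e1 k) x = along e2 (\<lambda>x. 2 * k x * l1 x) x"
    by (rule along_cong_open[OF D1(1) x]) (rule along_k(1))
  also have "\<dots> = 2 * (2 * k x * l2 x) * l1 x + 2 * k x * along e2 l1 x"
    by (simp add: along_mult diffs x along_k)
  finally have "k x * (along e1 l2 x - along e2 l1 x) = k x * (w1 x * l1 x - w2 x * l2 x)"
    using kf a along_k x by (simp add: algebra_simps)
  then show "along e1 l2 x = l1 x * l2 x - 2 * k x * H12 x + w1 x * l1 x"
    using nz 2 by simp
qed

lemma vertical_Y: "vertical (\<lambda>x. (0, 0, 1, - k x, - l1 x, - l2 x))"
  using vertical_curvature unfolding l1_def l2_def .

text \<open>The covariant derivative of the curvature element along \<open>e1\<close> has
  translation part \<open>2 k e\<^sub>2 + l\<^sub>1 e\<^sub>3\<close>; subtracting \<open>l1\<close>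
  times that element and dividing by 2 k normalizes it to \<open>e\<^sub>2\<close>.\<close>

lemma vertical_Z1: "vertical (\<lambda>x. (0, 1, 0, - l1 x, k x / 2 + H11 x, H12 x))"
  by (rule vertical_combination[OF vertical_nabla(1)[OF vertical_Y] vertical_Y,
      of _ "\<lambda>x. inverse (2 * k x)" "\<lambda>x. - l1 x * inverse (2 * k x)"])
    (simp_all add: smooth_on_minus[OF D1(1)] smooth_k smooth_l along_minus diffs along_k along_l k_nz field_simps)

lemma vertical_Z2: "vertical (\<lambda>x. (1, 0, 0, - l2 x, H12 x, - k x / 2 + H22 x))"
  by (rule vertical_combination[OF vertical_nabla(2)[OF vertical_Y] vertical_Y,
      of _ "\<lambda>x. inverse (2 * k x)" "\<lambda>x. - l2 x * inverse (2 * k x)"])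
    (simp_all add: smooth_on_minus[OF D1(1)] smooth_k smooth_l along_minus diffs along_k along_l k_nz field_simps)

text \<open>The three known elements carry the three unit translations, so multiples of them remove
  any translation part.\<close>

lemma vertical_reduce:
  assumes a: "vertical a"
    and c: "\<And>x. x \<in> D1 \<Longrightarrow> c x = a x + u x *\<^sub>R (0, 1, 0, - l1 x, k x / 2 + H11 x, H12 x) +
      v x *\<^sub>R (1, 0, 0, - l2 x, H12 x, - k x / 2 + H22 x) + w x *\<^sub>R (0, 0, 1, - k x, - l1 x, - l2 x)"
  shows "vertical c"
proof -
  let ?b = "\<lambda>x. a x + u x *\<^sub>R (0, 1, 0, - l1 x, k x / 2 + H11 x, H12 x)"
  let ?d = "\<lambda>x. v x *\<^sub>R (1, 0, 0, - l2 x, H12 x, - k x / 2 + H22 x) + w x *\<^sub>R (0, 0, 1, - k x, - l1 x, - l2 x)"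
  have b: "vertical ?b" by (rule vertical_combination[OF a vertical_Z1, of _ "\<lambda>_. 1" u]) simp
  have d: "vertical ?d" by (rule vertical_combination[OF vertical_Z2 vertical_Y, of _ v w]) simp
  show ?thesis by (rule vertical_combination[OF b d, of _ "\<lambda>_. 1" "\<lambda>_. 1"]) (simp add: c del: scaleR_Pair)
qed

text \<open>The \<open>c\<^sub>i\<^sub>j\<close> are the components of dl \<otimes> dl -
  \<nabla>\<nabla>l - k^2 g. They appear as the first rotational entry of the covariant derivatives
  of \<open>Z\<^sub>1\<close> and \<open>Z\<^sub>2\<close> after removal of the translations; the
  \<open>P\<^sub>i\<^sub>j\<close>, \<open>Q\<^sub>i\<^sub>j\<close> are the other two
  entries.\<close>

definition c11 :: "real^2 \<Rightarrow> real" where "c11 x = 2 * k x * H11 x - k x * k x"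
definition c12 :: "real^2 \<Rightarrow> real" where "c12 x = 2 * k x * H12 x"
definition c22 :: "real^2 \<Rightarrow> real" where "c22 x = 2 * k x * H22 x + k x * k x"
definition P11 :: "real^2 \<Rightarrow> real" where
  "P11 x = along e1 H11 x - 2 * w1 x * H12 x - 2 * l1 x * H11 x"
definition Q11 :: "real^2 \<Rightarrow> real" where
  "Q11 x = along e1 H12 x - w1 x * (H11 x + H22 x) - l1 x * H12 x - l2 x * H11 x - 3 * k x * l2 x / 2"
definition P12 :: "real^2 \<Rightarrow> real" where
  "P12 x = along e2 H11 x - 2 * w2 x * H12 x + k x * l2 x - 2 * l1 x * H12 x"
definition Q12 :: "real^2 \<Rightarrow> real" where
  "Q12 x = along e2 H12 x - w2 x * (H11 x + H22 x) - k x * l1 x / 2 - l1 x * H22 x - l2 x * H12 x"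
text \<open>The index 12 arises twice: primed from differentiating \<open>Z\<^sub>2\<close> along
  \<open>e1\<close>, unprimed from differentiating \<open>Z\<^sub>1\<close> along
  \<open>e2\<close>.\<close>

definition P12' :: "real^2 \<Rightarrow> real" where
  "P12' x = along e1 H12 x - w1 x * (H11 x + H22 x) + k x * l2 x / 2 - l2 x * H11 x - l1 x * H12 x"
definition Q12' :: "real^2 \<Rightarrow> real" where
  "Q12' x = along e1 H22 x - 2 * w1 x * H12 x - k x * l1 x - 2 * l2 x * H12 x"
definition P22 :: "real^2 \<Rightarrow> real" where
  "P22 x = along e2 H12 x - w2 x * (H11 x + H22 x) - l2 x * H12 x - l1 x * H22 x + 3 * k x * l1 x / 2"
definition Q22 :: "real^2 \<Rightarrow> real" where
  "Q22 x = along e2 H22 x - 2 * w2 x * H12 x - 2 * l2 x * H22 x"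

lemma smooth_half: "smooth_on D1 (\<lambda>x. k x / 2 + H11 x)" "smooth_on D1 (\<lambda>x. - k x / 2 + H22 x)"
  by (intro smooth_ops1 smooth_k smooth_H; simp)+

lemma along_half:
  assumes "x \<in> D1"
  shows "along X (\<lambda>x. k x / 2 + H11 x) x = along X k x / 2 + along X H11 x"
    "along X (\<lambda>x. - k x / 2 + H22 x) x = - along X k x / 2 + along X H22 x"
  using along_add[of "\<lambda>x. k x * (1 / 2)" x H11 X] along_mult[of k x "\<lambda>_. 1 / 2" X]
    along_add[of "\<lambda>x. k x * (- 1 / 2)" x H22 X] along_mult[of k x "\<lambda>_. - 1 / 2" X] diffs[OF assms]
  by simp_all

lemma vertical_E:
  shows "vertical (\<lambda>x. (0, 0, 0, c11 x, P11 x, Q11 x))"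
    and "vertical (\<lambda>x. (0, 0, 0, c12 x, P12' x, Q12' x))"
    and "vertical (\<lambda>x. (0, 0, 0, c12 x, P12 x, Q12 x))"
    and "vertical (\<lambda>x. (0, 0, 0, c22 x, P22 x, Q22 x))"
proof -
  note n1 = vertical_nabla[OF vertical_Z1 smooth_on_const smooth_on_const smooth_on_const
      smooth_on_minus[OF D1(1) smooth_l(1)] smooth_half(1) smooth_H(2)]
  note n2 = vertical_nabla[OF vertical_Z2 smooth_on_const smooth_on_const smooth_on_const
      smooth_on_minus[OF D1(1) smooth_l(2)] smooth_H(2) smooth_half(2)]
  note S = along_minus diffs along_k along_l
  show "vertical (\<lambda>x. (0, 0, 0, c11 x, P11 x, Q11 x))"
    by (rule vertical_reduce[OF n1(1), of _ "\<lambda>x. - l1 x" "\<lambda>x. - w1 x" "\<lambda>x. 3 * k x / 2 + H11 x"])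
      (unfold along_half, simp add: S c11_def P11_def Q11_def algebra_simps)
  show "vertical (\<lambda>x. (0, 0, 0, c12 x, P12' x, Q12' x))"
    by (rule vertical_reduce[OF n2(1), of _ "\<lambda>x. - l2 x - w1 x" "\<lambda>x. 0" "\<lambda>x. H12 x"])
      (unfold along_half, simp add: S c12_def P12'_def Q12'_def algebra_simps)
  show "vertical (\<lambda>x. (0, 0, 0, c12 x, P12 x, Q12 x))"
    by (rule vertical_reduce[OF n1(2), of _ "\<lambda>x. 0" "\<lambda>x. - l1 x - w2 x" "\<lambda>x. H12 x"])
      (unfold along_half, simp add: S c12_def P12_def Q12_def algebra_simps)
  show "vertical (\<lambda>x. (0, 0, 0, c22 x, P22 x, Q22 x))"
    by (rule vertical_reduce[OF n2(2), of _ "\<lambda>x. - w2 x" "\<lambda>x. - l2 x" "\<lambda>x. H22 x - 3 * k x / 2"])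
      (unfold along_half, simp add: S c22_def P22_def Q22_def algebra_simps)
qed

text \<open>Both mixed elements share the entry \<open>c12\<close>, so only the last two entries
  survive in their difference, and transversality makes them zero.\<close>

lemma ricci:
  assumes x: "x \<in> D1"
  shows "P12' x = P12 x" "Q12' x = Q12 x"
proof -
  have "vertical (\<lambda>x. (0, 0, 0, 0, P12' x - P12 x, Q12' x - Q12 x))"
    by (rule vertical_combination[OF vertical_E(2,3), of _ "\<lambda>_. 1" "\<lambda>_. -1"]) simp
  from vertical_zero[OF this x refl] show "P12' x = P12 x" "Q12' x = Q12 x" by auto
qed

lemma PQ_relations:
  assumes x: "x \<in> D1"
  shows "P12 x - Q11 x = 2 * k x * l2 x" "P22 x - Q12 x = 2 * k x * l1 x"
  using ricci(1)[OF x] by (simp_all add: P12'_def Q11_def P22_def Q12_def)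

text \<open>If all \<open>c\<^sub>i\<^sub>j\<close> vanished, transversality would make every
  \<open>P\<^sub>i\<^sub>j\<close> and \<open>Q\<^sub>i\<^sub>j\<close> vanish, whereas two of their
  differences are 2 k times the components of dl. So a fourth independent holonomy element exists
  where dl is nonzero.\<close>

lemma some_c_nonzero:
  assumes x: "x \<in> D1" and l: "l1 x \<noteq> 0 \<or> l2 x \<noteq> 0"
  shows "c11 x \<noteq> 0 \<or> c12 x \<noteq> 0 \<or> c22 x \<noteq> 0"
proof (rule ccontr)
  assume "\<not> (c11 x \<noteq> 0 \<or> c12 x \<noteq> 0 \<or> c22 x \<noteq> 0)"
  then have c: "c11 x = 0" "c12 x = 0" "c22 x = 0" by auto
  have "P12 x = 0" "Q11 x = 0" "P22 x = 0" "Q12 x = 0"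
    using vertical_zero[OF vertical_E(1) x] vertical_zero[OF vertical_E(3) x] vertical_zero[OF vertical_E(4) x] c by auto
  then show False using PQ_relations[OF x] k_pos[OF x] l by simp
qed

end

text \<open>By \<open>1\<close> the pair (M, N) is a multiple f of (l1, l2). Comparing
  \<open>2\<close> with \<open>3\<close> shows that c is diag(s, -s) - f dl \<otimes> dl, and
  \<open>A\<close>, \<open>B\<close> say f s = -4 k^2. The determinant equation becomes (s + 2
  k^2)^2 = 0, whose only root s = -2 k^2 gives f = 2.\<close>

lemma hessian_algebra:
  fixes k l1 l2 M N c11 c12 c22 :: real
  assumes k: "k \<noteq> 0" and l: "l1 \<noteq> 0 \<or> l2 \<noteq> 0"
    and A: "M * c12 - N * c11 = 4 * k^2 * l2" and B: "M * c22 - N * c12 = 4 * k^2 * l1"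
    and 1: "c12 = - M * l2" "c12 = - N * l1"
    and 2: "c11 * c22 - c12 * c12 = 4 * k^2 * (l2 * l2 - l1 * l1 - N * l2 - c22 + k^2)"
    and 3: "c11 * c22 - c12 * c12 = 4 * k^2 * (l2 * l2 - l1 * l1 + M * l1 + c11 + k^2)"
  shows "c11 = - 2 * l1 * l1 - 2 * k^2" "c12 = - 2 * l1 * l2" "c22 = - 2 * l2 * l2 + 2 * k^2"
proof -
  obtain f where f: "M = f * l1" "N = f * l2"
  proof (cases "l1 = 0")
    case True
    then have "M = 0" using 1 l by simp
    then show ?thesis using that[of "N / l2"] True l by simp
  next
    case False
    then have "N = M / l1 * l2" using 1 by (simp add: field_simps)
    then show ?thesis using that[of "M / l1"] False by simp
  qed
  define s where "s = c11 + f * l1 * l1"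
  have c11: "c11 = s - f * l1 * l1" by (simp add: s_def)
  have c12: "c12 = - f * l1 * l2" using 1(1) f by simp
  have "4 * k^2 * (- N * l2 - c22) = 4 * k^2 * (M * l1 + c11)" using 2 3 by (simp add: algebra_simps)
  then have "- N * l2 - c22 = M * l1 + c11" using k by simp
  then have c22: "c22 = - s - f * l2 * l2" by (simp add: s_def f algebra_simps)
  have "l2 * (f * s + 4 * k^2) = 0" using A unfolding c11 c12 f by (simp add: algebra_simps)
  moreover have "l1 * (f * s + 4 * k^2) = 0" using B unfolding c22 c12 f by (simp add: algebra_simps)
  ultimately have fs: "f * s = - 4 * k^2" using l by auto
  have "c11 * c22 - c12 * c12 = - s * s + (f * s) * (l1 * l1 - l2 * l2)"
    unfolding c11 c12 c22 by (simp add: algebra_simps)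
  then have "- s * s - 4 * k^2 * (l1 * l1 - l2 * l2) = 4 * k^2 * (l2 * l2 - l1 * l1 + s + k^2)"
    using 3 unfolding fs f c11 by (simp add: algebra_simps)
  then have "(s + 2 * k^2)^2 = 0" by (simp add: power2_eq_square algebra_simps)
  then have s: "s = - 2 * k^2" by simp
  then have "2 * k^2 * (f - 2) = 0" using fs by (simp add: algebra_simps)
  then have "f = 2" using k by simp
  then show "c11 = - 2 * l1 * l1 - 2 * k^2" "c12 = - 2 * l1 * l2" "c22 = - 2 * l2 * l2 + 2 * k^2"
    unfolding c11 c12 c22 s by simp_all
qed

context frobenius_patch
begin

text \<open>The components of \<nabla>\<nabla>l = 3 dl \<otimes> dl + k^2 g with the connection
  terms written out.\<close>

definition hessian_relation :: "real^2 \<Rightarrow> bool" where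
  "hessian_relation x \<longleftrightarrow> along e1 l1 x = 3 * l1 x * l1 x + (k x)\<^sup>2 + w1 x * l2 x \<and>
     along e2 l1 x = 3 * l1 x * l2 x + w2 x * l2 x \<and> along e1 l2 x = 3 * l1 x * l2 x + w1 x * l1 x \<and>
     along e2 l2 x = 3 * l2 x * l2 x - (k x)\<^sup>2 + w2 x * l1 x"

lemma smooth_c: "smooth_on D1 c11" "smooth_on D1 c12" "smooth_on D1 c22"
  unfolding c11_def c12_def c22_def
  by (intro smooth_ops1 smooth_k smooth_H)+

lemma smooth_PQ: "smooth_on D1 P11" "smooth_on D1 Q11" "smooth_on D1 P12" "smooth_on D1 Q12" "smooth_on D1 P22" "smooth_on D1 Q22"
  unfolding P11_def Q11_def P12_def Q12_def P22_def Q22_def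
  by (intro smooth_ops1 smooth_on_along[OF D1(1)] smooth_k smooth_H smooth_l smooth_ww smooth_e; simp)+

text \<open>The holonomy algebra is spanned by \<open>Y\<close>, \<open>Z\<^sub>1\<close>, \<open>Z\<^sub>2\<close> and \<open>(0, 0, 0, 1, M / (2 k), N / (2 k))\<close>.  Its
  closure under covariant differentiation determines the derivatives of \<open>M\<close>, \<open>N\<close> and the \<open>c\<^sub>i\<^sub>j\<close>;
  the relation then follows by differentiating the two identities \<open>A\<close>, \<open>B\<close>.\<close>

lemma hessian_relation_if_nonzero:
  assumes v: "vertical (\<lambda>x. (0, 0, 0, c x, P x, Q x))"
    and sm: "smooth_on D1 c" "smooth_on D1 P" "smooth_on D1 Q" and c: "\<And>x. x \<in> D1 \<Longrightarrow> c x \<noteq> 0"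
    and x: "x \<in> D1" and l: "l1 x \<noteq> 0 \<or> l2 x \<noteq> 0"
  shows "hessian_relation x"
proof -
  define m where "m = (\<lambda>x. P x / c x)"
  define n where "n = (\<lambda>x. Q x / c x)"
  have smm: "smooth_on D1 m" and smn: "smooth_on D1 n"
    unfolding m_def n_def using sm c by (auto intro!: smooth_on_divide[OF D1(1)])
  \<comment> \<open>Normalizing by \<open>c\<close> is why \<open>c\<close> has to be nonzero on all
    of \<open>D1\<close>: the quotients \<open>m\<close>, \<open>n\<close> are differentiated
    next.\<close>
  have W: "vertical (\<lambda>x. (0, 0, 0, 1, m x, n x))"
    by (rule vertical_combination[OF v v, of _ "\<lambda>x. inverse (c x)" "\<lambda>_. 0"]) (simp add: m_def n_def c field_simps)
  note nW = vertical_nabla[OF W smooth_on_const smooth_on_const smooth_on_const smooth_on_const smm smn]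
  have "vertical (\<lambda>x. (0, 0, 0, - l1 x, along e1 m x - k x / 2 - w1 x * n x + H11 x - m x * l1 x,
      along e1 n x - w1 x * m x + H12 x - m x * l2 x))"
    by (rule vertical_reduce[OF nW(1), of _ "\<lambda>_. 1" "\<lambda>_. 0" m]) (simp add: algebra_simps)
  then have "vertical (\<lambda>x. (0, 0, 0, 0, along e1 m x - k x / 2 - w1 x * n x + H11 x,
      along e1 n x - w1 x * m x + H12 x - m x * l2 x + l1 x * n x))"
    by (rule vertical_combination[OF _ W, of _ _ "\<lambda>_. 1" l1]) (simp add: algebra_simps)
  note w1eqs = vertical_zero[OF this _ refl]
  have "vertical (\<lambda>x. (0, 0, 0, - l2 x, along e2 m x - w2 x * n x + H12 x - n x * l1 x,
      along e2 n x + k x / 2 - w2 x * m x + H22 x - n x * l2 x))"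
    by (rule vertical_reduce[OF nW(2), of _ "\<lambda>_. 0" "\<lambda>_. 1" n]) (simp add: algebra_simps)
  then have "vertical (\<lambda>x. (0, 0, 0, 0, along e2 m x - w2 x * n x + H12 x - n x * l1 x + l2 x * m x,
      along e2 n x + k x / 2 - w2 x * m x + H22 x))"
    by (rule vertical_combination[OF _ W, of _ _ "\<lambda>_. 1" l2]) (simp add: algebra_simps)
  note w2eqs = vertical_zero[OF this _ refl]
  \<comment> \<open>Subtracting \<open>d\<close> times the normalized element leaves a case of
    \<open>vertical_zero\<close>. So every translation-free element is a multiple of that one, and
    all \<open>P\<^sub>i\<^sub>j\<close>, \<open>Q\<^sub>i\<^sub>j\<close> become
    \<open>c\<^sub>i\<^sub>j m\<close>, \<open>c\<^sub>i\<^sub>j n\<close>.\<close>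
  have E: "p y = d y * m y \<and> q y = d y * n y" if "vertical (\<lambda>x. (0, 0, 0, d x, p x, q x))" "y \<in> D1" for d p q y
  proof -
    have "vertical (\<lambda>x. (0, 0, 0, 0, p x - d x * m x, q x - d x * n x))"
      by (rule vertical_combination[OF that(1) W, of _ "\<lambda>_. 1" "\<lambda>x. - d x"]) simp
    from vertical_zero[OF this that(2) refl] show ?thesis by simp
  qed
  define M where "M = (\<lambda>x. 2 * k x * m x)"
  define N where "N = (\<lambda>x. 2 * k x * n x)"
  have smM: "smooth_on D1 M" and smN: "smooth_on D1 N" unfolding M_def N_def
    by (intro smooth_ops1 smooth_k smm smn)+
  \<comment> \<open>These are the identities of \<open>PQ_relations\<close> after that substitution.
    The factor 2 k in \<open>M\<close>, \<open>N\<close> is chosen to clear \<open>k\<close> from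
    their derivatives in \<open>dM\<close>.\<close>
  have AB: "M y * c12 y - N y * c11 y = 4 * (k y * k y) * l2 y" "M y * c22 y - N y * c12 y = 4 * (k y * k y) * l1 y"
    if y: "y \<in> D1" for y
  proof -
    have "c12 y * m y - c11 y * n y = 2 * k y * l2 y" "c22 y * m y - c12 y * n y = 2 * k y * l1 y"
      using PQ_relations[OF y] E[OF vertical_E(1) y] E[OF vertical_E(3) y] E[OF vertical_E(4) y] by simp_all
    then have "2 * k y * (c12 y * m y - c11 y * n y) = 2 * k y * (2 * k y * l2 y)"
      "2 * k y * (c22 y * m y - c12 y * n y) = 2 * k y * (2 * k y * l1 y)" by simp_all
    then show "M y * c12 y - N y * c11 y = 4 * (k y * k y) * l2 y" "M y * c22 y - N y * c12 y = 4 * (k y * k y) * l1 y"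
      by (simp_all add: M_def N_def algebra_simps)
  qed
  note df = diffs[OF x] differentiable[OF smm x] differentiable[OF smn x] differentiable[OF smM x] differentiable[OF smN x]
     differentiable[OF smooth_c(1) x] differentiable[OF smooth_c(2) x] differentiable[OF smooth_c(3) x]
  have dmn: "along e1 m x = k x / 2 + w1 x * n x - H11 x" "along e1 n x = w1 x * m x - H12 x + m x * l2 x - l1 x * n x"
    "along e2 m x = w2 x * n x - H12 x + n x * l1 x - l2 x * m x" "along e2 n x = w2 x * m x - k x / 2 - H22 x"
    using w1eqs[OF x] w2eqs[OF x] by simp_all
  have dM: "along e1 M x = 2 * l1 x * M x + w1 x * N x - c11 x"
      "along e2 M x = l2 x * M x + l1 x * N x - c12 x + w2 x * N x"
      "along e1 N x = l1 x * N x + l2 x * M x - c12 x + w1 x * M x"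
      "along e2 N x = 2 * l2 x * N x - c22 x + w2 x * M x"
    unfolding M_def N_def
    by (simp_all add: along_mult df x along_k dmn c11_def c12_def c22_def algebra_simps)
  have dH: "along e1 H11 x = c11 x * m x + 2 * w1 x * H12 x + 2 * l1 x * H11 x"
    "along e1 H12 x = c11 x * n x + w1 x * (H11 x + H22 x) + l1 x * H12 x + l2 x * H11 x + 3 * k x * l2 x / 2"
    "along e2 H11 x = c12 x * m x + 2 * w2 x * H12 x - k x * l2 x + 2 * l1 x * H12 x"
    "along e2 H12 x = c12 x * n x + w2 x * (H11 x + H22 x) + k x * l1 x / 2 + l1 x * H22 x + l2 x * H12 x"
    "along e1 H22 x = c12 x * n x + 2 * w1 x * H12 x + k x * l1 x + 2 * l2 x * H12 x"
    "along e2 H22 x = c22 x * n x + 2 * w2 x * H12 x + 2 * l2 x * H22 x"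
    using E[OF vertical_E(1) x] E[OF vertical_E(2) x] E[OF vertical_E(3) x] E[OF vertical_E(4) x]
    unfolding P11_def Q11_def P12_def Q12_def P22_def Q22_def Q12'_def by linarith+
  have dcX: "along X c11 x = 2 * (along X k x * H11 x + k x * along X H11 x) - 2 * k x * along X k x"
    "along X c12 x = 2 * (along X k x * H12 x + k x * along X H12 x)"
    "along X c22 x = 2 * (along X k x * H22 x + k x * along X H22 x) + 2 * k x * along X k x" for X
    unfolding c11_def c12_def c22_def by (simp_all add: along_mult along_add along_diff df algebra_simps)
  have dc: "along e1 c11 x = M x * c11 x + 2 * w1 x * c12 x + 4 * l1 x * c11 x"
    "along e1 c12 x = N x * c11 x + w1 x * (c11 x + c22 x) + 3 * l1 x * c12 x + l2 x * c11 x + 4 * (k x * k x) * l2 x"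
    "along e2 c11 x = M x * c12 x + 2 * l2 x * c11 x + 2 * l1 x * c12 x + 2 * w2 x * c12 x - 4 * (k x * k x) * l2 x"
    "along e2 c12 x = N x * c12 x + 3 * l2 x * c12 x + l1 x * c22 x + w2 x * (c11 x + c22 x)"
    "along e1 c22 x = N x * c12 x + 2 * l1 x * c22 x + 2 * l2 x * c12 x + 2 * w1 x * c12 x + 4 * (k x * k x) * l1 x"
    "along e2 c22 x = N x * c22 x + 4 * l2 x * c22 x + 2 * w2 x * c12 x"
    unfolding dcX dH along_k[OF x] by (simp_all add: M_def N_def c11_def c12_def c22_def algebra_simps)
  have dl: "along e1 l1 x = l1 x * l1 x - c11 x - k x * k x + w1 x * l2 x"
    "along e2 l1 x = l1 x * l2 x - c12 x + w2 x * l2 x"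
    "along e1 l2 x = l1 x * l2 x - c12 x + w1 x * l1 x"
    "along e2 l2 x = l2 x * l2 x - c22 x + k x * k x + w2 x * l1 x"
    unfolding along_l[OF x] by (simp_all add: c11_def c12_def c22_def)
  have dA: "along X M x * c12 x + M x * along X c12 x - (along X N x * c11 x + N x * along X c11 x) =
      8 * (k x * along X k x) * l2 x + 4 * (k x * k x) * along X l2 x"
    and dB: "along X M x * c22 x + M x * along X c22 x - (along X N x * c12 x + N x * along X c12 x) =
      8 * (k x * along X k x) * l1 x + 4 * (k x * k x) * along X l1 x" for X
  proof -
    have "along X (\<lambda>y. M y * c12 y - N y * c11 y) x = along X (\<lambda>y. 4 * (k y * k y) * l2 y) x"
      "along X (\<lambda>y. M y * c22 y - N y * c12 y) x = along X (\<lambda>y. 4 * (k y * k y) * l1 y) x"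
      by (rule along_cong_open[OF D1(1) x AB(1)], assumption, rule along_cong_open[OF D1(1) x AB(2)], assumption)
    then show "along X M x * c12 x + M x * along X c12 x - (along X N x * c11 x + N x * along X c11 x) =
      8 * (k x * along X k x) * l2 x + 4 * (k x * k x) * along X l2 x"
      "along X M x * c22 x + M x * along X c22 x - (along X N x * c12 x + N x * along X c12 x) =
      8 * (k x * along X k x) * l1 x + 4 * (k x * k x) * along X l1 x"
      by (simp_all add: along_mult along_diff df algebra_simps)
  qed
  let ?A = "M x * c12 x - N x * c11 x" and ?B = "M x * c22 x - N x * c12 x" and ?kk = "k x * k x"
  note Ax = AB(1)[OF x] and Bx = AB(2)[OF x]
  \<comment> \<open>\<open>?A\<close> and \<open>?B\<close> are left unexpanded so that their known
    values can be inserted into the differentiated identity; the connection terms and the terms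
    quadratic in dl then cancel.\<close>
  have "(5 * l1 x + M x) * ?A + w1 x * ?B = 4 * ?kk * (5 * l1 x * l2 x - c12 x + w1 x * l1 x) - M x * (4 * ?kk * l2 x - ?A)"
    using dA[of e1] unfolding dM dc dl along_k[OF x] by (simp add: algebra_simps)
  then have "4 * ?kk * (M x * l2 x + c12 x) = 0" unfolding Ax Bx by (simp add: algebra_simps)
  then have 1: "c12 x = - M x * l2 x" using k_nz[OF x] by (simp add: eq_neg_iff_add_eq_0 add.commute)
  have "(5 * l2 x + N x) * ?B + w2 x * ?A = 4 * ?kk * (5 * l1 x * l2 x - c12 x + w2 x * l2 x)"
    using dB[of e2] unfolding dM dc dl along_k[OF x] by (simp add: algebra_simps)
  then have "4 * ?kk * (N x * l1 x + c12 x) = 0" unfolding Ax Bx by (simp add: algebra_simps)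
  then have 2: "c12 x = - N x * l1 x" using k_nz[OF x] by (simp add: eq_neg_iff_add_eq_0 add.commute)
  have "(4 * l2 x + N x) * ?A + (l1 x + w2 x) * ?B + (c11 x * c22 x - c12 x * c12 x) =
      4 * ?kk * (5 * l2 x * l2 x - c22 x + ?kk + w2 x * l1 x) + N x * (?A - 4 * ?kk * l2 x)"
    using dA[of e2] unfolding dM dc dl along_k[OF x] by (simp add: algebra_simps)
  then have 3: "c11 x * c22 x - c12 x * c12 x = 4 * (k x)^2 * (l2 x * l2 x - l1 x * l1 x - N x * l2 x - c22 x + (k x)^2)"
    unfolding Ax Bx by (simp add: algebra_simps power2_eq_square)
  have "(4 * l1 x + M x) * ?B + (l2 x + w1 x) * ?A - (c11 x * c22 x - c12 x * c12 x) =
      4 * ?kk * (5 * l1 x * l1 x - c11 x - ?kk + w1 x * l2 x) + M x * (?B - 4 * ?kk * l1 x) + N x * (4 * ?kk * l2 x - ?A)"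
    using dB[of e1] unfolding dM dc dl along_k[OF x] by (simp add: algebra_simps)
  then have 4: "c11 x * c22 x - c12 x * c12 x = 4 * (k x)^2 * (l2 x * l2 x - l1 x * l1 x + M x * l1 x + c11 x + (k x)^2)"
    unfolding Ax Bx by (simp add: algebra_simps power2_eq_square)
  have "c11 x = - 2 * l1 x * l1 x - 2 * (k x)^2" "c12 x = - 2 * l1 x * l2 x" "c22 x = - 2 * l2 x * l2 x + 2 * (k x)^2"
    using hessian_algebra[OF k_nz[OF x] l _ _ 1 2 3 4] Ax Bx by (simp_all add: power2_eq_square)
  then show ?thesis unfolding hessian_relation_def dl by (simp add: power2_eq_square)
qed

lemma hessian_relation:
  assumes x: "x \<in> D1" and l: "l1 x \<noteq> 0 \<or> l2 x \<noteq> 0"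
  shows "hessian_relation x"
proof -
  have *: "hessian_relation x" if v: "vertical (\<lambda>x. (0, 0, 0, c x, P x, Q x))"
    and sm: "smooth_on D1 c" "smooth_on D1 P" "smooth_on D1 Q" and c: "c x \<noteq> 0" for c P Q
  proof -
    \<comment> \<open>The quotients by \<open>c\<close> need an open set on which \<open>c\<close>
      has no zero, so the patch is shrunk; vertical elements restrict to it.\<close>
    define D2 where "D2 = {y \<in> D1. c y \<noteq> 0}"
    have "open D2"
      unfolding D2_def using continuous_open_preimage[OF smooth_on_continuous_on[OF sm(1)] D1(1), of "- {0}"]
      by (simp add: vimage_def Int_def open_Compl)
    have D2: "D2 \<subseteq> D1" by (auto simp: D2_def)
    interpret patch: frobenius_patch D S g \<omega> \<kappa> e1 e2 k D2 F f0 W r \<alpha>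
      by unfold_locales (use k negative \<open>open D2\<close> D2 D1 F f0 W r frobenius span transverse in auto)
    have "patch.vertical (\<lambda>x. (0, 0, 0, c x, P x, Q x))"
      using v D2 unfolding vertical_def killed_def patch.vertical_def patch.killed_def by blast
    then show ?thesis
      by (rule patch.hessian_relation_if_nonzero[OF _ smooth_on_subset[OF sm(1) D2] smooth_on_subset[OF sm(2) D2]
            smooth_on_subset[OF sm(3) D2] _ _ l]) (use x c in \<open>auto simp: D2_def\<close>)
  qed
  show ?thesis
    using some_c_nonzero[OF x l] *[OF vertical_E(1) smooth_c(1) smooth_PQ(1,2)]
      *[OF vertical_E(3) smooth_c(2) smooth_PQ(3,4)] *[OF vertical_E(4) smooth_c(3) smooth_PQ(5,6)] by blast
qed

end

subsection \<open>The Poincare lemma and smooth inverses\<close>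

text \<open>The potential at x is the integral over t in [0, 1] of \<beta>, taken at x0 + t (x -
  x0), on x - x0. By closedness the derivative of the integrand in direction h is the t-derivative
  of t \<beta>(x0 + t (x - x0)) h, so the fundamental theorem of calculus returns \<beta> x
  h.\<close>

lemma poincare_lemma:
  fixes \<beta> :: "('a::euclidean_space, real) form"
  assumes S: "open S" "convex S" "x0 \<in> S" and \<beta>: "smooth_form S \<beta>"
    and closed: "\<And>x u v. x \<in> S \<Longrightarrow> ext_deriv \<beta> x u v = 0"
  shows "\<exists>f. smooth_on S f \<and> (\<forall>x\<in>S. (f has_derivative \<beta> x) (at x))"
proof -
  have lin: "linear (\<beta> p)" if "p \<in> S" for p using \<beta> that unfolding smooth_form_def by blast
  have sm: "smooth_on S (\<lambda>p. \<beta> p v)" for v using \<beta> unfolding smooth_form_def by blast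
  let ?p = "\<lambda>x t. x0 + t *\<^sub>R (x - x0)"
  have inS: "?p x t \<in> S" if "x \<in> S" "t \<in> cbox 0 1" for x t
    using convexD_alt[OF S(2) S(3) that(1), of t] that(2) by (simp add: algebra_simps)
  let ?D = "\<lambda>v p. fderiv (\<lambda>y. \<beta> y v) p"
  have Dsym: "?D v p u = ?D u p v" if "p \<in> S" for p u v
    using closed[OF that, of u v] by (simp add: ext_deriv_def)
  have Dlin: "linear (?D v p)" if "p \<in> S" for v p
    by (rule linear_frechet_derivative[OF smooth_on_differentiable[OF sm that]])
  define L where "L = (\<lambda>x t h. t * ?D (x - x0) (?p x t) h + \<beta> (?p x t) h)"
  have Llin: "linear (L x t)" if "x \<in> S" "t \<in> cbox 0 1" for x t
    unfolding L_def
    using Dlin[OF inS[OF that], of "x - x0"] lin[OF inS[OF that]]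
    by (auto intro!: linearI simp: linear_add linear_scale algebra_simps)
  define fx where "fx = (\<lambda>x t. Blinfun (L x t))"
  have fx: "blinfun_apply (fx x t) = L x t" if "x \<in> S" "t \<in> cbox 0 1" for x t
    unfolding fx_def using Llin[OF that] by (intro bounded_linear_Blinfun_apply) (simp add: linear_conv_bounded_linear)
  define f where "f = (\<lambda>x. integral (cbox 0 1) (\<lambda>t. \<beta> (?p x t) (x - x0)))"
  have dx: "((\<lambda>x. \<beta> (?p x t) (x - x0)) has_derivative L x t) (at x)" if "x \<in> S" "t \<in> cbox 0 1" for x t
  proof -
    have 1: "((\<lambda>x. ?p x t) has_derivative (\<lambda>h. t *\<^sub>R h)) (at x)" by (auto intro!: derivative_eq_intros)
    have 2: "((\<lambda>x. x - x0) has_derivative (\<lambda>h. h)) (at x)" by (auto intro!: derivative_eq_intros)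
    have "((\<lambda>x. \<beta> (?p x t) (x - x0)) has_derivative
        (\<lambda>h. ?D (x - x0) (?p x t) (t *\<^sub>R h) + \<beta> (?p x t) h)) (at x)"
      by (rule has_derivative_apply_linear[where \<alpha> = \<beta> and \<phi> = "\<lambda>x. ?p x t" and Y = "\<lambda>x. x - x0",
            OF 1 2 S(1) inS[OF that] lin smooth_on_differentiable[OF sm inS[OF that]]])
    then show ?thesis unfolding L_def using linear_scale[OF Dlin[OF inS[OF that]]] by simp
  qed
  have pcont: "continuous_on (S \<times> cbox 0 1) (\<lambda>z. ?p (fst z) (snd z))"
    by (intro continuous_intros)
  have cont: "continuous_on (S \<times> cbox 0 1) (\<lambda>z. \<phi> (?p (fst z) (snd z)))"
    if "continuous_on S \<phi>" for \<phi> :: "'a \<Rightarrow> real"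
    by (rule continuous_on_compose2[OF that pcont]) (use inS in auto)
  \<comment> \<open>Closedness moves the varying vector x - x0 into the slot of the differentiation
    direction, where a basis expansion exhibits joint continuity.\<close>
  have contD: "continuous_on (S \<times> cbox 0 1) (\<lambda>z. L (fst z) (snd z) b)" for b
  proof (rule continuous_on_eq)
    show "continuous_on (S \<times> cbox 0 1) (\<lambda>z. snd z * (\<Sum>j\<in>Basis. ((fst z - x0) \<bullet> j) * ?D b (?p (fst z) (snd z)) j)
        + \<beta> (?p (fst z) (snd z)) b)"
      by (intro continuous_on_add continuous_on_mult continuous_on_sum cont continuous_on_inner continuous_on_diff
          continuous_on_fst continuous_on_snd continuous_on_const continuous_on_id
          smooth_on_continuous_on[OF smooth_on_frechet_derivative[OF sm]] smooth_on_continuous_on[OF sm])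
    show "snd z * (\<Sum>j\<in>Basis. ((fst z - x0) \<bullet> j) * ?D b (?p (fst z) (snd z)) j)
        + \<beta> (?p (fst z) (snd z)) b = L (fst z) (snd z) b" if "z \<in> S \<times> cbox 0 1" for z
    proof -
      have p: "?p (fst z) (snd z) \<in> S" using that inS by auto
      have "(\<Sum>j\<in>Basis. ((fst z - x0) \<bullet> j) * ?D b (?p (fst z) (snd z)) j) = ?D b (?p (fst z) (snd z)) (fst z - x0)"
        using linear_sum_Basis[OF Dlin[OF p, of b], of "fst z - x0"] by simp
      then show ?thesis unfolding L_def Dsym[OF p, of "fst z - x0" b] by simp
    qed
  qed
  have contfx: "continuous_on (S \<times> cbox 0 1) (\<lambda>(x, t). fx x t)"
  proof (rule continuous_on_blinfun_componentwise)
    fix b :: 'a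
    show "continuous_on (S \<times> cbox 0 1) (\<lambda>z. blinfun_apply (case z of (x, t) \<Rightarrow> fx x t) b)"
      by (rule continuous_on_eq[OF contD[of b]]) (auto simp: fx)
  qed
  have intg: "(\<lambda>t. \<beta> (?p x t) (x - x0)) integrable_on cbox 0 1" if x: "x \<in> S" for x
  proof (rule integrable_continuous)
    show "continuous_on (cbox 0 1) (\<lambda>t. \<beta> (?p x t) (x - x0))"
      by (rule continuous_on_compose2[OF smooth_on_continuous_on[OF sm[of "x - x0"]], of "cbox 0 1" "?p x"])
        (use inS x in \<open>auto intro!: continuous_intros\<close>)
  qed
  have D: "(f has_derivative \<beta> x) (at x)" if x: "x \<in> S" for x
  proof -
    have "(f has_derivative integral (cbox 0 1) (fx x)) (at x within S)"
      unfolding f_def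
      by (rule leibniz_rule[OF _ intg contfx x S(2)]) (simp_all add: fx has_derivative_at_withinI dx)
    then have D: "(f has_derivative integral (cbox 0 1) (fx x)) (at x)"
      using at_within_open[OF x S(1)] by simp
    have cfx: "continuous_on (cbox 0 1) (fx x)"
    proof -
      have "continuous_on (cbox 0 1) (\<lambda>t. (x, t :: real))"
        by (intro continuous_on_Pair continuous_on_const continuous_on_id)
      from continuous_on_compose2[OF contfx this] show ?thesis using x by (auto simp: image_subset_iff)
    qed
    have "blinfun_apply (integral (cbox 0 1) (fx x)) h = \<beta> x h" for h
    proof -
      have "blinfun_apply (integral (cbox 0 1) (fx x)) h = integral (cbox 0 1) (\<lambda>t. blinfun_apply (fx x t) h)"
        using integral_linear[OF integrable_continuous[OF cfx], of "\<lambda>b. blinfun_apply b h"]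
          bounded_bilinear.bounded_linear_left[OF bounded_bilinear_blinfun_apply, of h]
        by (simp add: o_def)
      also have "\<dots> = integral {0..1} (\<lambda>t. L x t h)"
        unfolding cbox_interval[symmetric] by (rule integral_cong) (use fx x in auto)
      also have "\<dots> = 1 * \<beta> (?p x 1) h - 0 * \<beta> (?p x 0) h"
      proof (rule integral_unique, rule fundamental_theorem_of_calculus)
        fix t :: real assume t: "t \<in> {0..1}"
        then have pS: "?p x t \<in> S" using inS x by auto
        have "((\<lambda>t. ?p x t) has_derivative (\<lambda>s. s *\<^sub>R (x - x0))) (at t)"
          by (auto intro!: derivative_eq_intros)
        from has_derivative_compose[OF this smooth_on_has_derivative[OF sm pS]]
        have "((\<lambda>t. \<beta> (?p x t) h) has_derivative (\<lambda>s. ?D h (?p x t) (s *\<^sub>R (x - x0)))) (at t)" .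
        then have "((\<lambda>t. \<beta> (?p x t) h) has_real_derivative ?D h (?p x t) (x - x0)) (at t)"
          unfolding has_field_derivative_def
          by (rule has_derivative_eq_rhs) (simp add: linear_scale[OF Dlin[OF pS]] fun_eq_iff)
        then have "((\<lambda>t. t * \<beta> (?p x t) h) has_real_derivative L x t h) (at t)"
          unfolding L_def Dsym[OF pS, of "x - x0" h] by (auto intro!: derivative_eq_intros)
        then show "((\<lambda>t. t * \<beta> (?p x t) h) has_vector_derivative L x t h) (at t within {0..1})"
          by (simp add: has_real_derivative_iff_has_vector_derivative has_vector_derivative_at_within)
      qed simp
      finally show ?thesis by simp
    qed
    then have "blinfun_apply (integral (cbox 0 1) (fx x)) = \<beta> x" by blast
    then show ?thesis using D by simp
  qed
  have "smooth_on S f"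
  proof (rule smooth_onI_derivative)
    show "f differentiable (at x)" if "x \<in> S" for x using D[OF that] unfolding differentiable_def by blast
    show "smooth_on S (\<lambda>x. fderiv f x v)" for v
      by (rule smooth_on_cong[OF S(1) _ sm[of v]]) (simp add: frechet_derivative_eq[OF D])
  qed
  then show ?thesis using D by blast
qed

text \<open>Bootstrapping: the derivative of \<open>g\<close> is a smooth field evaluated at
  \<open>g\<close>, so if \<open>g\<close> is k times continuously differentiable, then so is its
  derivative.\<close>

lemma smooth_on_local_inverse:
  fixes f g :: "'a::euclidean_space \<Rightarrow> 'a"
  assumes V: "open V" and U: "open U" and gc: "continuous_on V g" and gU: "\<And>y. y \<in> V \<Longrightarrow> g y \<in> U"
    and X: "\<And>b. smooth_on U (X b)" and g: "\<And>y. y \<in> V \<Longrightarrow> (g has_derivative (\<lambda>b. X b (g y))) (at y)"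
  shows "smooth_on V g"
  unfolding smooth_on_def
proof
  fix k
  show "C_k_on k V g"
  proof (induction k)
    case 0
    then show ?case using gc by simp
  next
    case (Suc k)
    show ?case
    proof (rule C_k_onI_has_derivative[OF V g])
      show "C_k_on k V (\<lambda>y. X b (g y))" for b
        using C_k_on_compose[OF V U _ _ Suc, of "X b"] X gU unfolding smooth_on_def by blast
    qed
  qed
qed

lemma local_diffeomorphism:
  fixes f :: "real^2 \<Rightarrow> real^2"
  assumes S: "open S" "x0 \<in> S" and f: "smooth_on S f"
    and det: "fderiv f x0 (axis 1 1) $ 1 * fderiv f x0 (axis 2 1) $ 2 -
      fderiv f x0 (axis 2 1) $ 1 * fderiv f x0 (axis 1 1) $ 2 \<noteq> 0"
  shows "\<exists>U V g. open U \<and> U \<subseteq> S \<and> x0 \<in> U \<and> open V \<and> homeomorphism U V f g \<and> smooth_on V g"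
proof -
  let ?J = "\<lambda>i j x. fderiv f x (axis j 1) $ i"
  define d where "d = (\<lambda>x. ?J 1 1 x * ?J 2 2 x - ?J 1 2 x * ?J 2 1 x)"
  have sJ: "smooth_on S (?J i j)" for i j
    by (rule smooth_on_vec_nth[OF S(1) smooth_on_frechet_derivative[OF f]])
  have sd: "smooth_on S d" unfolding d_def by (intro smooth_on_diff[OF S(1)] smooth_on_mult[OF S(1)] sJ)
  define T where "T = {x \<in> S. d x \<noteq> 0}"
  have oT: "open T"
    unfolding T_def using continuous_open_preimage[OF smooth_on_continuous_on[OF sd] S(1), of "- {0}"]
    by (simp add: vimage_def Int_def open_Compl)
  have TS: "T \<subseteq> S" by (auto simp: T_def)
  have x0: "x0 \<in> T" using S det by (simp add: T_def d_def)
  have dT: "d x \<noteq> 0" if "x \<in> T" for x using that by (simp add: T_def)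
  \<comment> \<open>Cramer's rule for the preimage of \<open>b\<close> under the derivative of
    \<open>f\<close>; the explicit quotient shows smoothness in \<open>x\<close> wherever the
    determinant \<open>d\<close> is nonzero.\<close>
  define X where "X = (\<lambda>(b :: real^2) x. vector [(?J 2 2 x * b $ 1 - ?J 1 2 x * b $ 2) / d x,
      (?J 1 1 x * b $ 2 - ?J 2 1 x * b $ 1) / d x] :: real^2)"
  have sX: "smooth_on T (X b)" for b
    unfolding X_def
    by (intro smooth_on_vector2[OF oT] smooth_on_divide[OF oT] smooth_on_diff[OF oT] smooth_on_mult[OF oT]
        smooth_on_const smooth_on_subset[OF sJ TS] smooth_on_subset[OF sd TS] dT)
  have D: "(f has_derivative fderiv f x) (at x)" if "x \<in> S" for x
    by (rule smooth_on_has_derivative[OF f that])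
  have lin: "linear (fderiv f x)" if "x \<in> S" for x
    using has_derivative_linear[OF D[OF that]] .
  have comp: "fderiv f x w $ i = w $ 1 * ?J i 1 x + w $ 2 * ?J i 2 x" if "x \<in> S" for x w i
  proof -
    have w: "w = w $ 1 *\<^sub>R axis 1 1 + w $ 2 *\<^sub>R axis 2 1" by (simp add: vec_eq_iff forall_2 axis_def)
    have "fderiv f x w = w $ 1 *\<^sub>R fderiv f x (axis 1 1) + w $ 2 *\<^sub>R fderiv f x (axis 2 1)"
      by (subst w) (simp only: linear_add[OF lin[OF that]] linear_scale[OF lin[OF that]])
    then show ?thesis by simp
  qed
  have inv1: "fderiv f x (X b x) = b" if "x \<in> T" for x b
  proof -
    have xS: "x \<in> S" using that TS by blast
    have "d x * (fderiv f x (X b x) $ i) = d x * b $ i" for i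
    proof -
      have "d x * (fderiv f x (X b x) $ i) =
          (d x * X b x $ 1) * ?J i 1 x + (d x * X b x $ 2) * ?J i 2 x"
        unfolding comp[OF xS, of "X b x" i] by (simp only: distrib_left mult.assoc)
      also have "\<dots> = (?J 2 2 x * b $ 1 - ?J 1 2 x * b $ 2) * ?J i 1 x + (?J 1 1 x * b $ 2 - ?J 2 1 x * b $ 1) * ?J i 2 x"
        using dT[OF that] by (simp add: X_def)
      also have "\<dots> = d x * b $ i" using exhaust_2[of i] by (auto simp: d_def algebra_simps)
      finally show ?thesis .
    qed
    then show ?thesis using dT[OF that] by (simp add: vec_eq_iff)
  qed
  have inv2: "X (fderiv f x w) x = w" if "x \<in> T" for x w
  proof -
    have xS: "x \<in> S" using that TS by blast
    have "d x * (X (fderiv f x w) x $ i) = d x * w $ i" for i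
    proof -
      have "d x * (X (fderiv f x w) x $ i) =
        (if i = 1 then ?J 2 2 x * (fderiv f x w $ 1) - ?J 1 2 x * (fderiv f x w $ 2)
         else ?J 1 1 x * (fderiv f x w $ 2) - ?J 2 1 x * (fderiv f x w $ 1))"
        using exhaust_2[of i] dT[OF that] by (auto simp: X_def)
      then show ?thesis
        using exhaust_2[of i] unfolding comp[OF xS, of w 1] comp[OF xS, of w 2] by (auto simp: d_def algebra_simps)
    qed
    then show ?thesis using dT[OF that] by (simp add: vec_eq_iff)
  qed
  define f' where "f' = (\<lambda>x. Blinfun (fderiv f x))"
  have f': "blinfun_apply (f' x) = fderiv f x" if "x \<in> T" for x
    unfolding f'_def using has_derivative_bounded_linear[OF D] that TS by (intro bounded_linear_Blinfun_apply) auto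
  have cf': "continuous_on T f'"
  proof (rule continuous_on_blinfun_componentwise)
    fix b :: "real^2"
    show "continuous_on T (\<lambda>x. blinfun_apply (f' x) b)"
      by (rule continuous_on_eq[OF continuous_on_subset[OF smooth_on_continuous_on[OF smooth_on_frechet_derivative[OF f]] TS]])
        (simp add: f')
  qed
  have linX: "linear (\<lambda>b. X b x0)"
    by (rule linearI) (simp_all add: X_def vec_eq_iff forall_2 add_divide_distrib diff_divide_distrib algebra_simps)
  define invf where "invf = Blinfun (\<lambda>b. X b x0)"
  have invf: "blinfun_apply invf = (\<lambda>b. X b x0)"
    unfolding invf_def using linX by (intro bounded_linear_Blinfun_apply) (simp add: linear_conv_bounded_linear)
  have id: "invf o\<^sub>L f' x0 = id_blinfun"
    by (rule blinfun_eqI) (simp add: invf f' x0 inv2)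
  obtain U V g g' where U: "open U" "U \<subseteq> T" "x0 \<in> U" and V: "open V" and hom: "homeomorphism U V f g"
    and dg: "\<And>y. y \<in> V \<Longrightarrow> (g has_derivative g' y) (at y)" and g': "\<And>y. y \<in> V \<Longrightarrow> g' y = inv (blinfun_apply (f' (g y)))"
  proof (rule inverse_function_theorem[OF oT _ cf' x0 id])
    show "(f has_derivative blinfun_apply (f' x)) (at x)" if "x \<in> T" for x
      using D[of x] f'[OF that] that TS by auto
  qed (rule that)
  have gU: "g y \<in> U" if "y \<in> V" for y using hom that unfolding homeomorphism_def by blast
  have "smooth_on V g"
  proof (rule smooth_on_local_inverse[OF V oT])
    show "continuous_on V g" using hom unfolding homeomorphism_def by blast
    show "g y \<in> T" if "y \<in> V" for y using gU[OF that] U by blast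
    show "smooth_on T (X b)" for b by (rule sX)
    show "(g has_derivative (\<lambda>b. X b (g y))) (at y)" if y: "y \<in> V" for y
    proof -
      have gT: "g y \<in> T" using gU[OF y] U by blast
      have "inv (fderiv f (g y)) = (\<lambda>b. X b (g y))"
        by (rule inv_equality) (simp_all add: inv1[OF gT] inv2[OF gT])
      then show ?thesis using dg[OF y] unfolding g'[OF y] f'[OF gT] by simp
    qed
  qed
  then show ?thesis using U V hom TS by blast
qed

subsection \<open>The normal form of the metric\<close>

lemma along_inverse:
  fixes f :: "'a::euclidean_space \<Rightarrow> real"
  assumes "f differentiable (at x)" "f x \<noteq> 0"
  shows "along X (\<lambda>x. inverse (f x)) x = - along X f x / (f x)\<^sup>2"
  using along_has_derivative[OF Deriv.has_derivative_inverse[OF assms(2) has_derivative_frechet[OF assms(1)]], of X]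
  by (simp add: along_def power2_eq_square field_simps)

lemma along_scaled_mult:
  fixes f g :: "'a::euclidean_space \<Rightarrow> real"
  assumes "f differentiable (at x)" "g differentiable (at x)"
  shows "along X (\<lambda>x. c * f x * g x) x = c * (along X f x * g x + f x * along X g x)"
proof -
  have "(\<lambda>x. c * f x) differentiable (at x)" using assms(1) by (intro differentiable_mult) simp_all
  then have "along X (\<lambda>x. c * f x * g x) x = along X (\<lambda>x. c * f x) x * g x + c * f x * along X g x"
    using along_mult[of "\<lambda>x. c * f x" x g X] assms(2) by simp
  then show ?thesis using along_mult[of "\<lambda>_. c" x f X] assms(1) by (simp add: distrib_left)
qed

lemma along_sqrt:
  fixes f :: "'a::euclidean_space \<Rightarrow> real"
  assumes "f differentiable (at x)" "0 < f x"
  shows "along X (\<lambda>x. sqrt (f x)) x = along X f x / (2 * sqrt (f x))"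
proof -
  have "(sqrt has_derivative (\<lambda>h. h * (inverse (sqrt (f x)) / 2))) (at (f x))"
    using DERIV_real_sqrt[OF assms(2)] unfolding has_field_derivative_def
    by (rule has_derivative_eq_rhs) (simp add: fun_eq_iff)
  from along_has_derivative[OF has_derivative_compose[OF has_derivative_frechet[OF assms(1)] this], of X]
  show ?thesis by (simp add: along_def field_simps)
qed

lemma smooth_on_ln:
  fixes f :: "'a::euclidean_space \<Rightarrow> real"
  assumes S: "open S" and f: "smooth_on S f" and pos: "\<And>x. x \<in> S \<Longrightarrow> 0 < f x"
  shows "smooth_on S (\<lambda>x. ln (f x))"
proof (rule smooth_onI_derivative)
  have D: "((\<lambda>x. ln (f x)) has_derivative (\<lambda>v. inverse (f x) * fderiv f x v)) (at x)" if "x \<in> S" for x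
  proof -
    have "(ln has_derivative (\<lambda>h. inverse (f x) * h)) (at (f x))"
      using DERIV_ln[OF pos[OF that]] unfolding has_field_derivative_def .
    from has_derivative_compose[OF smooth_on_has_derivative[OF f that] this] show ?thesis .
  qed
  show "(\<lambda>x. ln (f x)) differentiable (at x)" if "x \<in> S" for x
    using D[OF that] unfolding differentiable_def by blast
  show "smooth_on S (\<lambda>x. fderiv (\<lambda>x. ln (f x)) x v)" for v
  proof (rule smooth_on_cong[OF S])
    show "smooth_on S (\<lambda>x. inverse (f x) * fderiv f x v)"
      by (rule smooth_on_mult[OF S smooth_on_inverse[OF S f] smooth_on_frechet_derivative[OF f]])
        (use pos in fastforce)
    show "inverse (f x) * fderiv f x v = fderiv (\<lambda>x. ln (f x)) x v" if "x \<in> S" for x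
      by (simp add: frechet_derivative_eq[OF D[OF that]])
  qed
qed

section \<open>The function y = 1 / k and its Hessian\<close>

context moving_frame
begin

definition y :: "real^2 \<Rightarrow> real" where "y x = inverse (sqrt \<bar>\<kappa> x\<bar>)"
definition y1 :: "real^2 \<Rightarrow> real" where "y1 x = along e1 y x"
definition y2 :: "real^2 \<Rightarrow> real" where "y2 x = along e2 y x"

definition y_hessian :: "real^2 \<Rightarrow> bool" where
  "y_hessian x \<longleftrightarrow>
     along e1 y1 x = - (y1 x)\<^sup>2 / (2 * y x) - 2 / y x + w1 x * y2 x \<and>
     along e2 y1 x = - (y1 x * y2 x) / (2 * y x) + w2 x * y2 x \<and>
     along e1 y2 x = - (y1 x * y2 x) / (2 * y x) + w1 x * y1 x \<and>
     along e2 y2 x = - (y2 x)\<^sup>2 / (2 * y x) + 2 / y x + w2 x * y1 x"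

lemma smooth_y_if_negative:
  assumes neg: "\<And>x. x \<in> S \<Longrightarrow> \<kappa> x < 0"
  shows "smooth_on S y"
proof (rule smooth_on_cong[OF S(1)])
  have s: "smooth_on S (\<lambda>x. sqrt (- \<kappa> x))"
    by (rule smooth_on_sqrt[OF S(1) smooth_on_minus[OF S(1) smooth_curvature]]) (simp add: neg)
  show "smooth_on S (\<lambda>x. inverse (sqrt (- \<kappa> x)))"
    by (rule smooth_on_inverse[OF S(1) s]) (use neg in fastforce)
  show "inverse (sqrt (- \<kappa> x)) = y x" if "x \<in> S" for x
    using neg[OF that] by (simp add: y_def)
qed

text \<open>In terms of \<open>y\<close>, the function \<open>q\<close> defining the Killing field is \<open>y powr (3/2)\<close>.\<close>

lemma timelike_y:
  assumes neg: "\<And>x. x \<in> S \<Longrightarrow> \<kappa> x < 0" and x: "x \<in> S"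
    and V: "0 < g x (killing_field \<kappa> (x, e1 x, e2 x)) (killing_field \<kappa> (x, e1 x, e2 x))"
  shows "(y1 x)\<^sup>2 < (y2 x)\<^sup>2"
proof -
  have xD: "x \<in> D" using x S(2) by blast
  have yp: "0 < y x" using neg[OF x] by (simp add: y_def)
  have yq: "\<bar>\<kappa> z\<bar> powr (-3/4) = y z powr (3/2)" for z
  proof -
    have "y z = \<bar>\<kappa> z\<bar> powr (- (1/2))" unfolding y_def by (subst powr_minus) (simp add: powr_half_sqrt)
    then show ?thesis by (simp add: powr_powr)
  qed
  define Q where "Q = 3 / 2 * y x powr (1 / 2)"
  have "((\<lambda>t. t powr (3/2)) has_real_derivative Q) (at (y x))"
    unfolding Q_def using yp by (auto intro!: derivative_eq_intros)
  from has_derivative_compose[OF smooth_on_has_derivative[OF smooth_y_if_negative[OF neg] x] this[unfolded has_field_derivative_def]]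
  have "fderiv (\<lambda>z. \<bar>\<kappa> z\<bar> powr (-3/4)) x = (\<lambda>h. Q * fderiv y x h)"
    unfolding yq by (rule frechet_derivative_eq)
  then have k: "killing_field \<kappa> (x, e1 x, e2 x) = (Q * y1 x) *\<^sub>R e2 x - (Q * y2 x) *\<^sub>R e1 x"
    by (simp add: y1_def y2_def along_def)
  note B = bilinear_lsub[OF g_bilinear[OF xD]] bilinear_rsub[OF g_bilinear[OF xD]]
    bilinear_lmul[OF g_bilinear[OF xD]] bilinear_rmul[OF g_bilinear[OF xD]]
  have "0 < (Q * Q) * ((y2 x)\<^sup>2 - (y1 x)\<^sup>2)"
    using V unfolding k B metric_frame[OF x] by (simp add: algebra_simps power2_eq_square)
  moreover have "0 < Q" using yp by (simp add: Q_def)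
  ultimately show ?thesis by (simp add: zero_less_mult_iff)
qed

text \<open>Since y = exp(-2 l), the relation \<nabla>\<nabla>l = 3 dl \<otimes> dl + k^2 g
  translates into the one for y. That dy is nonzero is what provides the fourth holonomy
  element.\<close>

lemma y_hessian_if_integrable:
  assumes neg: "\<And>x. x \<in> S \<Longrightarrow> \<kappa> x < 0" and x0: "x0 \<in> S"
    and int: "has_transverse_frobenius (frame_pairs D g)
      (embedding_system g \<omega>) (singular_system g \<omega> \<kappa> (1::real))"
    and nz: "y1 x0 \<noteq> 0 \<or> y2 x0 \<noteq> 0"
  shows "y_hessian x0"
proof -
  let ?N = "frame_pairs D g"
  \<comment> \<open>Integrability is a condition around each point of the product of the frame
    bundles; the standard frame at the origin supplies the second component of such a point.\<close>
  define f0 :: frame3 where "f0 = (0, axis 1 1, axis 2 1, axis 3 1)"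
  have f0: "f0 \<in> mink_frame_bundle"
    by (simp add: f0_def mink_frame_bundle_def mink_def axis_def)
  have p: "(frame_at x0, f0) \<in> ?N" using frame_at_in[OF x0] f0 by simp
  from bspec[OF int[unfolded has_transverse_frobenius_def] p]
  obtain W r and \<alpha> :: "nat \<Rightarrow> (frame2 \<times> frame3, real) form" where W: "open W" "(frame_at x0, f0) \<in> W" and r: "2 \<le> r" and fr: "frobenius_frame ?N W r \<alpha>"
    and sp: "\<forall>y\<in>?N \<inter> W. (\<forall>i<r. in_span_at ?N (singular_system g \<omega> \<kappa> 1) y (\<alpha> i y)) \<and>
      (\<forall>c. in_span_at ?N (embedding_system g \<omega>) y (\<lambda>v. \<Sum>i<r. c i * \<alpha> i y v) \<longrightarrow>
        (\<forall>v\<in>tangent_vectors ?N y. (\<Sum>i<r. c i * \<alpha> i y v) = 0))"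
    by (elim exE conjE) (rule that; assumption)
  let ?e = "\<lambda>z. (frame_at (fst z), snd z :: frame3)"
  have oS: "open (S \<times> (UNIV :: frame3 set))" using S(1) by (simp add: open_Times)
  have "continuous_on (S \<times> (UNIV :: frame3 set)) ?e"
    by (intro continuous_on_Pair continuous_on_compose2[OF smooth_on_continuous_on[OF smooth_frame_at]]
        continuous_on_fst continuous_on_snd continuous_on_id) auto
  from continuous_open_preimage[OF this oS W(1)]
  have "open ((S \<times> UNIV) \<inter> ?e -` W)" .
  moreover have "(x0, f0) \<in> (S \<times> UNIV) \<inter> ?e -` W" using x0 W(2) by simp
  ultimately obtain D1 F where D1: "open D1" and F: "open F" and xf: "(x0, f0) \<in> D1 \<times> F"
    and sub: "D1 \<times> F \<subseteq> (S \<times> UNIV) \<inter> ?e -` W" by (rule open_prod_elim)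
  have D1S: "D1 \<subseteq> S" using sub xf by auto
  define k where "k = (\<lambda>x. sqrt \<bar>\<kappa> x\<bar>)"
  interpret patch: frobenius_patch D S g \<omega> \<kappa> e1 e2 k D1 F f0 W r \<alpha>
  proof unfold_locales
    show "\<And>x f. x \<in> D1 \<Longrightarrow> f \<in> F \<Longrightarrow> (frame_at x, f) \<in> W" using sub by auto
  qed (use k_def neg D1 D1S F xf f0 W(1) r fr sp in auto)
  have x: "x0 \<in> D1" using xf by simp
  have yk: "y = (\<lambda>x. inverse (k x))" by (simp add: y_def k_def fun_eq_iff)
  have y1: "y1 z = - 2 * patch.l1 z * y z" and y2: "y2 z = - 2 * patch.l2 z * y z" if "z \<in> D1" for z
    using patch.k_nz[OF that]
    unfolding y1_def y2_def yk along_inverse[OF patch.diffs(1)[OF that] patch.k_nz[OF that]] patch.along_k[OF that]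
    by (simp_all add: power2_eq_square field_simps)
  have ypos: "0 < y x0" unfolding yk using patch.k_pos[OF x] by simp
  have l: "patch.l1 x0 \<noteq> 0 \<or> patch.l2 x0 \<noteq> 0" using nz y1[OF x] y2[OF x] by auto
  have h: "along e1 patch.l1 x0 = 3 * patch.l1 x0 * patch.l1 x0 + (k x0)\<^sup>2 + w1 x0 * patch.l2 x0"
     "along e2 patch.l1 x0 = 3 * patch.l1 x0 * patch.l2 x0 + w2 x0 * patch.l2 x0"
     "along e1 patch.l2 x0 = 3 * patch.l1 x0 * patch.l2 x0 + w1 x0 * patch.l1 x0"
     "along e2 patch.l2 x0 = 3 * patch.l2 x0 * patch.l2 x0 - (k x0)\<^sup>2 + w2 x0 * patch.l1 x0"
    using patch.hessian_relation[OF x l] unfolding patch.hessian_relation_def by blast+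
  have sy: "smooth_on D1 y" unfolding yk
    by (rule smooth_on_inverse[OF D1 patch.smooth_k patch.k_nz])
  have a: "along X y1 x0 = - 2 * (along X patch.l1 x0 * y x0 + patch.l1 x0 * along X y x0)"
    "along X y2 x0 = - 2 * (along X patch.l2 x0 * y x0 + patch.l2 x0 * along X y x0)" for X
  proof -
    have "along X y1 x0 = along X (\<lambda>z. - 2 * patch.l1 z * y z) x0"
      "along X y2 x0 = along X (\<lambda>z. - 2 * patch.l2 z * y z) x0"
      by (rule along_cong_open[OF D1 x y1], assumption, rule along_cong_open[OF D1 x y2], assumption)
    then show "along X y1 x0 = - 2 * (along X patch.l1 x0 * y x0 + patch.l1 x0 * along X y x0)"
      "along X y2 x0 = - 2 * (along X patch.l2 x0 * y x0 + patch.l2 x0 * along X y x0)"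
      unfolding along_scaled_mult[OF patch.diffs(2)[OF x] smooth_on_differentiable[OF sy x]]
        along_scaled_mult[OF patch.diffs(3)[OF x] smooth_on_differentiable[OF sy x]] by simp_all
  qed
  have ky: "k x0 * y x0 = 1" using patch.k_nz[OF x] by (simp add: yk)
  then have kk: "(k x0)\<^sup>2 * y x0 = 1 / y x0" using ypos by (simp add: power2_eq_square field_simps)
  have half: "y1 x0 * y1 x0 / (2 * y x0) = 2 * patch.l1 x0 * patch.l1 x0 * y x0"
    "y1 x0 * y2 x0 / (2 * y x0) = 2 * patch.l1 x0 * patch.l2 x0 * y x0"
    "y2 x0 * y2 x0 / (2 * y x0) = 2 * patch.l2 x0 * patch.l2 x0 * y x0"
    unfolding y1[OF x] y2[OF x] using ypos by (simp_all add: field_simps)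
  have "along e1 y1 x0 = - (y1 x0 * y1 x0 / (2 * y x0)) - 2 * ((k x0)\<^sup>2 * y x0) + w1 x0 * y2 x0"
    "along e2 y1 x0 = - (y1 x0 * y2 x0 / (2 * y x0)) + w2 x0 * y2 x0"
    "along e1 y2 x0 = - (y1 x0 * y2 x0 / (2 * y x0)) + w1 x0 * y1 x0"
    "along e2 y2 x0 = - (y2 x0 * y2 x0 / (2 * y x0)) + 2 * ((k x0)\<^sup>2 * y x0) + w2 x0 * y1 x0"
    unfolding a half h
    by (simp_all add: y1_def[symmetric] y2_def[symmetric] y1[OF x] y2[OF x] algebra_simps)
  then show ?thesis unfolding y_hessian_def kk by (simp add: power2_eq_square)
qed

end

section \<open>Integration of the Hessian equation\<close>

locale darboux_frame = moving_frame +
  assumes negative: "\<And>x. x \<in> S \<Longrightarrow> \<kappa> x < 0" and convex: "convex S"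
    and hessian: "\<And>x. x \<in> S \<Longrightarrow> y_hessian x" and timelike: "\<And>x. x \<in> S \<Longrightarrow> (y1 x)\<^sup>2 < (y2 x)\<^sup>2"
begin

lemma y_pos: "x \<in> S \<Longrightarrow> 0 < y x"
  by (frule negative) (simp add: y_def)

lemma curvature_y: "x \<in> S \<Longrightarrow> \<kappa> x = - 1 / (y x)\<^sup>2"
  by (frule negative) (simp add: y_def power_divide inverse_eq_divide)

lemma smooth_y: "smooth_on S y"
  by (rule smooth_y_if_negative[OF negative])

lemma smooth_y12: "smooth_on S y1" "smooth_on S y2"
  using smooth_on_along[OF S(1) e1 smooth_y] smooth_on_along[OF S(1) e2 smooth_y]
  unfolding y1_def[abs_def] y2_def[abs_def] by (simp_all add: eta_contract_eq)

lemma frame_expand: "x \<in> S \<Longrightarrow> v = g x v (e1 x) *\<^sub>R e1 x - g x v (e2 x) *\<^sub>R e2 x"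
  using orthonormal_pair_basis[of g x "e1 x" "e2 x", OF g_bilinear g_sym orthonormal] S(2) by blast

lemmas smooth_diffs = smooth_on_differentiable[OF smooth_y] smooth_on_differentiable[OF smooth_y12(1)]
  smooth_on_differentiable[OF smooth_y12(2)]

lemma hessian_eqs:
  assumes "x \<in> S"
  shows "along e1 y1 x = - (y1 x)\<^sup>2 / (2 * y x) - 2 / y x + w1 x * y2 x"
    "along e2 y1 x = - (y1 x * y2 x) / (2 * y x) + w2 x * y2 x"
    "along e1 y2 x = - (y1 x * y2 x) / (2 * y x) + w1 x * y1 x"
    "along e2 y2 x = - (y2 x)\<^sup>2 / (2 * y x) + 2 / y x + w2 x * y1 x"
  using hessian[OF assms] unfolding y_hessian_def by blast+

text \<open>Contracting the Hessian equation with the gradient gives d(|\<nabla>y|^2) = -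
  (|\<nabla>y|^2 + 4) dy / y, so y (|\<nabla>y|^2 + 4) has zero differential.\<close>

lemma first_integral: "\<exists>c. \<forall>x\<in>S. y x * ((y1 x)\<^sup>2 - (y2 x)\<^sup>2 + 4) = c"
proof (rule has_derivative_zero_constant[OF convex])
  let ?E = "\<lambda>x. y x * ((y1 x)\<^sup>2 - (y2 x)\<^sup>2 + 4)"
  fix x assume x: "x \<in> S"
  have sE: "smooth_on S ?E"
    by (intro smooth_ops smooth_y smooth_y12)
  note h' = hessian_eqs[OF x]
  have al: "along X ?E x = along X y x * ((y1 x)\<^sup>2 - (y2 x)\<^sup>2 + 4) +
      y x * (2 * y1 x * along X y1 x - 2 * y2 x * along X y2 x)" for X
    unfolding power2_eq_square
    by (simp add: along_mult along_add along_diff smooth_diffs x algebra_simps)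
  have "along e1 ?E x = 0" "along e2 ?E x = 0"
    unfolding al h' y1_def[symmetric] y2_def[symmetric] using y_pos[OF x]
    by (simp_all add: field_simps power2_eq_square)
  then have z: "fderiv ?E x (e1 x) = 0" "fderiv ?E x (e2 x) = 0"
    by (simp_all add: along_def)
  have lin: "linear (fderiv ?E x)"
    by (rule linear_frechet_derivative[OF smooth_on_differentiable[OF sE x]])
  have "fderiv ?E x v = 0" for v
    by (subst frame_expand[OF x, of v]) (simp add: linear_diff[OF lin] linear_scale[OF lin] z)
  then have Z: "fderiv ?E x = (\<lambda>h. 0)" by (rule ext)
  show "(?E has_derivative (\<lambda>h. 0)) (at x within S)"
    using has_derivative_at_withinI[OF smooth_on_has_derivative[OF sE x], of S] unfolding Z .
qed

text \<open>The factor \<open>F\<close> is an integrating factor for \<open>y\<^sub>2 \<eta>\<^sup>1 + y\<^sub>1 \<eta>\<^sup>2\<close>, found by separating variables.\<close>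

lemma normal_form:
  assumes ne: "S \<noteq> {}"
  shows "\<exists>c v. smooth_on S v \<and> (\<forall>x\<in>S. c < 4 * y x \<and> (\<forall>a b. g x a b =
    (4 * y x - c) * (fderiv v x a * fderiv v x b)
    - y x / (4 * y x - c) * (fderiv y x a * fderiv y x b)))"
proof -
  obtain c where c: "\<And>x. x \<in> S \<Longrightarrow> y x * ((y1 x)\<^sup>2 - (y2 x)\<^sup>2 + 4) = c" using first_integral by blast
  have c1: "y x * ((y2 x)\<^sup>2 - (y1 x)\<^sup>2) = 4 * y x - c" if "x \<in> S" for x
    using c[OF that] by (simp add: algebra_simps)
  have q: "0 < 4 * y x - c" if "x \<in> S" for x
    unfolding c1[OF that, symmetric] using y_pos[OF that] timelike[OF that] by simp
  have qn: "4 * y x - c \<noteq> 0" if "x \<in> S" for x using q[OF that] by simp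
  \<comment> \<open>With this factor the form \<open>\<beta>\<close> vanishes on the gradient of
    \<open>y\<close> and, by the first integral, takes the constant value -3/2 on the Killing field;
    its potential is, up to a constant factor, the flow parameter of that field.\<close>
  define F where "F = (\<lambda>x. sqrt (y x) * inverse (4 * y x - c))"
  have sF: "smooth_on S F" unfolding F_def
    by (intro smooth_ops smooth_y y_pos qn)
  have dF: "along X F x = - F x * (4 * y x + c) / (2 * y x * (4 * y x - c)) * along X y x" if x: "x \<in> S" for X x
  proof -
    have "(\<lambda>x. sqrt (y x)) differentiable (at x)"
      by (rule smooth_on_differentiable[OF smooth_on_sqrt[OF S(1) smooth_y y_pos] x])
    moreover have 4: "(\<lambda>x. 4 * y x - c) differentiable (at x)"
      by (rule smooth_on_differentiable[OF _ x], intro smooth_ops smooth_y)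
    moreover have "(\<lambda>x. inverse (4 * y x - c)) differentiable (at x)"
      by (rule smooth_on_differentiable[OF _ x], intro smooth_ops smooth_y qn)
    moreover have "along X (\<lambda>x. 4 * y x - c) x = 4 * along X y x"
      by (simp add: along_diff along_mult smooth_diffs(1)[OF x])
    moreover have "4 * y x - c \<noteq> 0" using q[OF x] by simp
    ultimately have "along X F x = along X y x / (2 * sqrt (y x)) * inverse (4 * y x - c)
        + sqrt (y x) * (- (4 * along X y x) / (4 * y x - c)\<^sup>2)"
      unfolding F_def by (simp add: along_mult along_sqrt along_inverse smooth_diffs(1)[OF x] y_pos[OF x])
    also have "\<dots> = - F x * (4 * y x + c) / (2 * y x * (4 * y x - c)) * along X y x"
    proof -
      define s where "s = sqrt (y x)"
      define t where "t = 4 * y x - c"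
      have s: "0 < s" "y x = s * s" using y_pos[OF x] by (simp_all add: s_def)
      have t: "0 < t" using q[OF x] by (simp add: t_def)
      have cc: "c = 4 * (s * s) - t" using s by (simp add: t_def)
      show ?thesis
        unfolding F_def s_def[symmetric] t_def[symmetric] s(2) cc using s(1) t
        by (simp add: field_simps power2_eq_square)
    qed
    finally show ?thesis .
  qed
  define \<beta> :: "(real^2, real) form" where
    "\<beta> = (\<lambda>x v. F x * (y2 x * g x v (e1 x) - y1 x * g x v (e2 x)))"
  have \<beta>1: "\<beta> x (e1 x) = F x * y2 x" and \<beta>2: "\<beta> x (e2 x) = F x * y1 x" if "x \<in> S" for x
    using metric_frame[OF that] by (simp_all add: \<beta>_def)
  have xD: "x \<in> D" if "x \<in> S" for x using that S(2) by blast
  have lin: "linear (\<beta> x)" if "x \<in> S" for x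
    unfolding \<beta>_def
    by (rule linearI) (simp_all add: bilinear_ladd[OF g_bilinear[OF xD[OF that]]] bilinear_lmul[OF g_bilinear[OF xD[OF that]]] algebra_simps)
  have sg: "smooth_on S (\<lambda>x. g x v (Y x))" if "smooth_on S Y" for v Y
    by (rule smooth_on_bilinear_apply[OF S(1) D g_smooth g_bilinear smooth_on_ident xD smooth_on_const that])
  have s\<beta>: "smooth_on S (\<lambda>x. \<beta> x v)" for v
    unfolding \<beta>_def
    by (intro smooth_ops sF smooth_y12 sg e1 e2)
  have form: "smooth_form S \<beta>" using lin s\<beta> unfolding smooth_form_def by blast
  have frame0: "ext_deriv \<beta> x (e1 x) (e2 x) = 0" if x: "x \<in> S" for x
  proof -
    have id: "along X (\<lambda>x. x) z = X z" for X :: "real^2 \<Rightarrow> real^2" and z by (simp add: along_def)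
    have "ext_deriv \<beta> x (e1 x) (e2 x) = along e1 (\<lambda>z. \<beta> z (e2 z)) x - along e2 (\<lambda>z. \<beta> z (e1 z)) x - \<beta> x (lie e1 e2 x)"
      using ext_deriv_pullback(2)[OF S(1) x smooth_on_ident e1 e2 S(1) _ lin smooth_on_differentiable[OF s\<beta> x]] x
      by (simp add: id)
    moreover have "along e1 (\<lambda>z. \<beta> z (e2 z)) x = along e1 (\<lambda>z. F z * y1 z) x"
      by (rule along_cong_open[OF S(1) x \<beta>2])
    moreover have "along e2 (\<lambda>z. \<beta> z (e1 z)) x = along e2 (\<lambda>z. F z * y2 z) x"
      by (rule along_cong_open[OF S(1) x \<beta>1])
    moreover have "\<beta> x (lie e1 e2 x) = w1 x * (F x * y2 x) - w2 x * (F x * y1 x)"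
      unfolding lie_frame[OF x] linear_diff[OF lin[OF x]] linear_scale[OF lin[OF x]] \<beta>1[OF x] \<beta>2[OF x] by simp
    ultimately have "ext_deriv \<beta> x (e1 x) (e2 x) = along e1 F x * y1 x + F x * along e1 y1 x
      - (along e2 F x * y2 x + F x * along e2 y2 x) - (w1 x * (F x * y2 x) - w2 x * (F x * y1 x))"
      by (simp add: along_mult smooth_diffs x smooth_on_differentiable[OF sF x])
    also have "\<dots> = F x * (- (4 * y x + c) / (2 * y x * (4 * y x - c)) * ((y1 x)\<^sup>2 - (y2 x)\<^sup>2)
       - ((y1 x)\<^sup>2 - (y2 x)\<^sup>2) / (2 * y x) - 4 / y x)"
      unfolding dF[OF x] y1_def[symmetric] y2_def[symmetric] hessian_eqs[OF x]
      by (simp add: algebra_simps power2_eq_square diff_divide_distrib)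
    \<comment> \<open>The first integral eliminates the gradient; the remaining factor is a rational
      function of \<open>y\<close> and \<open>c\<close> that cancels identically.\<close>
    also have "(y1 x)\<^sup>2 - (y2 x)\<^sup>2 = - (4 * y x - c) / y x"
      using c1[OF x] y_pos[OF x] by (simp add: field_simps)
    also have "- (4 * y x + c) / (2 * y x * (4 * y x - c)) * (- (4 * y x - c) / y x)
       - (- (4 * y x - c) / y x) / (2 * y x) - 4 / y x = 0"
      using q[OF x] y_pos[OF x] by (simp add: field_simps)
    finally show ?thesis by simp
  qed
  have closed: "ext_deriv \<beta> x u v = 0" if x: "x \<in> S" for x u v
  proof -
    let ?D = "\<lambda>v u. fderiv (\<lambda>y. \<beta> y v) x u"
    have 1: "linear (\<lambda>u. ?D v u)" for v
      by (rule linear_frechet_derivative[OF smooth_on_differentiable[OF s\<beta> x]])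
    have 2: "?D (a *\<^sub>R v - b *\<^sub>R w) u = a * ?D v u - b * ?D w u" for a b v w u
    proof -
      have "fderiv (\<lambda>y. \<beta> y (a *\<^sub>R v - b *\<^sub>R w)) x = fderiv (\<lambda>y. a * \<beta> y v - b * \<beta> y w) x"
        by (rule frechet_derivative_cong_open[OF S(1) x]) (simp add: linear_diff[OF lin] linear_scale[OF lin])
      moreover have "((\<lambda>y. a * \<beta> y v - b * \<beta> y w) has_derivative (\<lambda>u. a * ?D v u - b * ?D w u)) (at x)"
        by (intro has_derivative_diff has_derivative_mult_right smooth_on_has_derivative[OF s\<beta> x])
      ultimately show ?thesis by (simp add: frechet_derivative_eq)
    qed
    define a1 a2 b1 b2 where "a1 = g x u (e1 x)" "a2 = g x u (e2 x)" "b1 = g x v (e1 x)" "b2 = g x v (e2 x)"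
    have u: "u = a1 *\<^sub>R e1 x - a2 *\<^sub>R e2 x" and v: "v = b1 *\<^sub>R e1 x - b2 *\<^sub>R e2 x"
      unfolding a1_a2_b1_b2_def using frame_expand[OF x] by auto
    have "ext_deriv \<beta> x u v = (a2 * b1 - a1 * b2) * ext_deriv \<beta> x (e1 x) (e2 x)"
      unfolding ext_deriv_def u v 2 linear_diff[OF 1] linear_scale[OF 1] by (simp add: algebra_simps)
    then show ?thesis using frame0[OF x] by simp
  qed
  obtain x0 where x0: "x0 \<in> S" using ne by blast
  obtain v where sv: "smooth_on S v" and dv: "\<forall>x\<in>S. (v has_derivative \<beta> x) (at x)"
    using poincare_lemma[OF S(1) convex x0 form closed] by blast
  have "g x a b = (4 * y x - c) * (fderiv v x a * fderiv v x b)
    - y x / (4 * y x - c) * (fderiv y x a * fderiv y x b)" if x: "x \<in> S" for x a b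
  proof -
    define a1 a2 b1 b2 where "a1 = g x a (e1 x)" "a2 = - g x a (e2 x)" "b1 = g x b (e1 x)" "b2 = - g x b (e2 x)"
    have a: "a = a1 *\<^sub>R e1 x + a2 *\<^sub>R e2 x" and b: "b = b1 *\<^sub>R e1 x + b2 *\<^sub>R e2 x"
      unfolding a1_a2_b1_b2_def using frame_expand[OF x] by auto
    note B = bilinear_ladd[OF g_bilinear[OF xD[OF x]]] bilinear_radd[OF g_bilinear[OF xD[OF x]]]
      bilinear_lmul[OF g_bilinear[OF xD[OF x]]] bilinear_rmul[OF g_bilinear[OF xD[OF x]]]
    have gab: "g x a b = a1 * b1 - a2 * b2" unfolding a b B metric_frame[OF x] by simp
    have v: "fderiv v x (p *\<^sub>R e1 x + q *\<^sub>R e2 x) = F x * (y2 x * p + y1 x * q)" for p q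
      using frechet_derivative_eq[of v "\<beta> x" x] dv x
      by (simp add: linear_add[OF lin[OF x]] linear_scale[OF lin[OF x]] \<beta>1 \<beta>2 algebra_simps)
    have ly: "linear (fderiv y x)"
      by (rule linear_frechet_derivative[OF smooth_diffs(1)[OF x]])
    have yy: "fderiv y x (p *\<^sub>R e1 x + q *\<^sub>R e2 x) = y1 x * p + y2 x * q" for p q
      by (simp add: linear_add[OF ly] linear_scale[OF ly] y1_def y2_def along_def)
    define t where "t = 4 * y x - c"
    have t: "0 < t" "t = y x * ((y2 x)\<^sup>2 - (y1 x)\<^sup>2)" using q[OF x] c1[OF x] by (simp_all add: t_def)
    have FF: "t * (F x * F x) = y x / t"
      unfolding F_def t_def[symmetric] using t(1) y_pos[OF x] by (simp add: field_simps)
    have "t * ((F x * (y2 x * a1 + y1 x * a2)) * (F x * (y2 x * b1 + y1 x * b2)))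
        = (t * (F x * F x)) * ((y2 x * a1 + y1 x * a2) * (y2 x * b1 + y1 x * b2))" by (simp add: algebra_simps)
    then have "t * ((F x * (y2 x * a1 + y1 x * a2)) * (F x * (y2 x * b1 + y1 x * b2)))
        - y x / t * ((y1 x * a1 + y2 x * a2) * (y1 x * b1 + y2 x * b2))
        = y x / t * ((y2 x * a1 + y1 x * a2) * (y2 x * b1 + y1 x * b2) - (y1 x * a1 + y2 x * a2) * (y1 x * b1 + y2 x * b2))"
      unfolding FF by (simp add: right_diff_distrib)
    \<comment> \<open>The difference of the two products factors as (y2^2 - y1^2) (a1 b1 - a2 b2),
      and \<open>y\<close> times the first factor is \<open>t\<close> by the first integral.\<close>
    also have "\<dots> = (y x * ((y2 x)\<^sup>2 - (y1 x)\<^sup>2)) / t * (a1 * b1 - a2 * b2)"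
      by (simp add: algebra_simps power2_eq_square add_divide_distrib diff_divide_distrib)
    also have "\<dots> = a1 * b1 - a2 * b2" using t(1) unfolding t(2)[symmetric] by simp
    finally show ?thesis unfolding gab unfolding a b v yy t_def[symmetric] by simp
  qed
  then show ?thesis using sv q by (intro exI[of _ c] exI[of _ v]) auto
qed

text \<open>The coefficients \<open>P\<close>, \<open>Q\<close> and the negative reciprocal \<open>R\<close> of the curvature, for \<open>r = 1\<close>.\<close>

definition models :: "((real \<Rightarrow> real) \<times> (real \<Rightarrow> real) \<times> (real \<Rightarrow> real)) set" where
  "models = {(\<lambda>u. (sinh u)\<^sup>2, \<lambda>u. cosh u ^ 4, \<lambda>u. cosh u ^ 4), (\<lambda>u. (cosh u)\<^sup>2, \<lambda>u. sinh u ^ 4, \<lambda>u. sinh u ^ 4),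
     (\<lambda>u. u\<^sup>2, \<lambda>u. u\<^sup>2, \<lambda>u. u ^ 4)}"

lemma derivative_y_through:
  assumes u: "smooth_on S u" and y: "\<And>x. x \<in> S \<Longrightarrow> y x = Y (u x)"
    and Y: "\<And>z. (Y has_real_derivative Y' z) (at z)" and x: "x \<in> S"
  shows "fderiv y x a = Y' (u x) * fderiv u x a"
proof -
  have "((\<lambda>x. Y (u x)) has_derivative (\<lambda>h. Y' (u x) * fderiv u x h)) (at x)"
    by (rule has_derivative_compose[OF smooth_on_has_derivative[OF u x] Y[unfolded has_field_derivative_def]])
  moreover have "fderiv y x = fderiv (\<lambda>x. Y (u x)) x"
    by (rule frechet_derivative_cong_open[OF S(1) x y])
  ultimately show ?thesis by (simp add: frechet_derivative_eq)
qed

lemma local_model: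
  assumes ne: "S \<noteq> {}"
  shows "\<exists>r u v P Q R. 0 < r \<and> smooth_on S u \<and> smooth_on S v \<and> (P, Q, R) \<in> models \<and>
    (\<forall>x\<in>S. r * \<kappa> x = - 1 / R (u x) \<and> (\<forall>a b. g x a b = r *
      (P (u x) * (fderiv v x a * fderiv v x b) -
       Q (u x) * (fderiv u x a * fderiv u x b))))"
proof -
  obtain c v where sv: "smooth_on S v" and c: "\<And>x. x \<in> S \<Longrightarrow> c < 4 * y x"
    and gv: "\<And>x a b. x \<in> S \<Longrightarrow> g x a b =
    (4 * y x - c) * (fderiv v x a * fderiv v x b)
    - y x / (4 * y x - c) * (fderiv y x a * fderiv y x b)"
    using normal_form[OF ne] by blast
  have scale: "smooth_on S (\<lambda>x. C * v x)"
    "x \<in> S \<Longrightarrow> fderiv (\<lambda>x. C * v x) x a = C * fderiv v x a" for C x a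
  proof -
    show "smooth_on S (\<lambda>x. C * v x)" by (intro smooth_ops sv)
    show "fderiv (\<lambda>x. C * v x) x a = C * fderiv v x a" if "x \<in> S"
      using frechet_derivative_eq[OF has_derivative_mult_right[OF smooth_on_has_derivative[OF sv that], of C]] by simp
  qed
  \<comment> \<open>The signs c > 0 and c < 0 are treated together, (q, p) being (cosh, sinh) or
    (sinh, cosh); of these functions only q' = p is differentiated. Setting y = s q^2 gives the du
    part the factor s^2, hence r = s^2, and rescaling v by 2 / sqrt s gives the dv part the same
    factor.\<close>
  have hyperbolic_model: ?thesis
    if s: "0 < s" and su: "smooth_on S u" and yu: "\<And>x. x \<in> S \<Longrightarrow> y x = s * (q (u x))\<^sup>2"
      and t: "\<And>x. x \<in> S \<Longrightarrow> 4 * y x - c = 4 * s * (p (u x))\<^sup>2"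
      and dq: "\<And>z. (q has_real_derivative p z) (at z)"
      and nz: "\<And>x. x \<in> S \<Longrightarrow> p (u x) \<noteq> 0"
      and model: "(\<lambda>u. (p u)\<^sup>2, \<lambda>u. q u ^ 4, \<lambda>u. q u ^ 4) \<in> models" for s u p q
  proof -
    have dy: "fderiv y x a = 2 * s * q (u x) * p (u x) * fderiv u x a" if "x \<in> S" for x a
      by (rule derivative_y_through[OF su yu _ that]) (auto intro!: derivative_eq_intros dq)
    define C where "C = 2 / sqrt s"
    have CC: "C * C = 4 / s" using s by (simp add: C_def)
    have g: "g x a b = s\<^sup>2 * ((p (u x))\<^sup>2 * (fderiv (\<lambda>x. C * v x) x a * fderiv (\<lambda>x. C * v x) x b)
       - q (u x) ^ 4 * (fderiv u x a * fderiv u x b))" if x: "x \<in> S" for x a b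
    proof -
      have "y x / (4 * y x - c) * (2 * s * q (u x) * p (u x))\<^sup>2 = s\<^sup>2 * q (u x) ^ 4"
        unfolding t[OF x] unfolding yu[OF x] using s nz[OF x] by (simp add: field_simps power2_eq_square power4_eq_xxxx)
      then have 2: "y x / (4 * y x - c) * (fderiv y x a * fderiv y x b) =
          s\<^sup>2 * q (u x) ^ 4 * (fderiv u x a * fderiv u x b)"
        unfolding dy[OF x] by algebra
      have "s\<^sup>2 * (C * C) = 4 * s" unfolding CC using s by (simp add: power2_eq_square)
      then have 3: "s\<^sup>2 * ((p (u x))\<^sup>2 * (fderiv (\<lambda>x. C * v x) x a * fderiv (\<lambda>x. C * v x) x b)) =
          4 * s * (p (u x))\<^sup>2 * (fderiv v x a * fderiv v x b)"
        unfolding scale(2)[OF x] by algebra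
      show ?thesis unfolding gv[OF x] 2 right_diff_distrib 3 unfolding t[OF x] by simp
    qed
    show ?thesis
    proof (intro exI conjI ballI allI)
      show "0 < s\<^sup>2" using s by simp
      show "smooth_on S u" by (rule su)
      show "smooth_on S (\<lambda>x. C * v x)" by (rule scale(1))
      show "(\<lambda>u. (p u)\<^sup>2, \<lambda>u. q u ^ 4, \<lambda>u. q u ^ 4) \<in> models" by (rule model)
      fix x assume x: "x \<in> S"
      show "s\<^sup>2 * \<kappa> x = - 1 / q (u x) ^ 4"
        unfolding curvature_y[OF x] yu[OF x] using s by (simp add: power_mult_distrib)
    qed (rule g)
  qed
  consider "0 < c" | "c < 0" | "c = 0" by linarith
  then show ?thesis
  proof cases
    case 1
    \<comment> \<open>With this s, 4 y - c is 4 s (y / s - 1). Timelikeness, in the form c < 4 y,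
      yields y / s > 1, so u is defined and stays away from the zero of sinh.\<close>
    define s where "s = c / 4"
    have s: "0 < s" "c = 4 * s" using 1 by (simp_all add: s_def)
    have ys: "1 < y x / s" if "x \<in> S" for x using c[OF that] s by simp
    define z where "z = (\<lambda>x. sqrt (y x / s))"
    define u where "u = (\<lambda>x. ln (z x + sqrt (z x * z x - 1)))"
    have z: "1 < z x" if "x \<in> S" for x using ys[OF that] by (simp add: z_def)
    have z2: "0 < z x * z x - 1" if "x \<in> S" for x
      using ys[OF that] y_pos[OF that] s(1) by (simp add: z_def)
    have sz: "smooth_on S z" unfolding z_def
      by (intro smooth_ops smooth_y) (use s y_pos in auto)
    have su: "smooth_on S u" unfolding u_def
    proof (rule smooth_on_ln[OF S(1)])
      show "smooth_on S (\<lambda>x. z x + sqrt (z x * z x - 1))"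
        by (intro smooth_ops sz z2)
      show "0 < z x + sqrt (z x * z x - 1)" if "x \<in> S" for x
        using z[OF that] real_sqrt_gt_zero[OF z2[OF that]] by linarith
    qed
    have cu: "cosh (u x) = z x" if "x \<in> S" for x
      using arcosh_real_def[of "z x"] cosh_arcosh_real[of "z x"] z[OF that] by (simp add: u_def power2_eq_square)
    have yu: "y x = s * (cosh (u x))\<^sup>2" if "x \<in> S" for x
      unfolding cu[OF that] z_def using s y_pos[OF that] by simp
    show ?thesis
    proof (rule hyperbolic_model[OF s(1) su yu])
      show "4 * y x - c = 4 * s * (sinh (u x))\<^sup>2" if "x \<in> S" for x
        unfolding yu[OF that] s(2) using cosh_square_eq[of "u x"] by (simp add: algebra_simps)
      show "sinh (u x) \<noteq> 0" if "x \<in> S" for x using cu[OF that] z[OF that] by auto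
      show "(\<lambda>u. (sinh u)\<^sup>2, \<lambda>u. cosh u ^ 4, \<lambda>u. cosh u ^ 4) \<in> models" by (simp add: models_def)
    qed (auto intro!: derivative_eq_intros)
  next
    case 2
    define s where "s = - c / 4"
    have s: "0 < s" "c = - 4 * s" using 2 by (simp_all add: s_def)
    define z where "z = (\<lambda>x. sqrt (y x / s))"
    \<comment> \<open>The inverse hyperbolic sine of \<open>z\<close>, spelled out so that its
      smoothness follows from that of \<open>ln\<close> and \<open>sqrt\<close>.\<close>
    define u where "u = (\<lambda>x. ln (z x + sqrt (z x * z x + 1)))"
    have z: "0 < z x" if "x \<in> S" for x using y_pos[OF that] s by (simp add: z_def)
    have z2: "0 < z x * z x + 1" if "x \<in> S" for x
      using z[OF that] by (simp add: add_pos_pos)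
    have sz: "smooth_on S z" unfolding z_def
      by (intro smooth_ops smooth_y) (use s y_pos in auto)
    have su: "smooth_on S u" unfolding u_def
    proof (rule smooth_on_ln[OF S(1)])
      show "smooth_on S (\<lambda>x. z x + sqrt (z x * z x + 1))"
        by (intro smooth_ops sz z2)
      show "0 < z x + sqrt (z x * z x + 1)" if "x \<in> S" for x
        using z[OF that] real_sqrt_gt_zero[OF z2[OF that]] by linarith
    qed
    have cu: "sinh (u x) = z x" for x
      using arsinh_real_def[of "z x"] sinh_arsinh_real[of "z x"] by (simp add: u_def power2_eq_square)
    have yu: "y x = s * (sinh (u x))\<^sup>2" if "x \<in> S" for x
      unfolding cu z_def using s y_pos[OF that] by simp
    show ?thesis
    proof (rule hyperbolic_model[OF s(1) su yu])
      show "4 * y x - c = 4 * s * (cosh (u x))\<^sup>2" if "x \<in> S" for x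
        unfolding yu[OF that] s(2) using cosh_square_eq[of "u x"] by (simp add: algebra_simps)
      show "(\<lambda>u. (cosh u)\<^sup>2, \<lambda>u. sinh u ^ 4, \<lambda>u. sinh u ^ 4) \<in> models" by (simp add: models_def)
    qed (auto intro!: derivative_eq_intros)
  next
    case 3
    \<comment> \<open>For c = 0 the normal form is 4 y dv^2 - dy^2 / 4, and y = u^2 turns it into
      u^2 (4 dv^2 - du^2); doubling v is the only rescaling, and r = 1.\<close>
    define u where "u = (\<lambda>x. sqrt (y x))"
    have su: "smooth_on S u" unfolding u_def by (rule smooth_on_sqrt[OF S(1) smooth_y y_pos])
    have u: "u x \<noteq> 0" and yu: "y x = (u x)\<^sup>2" if "x \<in> S" for x using y_pos[OF that] by (simp_all add: u_def)
    have dy: "fderiv y x a = 2 * u x * fderiv u x a" if "x \<in> S" for x a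
      by (rule derivative_y_through[OF su yu _ that]) (auto intro!: derivative_eq_intros)
    have g: "g x a b = 1 * ((u x)\<^sup>2 * (fderiv (\<lambda>x. 2 * v x) x a * fderiv (\<lambda>x. 2 * v x) x b)
       - (u x)\<^sup>2 * (fderiv u x a * fderiv u x b))" if x: "x \<in> S" for x a b
      unfolding gv[OF x] dy[OF x] scale(2)[OF x] unfolding 3 yu[OF x] using u[OF x]
      by (simp add: field_simps power2_eq_square)
    show ?thesis
    proof (intro exI conjI ballI allI)
      show "0 < (1::real)" by simp
      show "smooth_on S u" by (rule su)
      show "smooth_on S (\<lambda>x. 2 * v x)" by (rule scale(1))
      show "(\<lambda>u. u\<^sup>2, \<lambda>u. u\<^sup>2, \<lambda>u. u ^ 4) \<in> models" by (simp add: models_def)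
      fix x assume x: "x \<in> S"
      show "1 * \<kappa> x = - 1 / u x ^ 4"
        unfolding curvature_y[OF x] yu[OF x] by simp
    qed (rule g)
  qed
qed

text \<open>A vector annihilated by du and dv is g-orthogonal to all vectors, hence zero. If the
  determinant vanished, the coefficients of du, and likewise those of dv, would form such a vector;
  both differentials would then be zero.\<close>

lemma differentials_independent:
  assumes x: "x \<in> S" and u: "smooth_on S u" and v: "smooth_on S v"
    and g: "\<And>a b. g x a b = r * (P * (fderiv v x a * fderiv v x b) -
       Q * (fderiv u x a * fderiv u x b))"
  shows "fderiv u x (axis 1 1) * fderiv v x (axis 2 1) -
    fderiv u x (axis 2 1) * fderiv v x (axis 1 1) \<noteq> 0"
proof
  let ?u = "fderiv u x" and ?v = "fderiv v x"
  assume 0: "?u (axis 1 1) * ?v (axis 2 1) - ?u (axis 2 1) * ?v (axis 1 1) = 0"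
  have lu: "linear ?u" and lv: "linear ?v"
    using linear_frechet_derivative smooth_on_differentiable[OF u x] smooth_on_differentiable[OF v x] by blast+
  have zero: "w = 0" if "?u w = 0" "?v w = 0" for w
  proof -
    have "g x w b = 0" for b unfolding g that by simp
    then show ?thesis using frame_expand[OF x, of w] by simp
  qed
  have e: "?u (s *\<^sub>R axis 1 1 - t *\<^sub>R axis 2 1) = s * ?u (axis 1 1) - t * ?u (axis 2 1)"
    "?v (s *\<^sub>R axis 1 1 - t *\<^sub>R axis 2 1) = s * ?v (axis 1 1) - t * ?v (axis 2 1)" for s t :: real
    by (simp_all add: linear_diff[OF lu] linear_scale[OF lu] linear_diff[OF lv] linear_scale[OF lv])
  have i: "s = 0 \<and> t = 0" if "s *\<^sub>R axis 1 1 - t *\<^sub>R axis 2 1 = (0 :: real^2)" for s t :: real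
    using that by (simp add: vec_eq_iff forall_2 axis_def)
  have "?u (axis 2 1) = 0 \<and> ?u (axis 1 1) = 0"
    by (rule i, rule zero) (use 0 in \<open>simp_all add: e algebra_simps\<close>)
  moreover have "?v (axis 2 1) = 0 \<and> ?v (axis 1 1) = 0"
    by (rule i, rule zero) (use 0 in \<open>simp_all add: e algebra_simps\<close>)
  ultimately have "axis 1 1 = (0 :: real^2)" by (intro zero) simp_all
  then show False by (simp add: vec_eq_iff forall_2 axis_def)
qed

end

subsection \<open>Charts\<close>

lemma chart_inj: "is_chart X c \<Longrightarrow> inj_on (snd c) (fst c)"
  and chart_topspace: "is_chart X c \<Longrightarrow> fst c \<subseteq> topspace X"
proof -
  assume c: "is_chart X c"
  then show sub: "fst c \<subseteq> topspace X" unfolding is_chart_def using openin_subset by blast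
  have "homeomorphic_map (subtopology X (fst c)) (top_of_set (chart_domain c)) (snd c)"
    using c unfolding is_chart_def by blast
  from homeomorphic_imp_injective_map[OF this] show "inj_on (snd c) (fst c)"
    using sub by (simp add: topspace_subtopology inf.absorb2)
qed

lemma chart_inv_eq:
  assumes "is_chart X c" "p \<in> fst c"
  shows "chart_inv c (snd c p) = p"
  unfolding chart_inv_def by (rule inv_into_f_f[OF chart_inj[OF assms(1)] assms(2)])

lemma chart_image_open:
  assumes c: "is_chart X c" and T: "openin X T" "T \<subseteq> fst c"
  shows "open (snd c ` T)"
proof -
  have "open_map (subtopology X (fst c)) (top_of_set (chart_domain c)) (snd c)"
    using c homeomorphic_imp_open_map unfolding is_chart_def by blast
  moreover have "openin (subtopology X (fst c)) T"
    using c T openin_open_subtopology unfolding is_chart_def by blast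
  ultimately have "openin (top_of_set (chart_domain c)) (snd c ` T)" unfolding open_map_def by blast
  then show ?thesis using c openin_open_eq unfolding is_chart_def by blast
qed

text \<open>The atlas is maximal, so it is enough that the new map is a chart compatible with every
  chart of \<open>A\<close>; its transition maps are those of the old chart composed with
  \<open>\<Psi>\<close> or its inverse \<open>G\<close>.\<close>

lemma recoordinatized_chart:
  assumes A: "smooth_surface X A" and c: "(U0, \<phi>) \<in> A"
    and U1: "open U1" "U1 \<subseteq> \<phi> ` U0" and V: "open V" and hom: "homeomorphism U1 V \<Psi> G"
    and sm: "smooth_on U1 \<Psi>" "smooth_on V G"
  shows "({y \<in> U0. \<phi> y \<in> U1}, \<Psi> \<circ> \<phi>) \<in> A"
proof -
  let ?c = "(U0, \<phi>)" and ?U = "{y \<in> U0. \<phi> y \<in> U1}"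
  let ?d = "(?U, \<Psi> \<circ> \<phi>)"
  have ch: "is_chart X c'" if "c' \<in> A" for c' using A that unfolding smooth_surface_def by blast
  have comp: "compatible c' c''" if "c' \<in> A" "c'' \<in> A" for c' c'' using A that unfolding smooth_surface_def by blast
  note cc = ch[OF c]
  have oU0: "openin X U0" using cc unfolding is_chart_def by simp
  have inv: "chart_inv ?c (\<phi> y) = y" if "y \<in> U0" for y using chart_inv_eq[OF cc] that by simp
  have GP: "G (\<Psi> x) = x" "\<Psi> x \<in> V" if "x \<in> U1" for x using hom that unfolding homeomorphism_def by auto
  have PG: "\<Psi> (G z) = z" "G z \<in> U1" if "z \<in> V" for z using hom that unfolding homeomorphism_def by auto
  have contP: "continuous_on U1 \<Psi>" and contG: "continuous_on V G" and imP: "\<Psi> ` U1 = V"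
    using hom unfolding homeomorphism_def by auto
  have homc: "homeomorphic_map (subtopology X U0) (top_of_set (\<phi> ` U0)) \<phi>"
    using cc unfolding is_chart_def chart_domain_def by simp
  have ts: "topspace (subtopology X U0) = U0" using chart_topspace[OF cc] by (auto simp: topspace_subtopology)
  have contc: "continuous_map (subtopology X U0) (top_of_set (\<phi> ` U0)) \<phi>"
    by (rule homeomorphic_imp_continuous_map[OF homc])
  have oU: "openin X ?U"
  proof -
    have "openin (top_of_set (\<phi> ` U0)) U1" using U1 by (simp add: open_subset)
    from openin_continuous_map_preimage[OF contc this] have "openin (subtopology X U0) ?U" unfolding ts .
    then show ?thesis using oU0 openin_trans_full by blast
  qed
  have imU: "\<phi> ` ?U = U1" using U1(2) by blast
  have imd: "(\<Psi> \<circ> \<phi>) ` ?U = V" unfolding image_comp[symmetric] imU imP ..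
  have tsU: "topspace (subtopology X ?U) = ?U" using openin_subset[OF oU] by (auto simp: topspace_subtopology)
  have injd: "inj_on (\<Psi> \<circ> \<phi>) ?U"
  proof (rule inj_onI)
    fix a b assume ab: "a \<in> ?U" "b \<in> ?U" "(\<Psi> \<circ> \<phi>) a = (\<Psi> \<circ> \<phi>) b"
    then have "G (\<Psi> (\<phi> a)) = G (\<Psi> (\<phi> b))" by simp
    then have "\<phi> a = \<phi> b" using GP(1)[of "\<phi> a"] GP(1)[of "\<phi> b"] ab(1,2) by simp
    then show "a = b" using chart_inj[OF cc] ab by (auto dest: inj_onD)
  qed
  have openimg: "open (\<phi>' ` T)" if "is_chart X (U', \<phi>')" "openin X T" "T \<subseteq> U'" for U' \<phi>' T
    using chart_image_open[OF that(1,2)] that(3) by simp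
  have imgd: "open ((\<Psi> \<circ> \<phi>) ` T)" if T: "openin X T" "T \<subseteq> ?U" for T
  proof -
    have 1: "open (\<phi> ` T)" using openimg[OF cc T(1)] T(2) by blast
    have "(\<Psi> \<circ> \<phi>) ` T = V \<inter> G -` (\<phi> ` T)"
    proof (intro equalityI subsetI)
      fix z assume "z \<in> (\<Psi> \<circ> \<phi>) ` T"
      then obtain y where "y \<in> T" "z = \<Psi> (\<phi> y)" by auto
      then show "z \<in> V \<inter> G -` (\<phi> ` T)" using T(2) GP[of "\<phi> y"] by auto
    next
      fix z assume z: "z \<in> V \<inter> G -` (\<phi> ` T)"
      then obtain y where "y \<in> T" "G z = \<phi> y" by auto
      then have "z = (\<Psi> \<circ> \<phi>) y" using PG[of z] z by auto
      then show "z \<in> (\<Psi> \<circ> \<phi>) ` T" using \<open>y \<in> T\<close> by blast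
    qed
    then show ?thesis using continuous_open_preimage[OF contG V 1] by simp
  qed
  have chart: "is_chart X ?d"
    unfolding is_chart_def chart_domain_def fst_conv snd_conv imd
  proof (intro conjI oU V bijective_open_imp_homeomorphic_map)
    have "continuous_map (subtopology X ?U) (top_of_set U1) \<phi>"
    proof (rule continuous_map_into_subtopology)
      have "continuous_map (subtopology X U0) euclidean \<phi>" using contc continuous_map_in_subtopology by blast
      then show "continuous_map (subtopology X ?U) euclidean \<phi>"
        by (rule continuous_map_from_subtopology_mono) auto
    qed (simp add: tsU image_subset_iff Pi_iff)
    moreover have "continuous_map (top_of_set U1) (top_of_set V) \<Psi>"
      using contP imP by (auto simp: continuous_map_in_subtopology)
    ultimately show "continuous_map (subtopology X ?U) (top_of_set V) (\<Psi> \<circ> \<phi>)"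
      by (rule continuous_map_compose)
    show "open_map (subtopology X ?U) (top_of_set V) (\<Psi> \<circ> \<phi>)"
      unfolding open_map_def
    proof (intro allI impI)
      fix T assume "openin (subtopology X ?U) T"
      then have T: "openin X T" "T \<subseteq> ?U" using openin_open_subtopology[OF oU] by auto
      have "(\<Psi> \<circ> \<phi>) ` T \<subseteq> V" using T(2) imd by blast
      then show "openin (top_of_set V) ((\<Psi> \<circ> \<phi>) ` T)" using imgd[OF T] by (simp add: open_subset)
    qed
    show "(\<Psi> \<circ> \<phi>) ` topspace (subtopology X ?U) = topspace (top_of_set V)" unfolding tsU imd by simp
    show "inj_on (\<Psi> \<circ> \<phi>) (topspace (subtopology X ?U))" unfolding tsU by (rule injd)
  qed
  have invd: "chart_inv ?d z = chart_inv ?c (G z)" if zV: "z \<in> V" for z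
  proof -
    obtain y where y: "y \<in> ?U" "z = (\<Psi> \<circ> \<phi>) y" using zV imd by blast
    have "chart_inv ?d z = y" using chart_inv_eq[OF chart, of y] y by simp
    moreover have "G z = \<phi> y" using y GP by simp
    ultimately show ?thesis using inv y by simp
  qed
  have "compatible ?d c'" if c': "c' \<in> A" for c'
  proof -
    obtain U' \<phi>' where c'e: "c' = (U', \<phi>')" by (cases c')
    have ch': "is_chart X (U', \<phi>')" using ch[OF c'] unfolding c'e .
    have oU': "openin X U'" using ch' unfolding is_chart_def by simp
    have s1: "smooth_on (\<phi> ` (U0 \<inter> U')) (transition ?c c')" and s2: "smooth_on (\<phi>' ` (U0 \<inter> U')) (transition c' ?c)"
      using comp[OF c c'] unfolding compatible_def c'e by (simp_all add: Int_commute)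
    have oI: "openin X (U0 \<inter> U')" "openin X (?U \<inter> U')" using oU oU0 oU' by auto
    have o1: "open (\<phi> ` (U0 \<inter> U'))" by (rule openimg[OF cc oI(1)]) blast
    have o3: "open (\<phi>' ` (?U \<inter> U'))" by (rule openimg[OF ch' oI(2)]) blast
    have o4: "open ((\<Psi> \<circ> \<phi>) ` (?U \<inter> U'))" by (rule imgd[OF oI(2)]) blast
    have sub4: "(\<Psi> \<circ> \<phi>) ` (?U \<inter> U') \<subseteq> V" using imd by blast
    have "smooth_on ((\<Psi> \<circ> \<phi>) ` (?U \<inter> U')) (\<lambda>z. transition ?c c' (G z))"
    proof (rule smooth_on_compose[OF o4 o1 s1 smooth_on_subset[OF sm(2) sub4]])
      fix z assume "z \<in> (\<Psi> \<circ> \<phi>) ` (?U \<inter> U')"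
      then obtain y where "y \<in> ?U \<inter> U'" "z = \<Psi> (\<phi> y)" by auto
      then show "G z \<in> \<phi> ` (U0 \<inter> U')" using GP(1)[of "\<phi> y"] by auto
    qed
    then have 1: "smooth_on ((\<Psi> \<circ> \<phi>) ` (?U \<inter> U')) (transition ?d c')"
    proof (rule smooth_on_cong[OF o4, rotated])
      fix z assume "z \<in> (\<Psi> \<circ> \<phi>) ` (?U \<inter> U')"
      then have "z \<in> V" using sub4 by blast
      then show "transition ?c c' (G z) = transition ?d c' z" by (simp add: transition_def invd)
    qed
    have tr: "transition c' ?c z \<in> U1" if z: "z \<in> \<phi>' ` (?U \<inter> U')" for z
    proof -
      obtain y where y: "y \<in> ?U \<inter> U'" "z = \<phi>' y" using z by blast
      then have "chart_inv c' z = y" using chart_inv_eq[OF ch', of y] unfolding c'e by simp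
      then show ?thesis using y by (simp add: transition_def)
    qed
    have "smooth_on (\<phi>' ` (?U \<inter> U')) (\<lambda>z. \<Psi> (transition c' ?c z))"
      by (rule smooth_on_compose[OF o3 U1(1) sm(1) smooth_on_subset[OF s2] tr]) auto
    then have 2: "smooth_on (\<phi>' ` (?U \<inter> U')) (transition c' ?d)"
      by (simp add: transition_def o_def)
    show ?thesis unfolding compatible_def using 1 2 by (simp add: c'e Int_commute)
  qed
  then show ?thesis using chart A unfolding smooth_surface_def by blast
qed

theorem theorem14:
  fixes X :: "'a topology"
    and A :: "'a chart set"
    and g :: "'a chart \<Rightarrow> local_metric"
    and \<omega> :: "'a chart \<Rightarrow> (frame2, real) form"
    and K :: "'a \<Rightarrow> real"
  assumes "smooth_surface X A"
    and "lorentzian_metric A g"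
    and "connection_and_curvature A g \<omega> K"
    and "hyperbolic X K"
    and "darboux_integrable X A g \<omega> K"
    and "timelike_killing_field A g K"
  shows "\<forall>p\<in>topspace X. \<exists>U \<phi> r. (U, \<phi>) \<in> A \<and> p \<in> U \<and> r > 0 \<and>
    ((\<forall>y\<in>U. let u = \<phi> y $ 1 in
        (\<forall>a b. g (U, \<phi>) (\<phi> y) a b =
           r * ((sinh u)\<^sup>2 * (a $ 2 * b $ 2) - (cosh u) ^ 4 * (a $ 1 * b $ 1))) \<and>
        r * K y = - 1 / (cosh u) ^ 4) \<or>
     (\<forall>y\<in>U. let u = \<phi> y $ 1 in
        (\<forall>a b. g (U, \<phi>) (\<phi> y) a b =
           r * ((cosh u)\<^sup>2 * (a $ 2 * b $ 2) - (sinh u) ^ 4 * (a $ 1 * b $ 1))) \<and>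
        r * K y = - 1 / (sinh u) ^ 4) \<or>
     (\<forall>y\<in>U. let u = \<phi> y $ 1 in
        (\<forall>a b. g (U, \<phi>) (\<phi> y) a b =
           r * (u\<^sup>2 * (a $ 2 * b $ 2 - a $ 1 * b $ 1))) \<and>
        r * K y = - 1 / u ^ 4))"
proof (rule ballI, goal_cases)
  case p: (1 p)
  have "(\<Union>c\<in>A. fst c) = topspace X" using assms(1) unfolding smooth_surface_def by blast
  then obtain c where "c \<in> A" "p \<in> fst c" using p by blast
  then obtain U0 \<phi> where c: "(U0, \<phi>) \<in> A" and pU: "p \<in> U0" by (cases c) auto
  let ?c = "(U0, \<phi>)"
  let ?D = "\<phi> ` U0" and ?g = "g (U0, \<phi>)" and ?\<omega> = "\<omega> (U0, \<phi>)" and ?\<kappa> = "K \<circ> chart_inv (U0, \<phi>)"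
  have dom: "chart_domain ?c = ?D" by (simp add: chart_domain_def)
  have ch: "is_chart X ?c" using assms(1) c unfolding smooth_surface_def by blast
  have oD: "open ?D" using ch dom unfolding is_chart_def by simp
  have inv: "chart_inv ?c (\<phi> y) = y" if "y \<in> U0" for y using chart_inv_eq[OF ch, of y] that by simp
  have lor: "(\<forall>a b. smooth_on ?D (\<lambda>x. ?g x a b)) \<and> (\<forall>x\<in>?D. bilinear (?g x) \<and> (\<forall>a b. ?g x a b = ?g x b a) \<and>
           (\<exists>e1 e2. orthonormal_pair ?g x e1 e2))"
    using bspec[OF conjunct1[OF assms(2)[unfolded lorentzian_metric_def]] c] unfolding dom .
  have gs: "\<And>a b. smooth_on ?D (\<lambda>x. ?g x a b)" and bil: "\<And>x. x \<in> ?D \<Longrightarrow> bilinear (?g x)"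
    and sym: "\<And>x a b. x \<in> ?D \<Longrightarrow> ?g x a b = ?g x b a" using lor by blast+
  have neg: "?\<kappa> x < 0" if "x \<in> ?D" for x
    using that assms(4) inv chart_topspace[OF ch] unfolding hyperbolic_def by auto
  define x0 where "x0 = \<phi> p"
  have x0: "x0 \<in> ?D" using pU by (simp add: x0_def)
  obtain a b where on: "orthonormal_pair ?g x0 a b" using lor x0 by blast
  obtain S' e1 e2 where S': "open S'" "x0 \<in> S'" "S' \<subseteq> ?D" and e: "smooth_on S' e1" "smooth_on S' e2"
    and ont: "\<forall>x\<in>S'. orthonormal_pair ?g x (e1 x) (e2 x)"
    using local_orthonormal_frame[OF oD gs bil sym x0 on] by blast
  obtain d where d: "0 < d" "ball x0 d \<subseteq> S'" using S' openE by blast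
  \<comment> \<open>A ball, since constancy of the first integral and the Poincare lemma are applied
    on a convex set.\<close>
  define S where "S = ball x0 d"
  have SS: "open S" "x0 \<in> S" "convex S" "S \<subseteq> S'" "S \<subseteq> ?D" using d S' by (auto simp: S_def)
  interpret moving_frame ?D S ?g ?\<omega> ?\<kappa> e1 e2
  proof
    show "structure_equations ?D ?g ?\<omega> ?\<kappa>"
      using bspec[OF assms(3)[unfolded connection_and_curvature_def] c] unfolding dom .
    show "smooth_on S e1" "smooth_on S e2" using e SS(4) smooth_on_subset by blast+
    show "\<And>x. x \<in> S \<Longrightarrow> orthonormal_pair ?g x (e1 x) (e2 x)" using ont SS(4) by blast
  qed (fact oD SS(1) SS(5) gs bil sym)+
  have negS: "\<And>x. x \<in> S \<Longrightarrow> ?\<kappa> x < 0" using neg SS(5) by blast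
  \<comment> \<open>The point \<open>p\<close> shows that the surface is nonempty, so the hyperbolic
    alternative of \<open>darboux_integrable\<close> holds; its system with s = 1 is
    selected.\<close>
  have "\<not> elliptic X K" using assms(4) p unfolding hyperbolic_def elliptic_def by force
  then have "singular_system_integrable ?c ?g ?\<omega> K (1::real)"
    using assms(5) c unfolding darboux_integrable_def by blast
  then have int: "has_transverse_frobenius (frame_pairs ?D ?g)
      (embedding_system ?g ?\<omega>) (singular_system ?g ?\<omega> ?\<kappa> (1::real))"
    unfolding singular_system_integrable_def dom .
  have time: "(y1 x)\<^sup>2 < (y2 x)\<^sup>2" if x: "x \<in> S" for x
  proof (rule timelike_y[OF negS x])
    have "(x, e1 x, e2 x) \<in> frame_bundle (chart_domain ?c) ?g"
      using frame_at_in[OF x] unfolding frame_at_def dom .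
    then show "0 < ?g x (killing_field ?\<kappa> (x, e1 x, e2 x)) (killing_field ?\<kappa> (x, e1 x, e2 x))"
      using assms(6) c unfolding timelike_killing_field_def by fastforce
  qed
  interpret darboux_frame ?D S ?g ?\<omega> ?\<kappa> e1 e2
  proof
    fix x assume x: "x \<in> S"
    \<comment> \<open>The strict inequality for the timelike Killing field excludes zeros of
      dy.\<close>
    have nz: "y1 x \<noteq> 0 \<or> y2 x \<noteq> 0" using time[OF x] by auto
    show "y_hessian x" by (rule y_hessian_if_integrable[OF _ x int nz]) (rule negS)
  qed (fact negS SS(3) time)+
  obtain r u v P Q R where r: "0 < r" and u: "smooth_on S u" and v: "smooth_on S v"
    and PQR: "(P, Q, R) \<in> models" and K: "\<And>x. x \<in> S \<Longrightarrow> r * ?\<kappa> x = - 1 / R (u x)"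
    and gm: "\<And>x a b. x \<in> S \<Longrightarrow> ?g x a b = r *
      (P (u x) * (fderiv v x a * fderiv v x b) -
       Q (u x) * (fderiv u x a * fderiv u x b))"
    using local_model SS(2) by blast
  define \<Psi> where "\<Psi> = (\<lambda>x. vector [u x, v x] :: real^2)"
  have s\<Psi>: "smooth_on S \<Psi>" unfolding \<Psi>_def by (rule smooth_on_vector2[OF SS(1) u v])
  have \<Psi>c: "\<Psi> x $ 1 = u x" "\<Psi> x $ 2 = v x" for x by (simp_all add: \<Psi>_def)
  have d\<Psi>: "fderiv \<Psi> x w $ 1 = fderiv u x w"
    "fderiv \<Psi> x w $ 2 = fderiv v x w" if "x \<in> S" for x w
  proof -
    have "((\<lambda>x. \<Psi> x $ i) has_derivative (\<lambda>w. fderiv \<Psi> x w $ i)) (at x)" for i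
      by (rule bounded_linear.has_derivative[OF bounded_linear_vec_nth smooth_on_has_derivative[OF s\<Psi> that]])
    from frechet_derivative_eq[OF this]
    show "fderiv \<Psi> x w $ 1 = fderiv u x w"
      "fderiv \<Psi> x w $ 2 = fderiv v x w"
      unfolding \<Psi>c[symmetric] by simp_all
  qed
  have "\<exists>U1 V G. open U1 \<and> U1 \<subseteq> S \<and> x0 \<in> U1 \<and> open V \<and> homeomorphism U1 V \<Psi> G \<and> smooth_on V G"
    by (rule local_diffeomorphism[OF SS(1,2) s\<Psi>])
      (use differentials_independent[OF SS(2) u v gm[OF SS(2)]] in \<open>simp add: d\<Psi>[OF SS(2)]\<close>)
  then obtain U1 V G where U1: "open U1" "U1 \<subseteq> S" "x0 \<in> U1" and V: "open V"
    and hom: "homeomorphism U1 V \<Psi> G" and sG: "smooth_on V G" by blast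
  let ?U = "{y \<in> U0. \<phi> y \<in> U1}"
  let ?d = "(?U, \<Psi> \<circ> \<phi>)"
  have d: "?d \<in> A"
    by (rule recoordinatized_chart[OF assms(1) c U1(1) _ V hom smooth_on_subset[OF s\<Psi> U1(2)] sG])
      (use U1(2) SS(5) in blast)
  have metric: "g ?d ((\<Psi> \<circ> \<phi>) y) a b = r * (P (u (\<phi> y)) * (a $ 2 * b $ 2) - Q (u (\<phi> y)) * (a $ 1 * b $ 1))"
    and curv: "r * K y = - 1 / R (u (\<phi> y))" if y: "y \<in> ?U" for y a b
  proof -
    let ?x = "\<phi> y"
    have x: "?x \<in> U1" "?x \<in> S" using y U1(2) by auto
    show "r * K y = - 1 / R (u ?x)" using K[OF x(2)] inv y by simp
    have xV: "\<Psi> ?x \<in> V" and Gx: "G (\<Psi> ?x) = ?x" using hom x(1) unfolding homeomorphism_def by auto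
    have tr: "transition ?c ?d z = \<Psi> z" if z: "z \<in> U1" for z
    proof -
      have "z \<in> ?D" using z U1(2) SS(5) by blast
      then obtain q where "q \<in> U0" "z = \<phi> q" by blast
      then show ?thesis using inv by (simp add: transition_def)
    qed
    have trd: "fderiv (transition ?c ?d) ?x = fderiv \<Psi> ?x"
      by (rule frechet_derivative_cong_open[OF U1(1) x(1) tr])
    \<comment> \<open>The transformation law of the metric is applied to the vectors that the
      coordinate change sends to \<open>a\<close> and \<open>b\<close>; on them du and dv are the
      first and second components.\<close>
    let ?a = "fderiv G (\<Psi> ?x) a" and ?b = "fderiv G (\<Psi> ?x) b"
    have chain: "fderiv \<Psi> ?x (fderiv G (\<Psi> ?x) w) = w" for w
    proof -
      have "(\<Psi> has_derivative fderiv \<Psi> ?x) (at (G (\<Psi> ?x)))"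
        unfolding Gx by (rule smooth_on_has_derivative[OF s\<Psi> x(2)])
      from has_derivative_compose[OF smooth_on_has_derivative[OF sG xV] this]
      have "((\<lambda>z. \<Psi> (G z)) has_derivative (\<lambda>w. fderiv \<Psi> ?x (fderiv G (\<Psi> ?x) w))) (at (\<Psi> ?x))" .
      then have "((\<lambda>z. z) has_derivative (\<lambda>w. fderiv \<Psi> ?x (fderiv G (\<Psi> ?x) w))) (at (\<Psi> ?x))"
        by (rule has_derivative_transform_within_open[OF _ V xV]) (use hom in \<open>auto simp: homeomorphism_def\<close>)
      from has_derivative_unique[OF this has_derivative_ident] show ?thesis by (rule fun_cong)
    qed
    have "\<forall>c\<in>A. \<forall>c'\<in>A. \<forall>x\<in>snd c ` (fst c \<inter> fst c'). \<forall>a b. g c x a b = g c' (transition c c' x)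
          (fderiv (transition c c') x a) (fderiv (transition c c') x b)"
      using assms(2) unfolding lorentzian_metric_def by (rule conjunct2)
    from this[rule_format, OF c d, of ?x ?a ?b]
    have "?g ?x ?a ?b = g ?d (\<Psi> ?x) a b" using y by (simp add: trd tr x(1) chain)
    moreover have "fderiv u ?x (fderiv G (\<Psi> ?x) w) = w $ 1"
      "fderiv v ?x (fderiv G (\<Psi> ?x) w) = w $ 2" for w
      unfolding d\<Psi>[OF x(2), symmetric] chain by simp_all
    ultimately show "g ?d ((\<Psi> \<circ> \<phi>) y) a b = r * (P (u ?x) * (a $ 2 * b $ 2) - Q (u ?x) * (a $ 1 * b $ 1))"
      using gm[OF x(2), of ?a ?b] by simp
  qed
  have up: "(\<Psi> \<circ> \<phi>) y $ 1 = u (\<phi> y)" for y by (simp add: \<Psi>c)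
  have M: "\<forall>y\<in>?U. (\<forall>a b. g ?d ((\<Psi> \<circ> \<phi>) y) a b = r * (P (u (\<phi> y)) * (a $ 2 * b $ 2) - Q (u (\<phi> y)) * (a $ 1 * b $ 1))) \<and>
      r * K y = - 1 / R (u (\<phi> y))"
    using metric curv by blast
  have pU1: "p \<in> ?U" using pU U1(3) by (simp add: x0_def)
  consider "P = (\<lambda>u. (sinh u)\<^sup>2)" "Q = (\<lambda>u. cosh u ^ 4)" "R = (\<lambda>u. cosh u ^ 4)"
    | "P = (\<lambda>u. (cosh u)\<^sup>2)" "Q = (\<lambda>u. sinh u ^ 4)" "R = (\<lambda>u. sinh u ^ 4)"
    | "P = (\<lambda>u. u\<^sup>2)" "Q = (\<lambda>u. u\<^sup>2)" "R = (\<lambda>u. u ^ 4)"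
    using PQR unfolding models_def by blast
  then show ?case
  proof cases
    case 1
    show ?thesis
      by (intro exI[of _ ?U] exI[of _ "\<Psi> \<circ> \<phi>"] exI[of _ r] conjI d pU1 r, unfold up Let_def,
          rule disjI1, rule M[unfolded 1])
  next
    case 2
    show ?thesis
      by (intro exI[of _ ?U] exI[of _ "\<Psi> \<circ> \<phi>"] exI[of _ r] conjI d pU1 r, unfold up Let_def,
          rule disjI2, rule disjI1, rule M[unfolded 2])
  next
    case 3
    show ?thesis
      by (intro exI[of _ ?U] exI[of _ "\<Psi> \<circ> \<phi>"] exI[of _ r] conjI d pU1 r, unfold up Let_def,
          rule disjI2, rule disjI2, unfold right_diff_distrib, rule M[unfolded 3 right_diff_distrib])
  qed
qed

end
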